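(* Let $\Gamma$ be a cuspidal tree lattice acting on the uniform tree $Y$, and let $X=\Gamma\backslash Y$. For $|u|$ small enough, the operator $1-uA+u^2Q$ on $S(VX)$ is of connected determinant class and one has $$Z(u)^{-1}=\frac{\det(1-uA+u^2Q)}{(1-u^2)^{\chi(X_{\mathrm{fin}})}},$$ where $X_{\mathrm{fin}}$ is the finite part of $X$, i.e. $X$ minus the cusp sections. If $X$ has at least one cusp, then $1-uA+u^2Q$ is not of determinant class.
   Context: Graphs: an oriented edge $e$ has origin $o(e)$, terminus $t(e)$ and reverse $e^{-1}$; $VX$ is the set of vertices of $X$. A path is a sequence $(e_1,\dots,e_n)$ of oriented edges with $t(e_j)=o(e_{j+1})$ for $1\le j\le n-1$; it is reduced if $e_{j+1}\ne e_j^{-1}$ for all $1\le j\le n-1$. $\chi$ denotes the Euler number (vertices minus unoriented edges) of a finite graph. Tree lattices: a tree lattice is a group $\Gamma$ with an action on a locally finite tree $Y$ such that all edge stabilizers $\Gamma_e$ are finite and $\sum_{e \bmod \Gamma} 1/|\Gamma_e|<\infty$. Throughout, $Y$ is uniform, i.e. $G\backslash Y$ is finite where $G=\mathrm{Aut}(Y)$, and $\Gamma$ acts orientation preservingly, so that the oriented edges of $X=\Gamma\backslash Y$ are the $\Gamma$-orbits of oriented edges of $Y$. Cusps: a ray in $Y$ is an infinite reduced path; two rays $r,s$ are equivalent if there are $N\in\mathbb N$, $k\in\mathbb Z$ with $r_{j+k}=s_j$ for all $j\ge N$; the set of equivalence classes is the boundary $\partial Y$. For $c\in\partial Y$, two vertices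 $x,y$ lie in the same horocycle with respect to $c$ if there are rays in $c$ starting at $x$ and $y$ and an $n\ge 0$ such that the two rays have the same $n$-th vertex. Let $P_c$ be the stabilizer of $c$ in $G$ and $N_c\subset P_c$ the subgroup of elements stabilizing one (hence every) horocycle with respect to $c$. The point $c$ is a cusp of $\Gamma$ if $\Gamma\cap P_c=\Gamma\cap N_c$ and $\Gamma\cap N_c$ acts transitively on some horocycle with respect to $c$; then a ray in $c$, or rather its image in $X$, is called a cusp section. The cusp is periodic if, along a ray in $c$ with vertices $x_1,x_2,\dots$, the sequence of valencies $\mathrm{val}(x_n)$ (in $Y$) is eventually periodic. $\Gamma$ is cuspidal if $X$ is the union of a finite graph $X_{\mathrm{fin}}$ and finitely many periodic cusp sections; the cusp sections are infinite rays emanating from $X_{\mathrm{fin}}$ (each meeting $X_{\mathrm{fin}}$ only in its initial vertex), so that they do not contribute to the Euler number. Cycles, weights, zeta function: a path $(e_1,\dots,e_n)$ in $X$ is closed if $t(e_n)=o(e_1)$; a cycle is an equivalence class of closed paths under cyclic shifts; $l(c)$ is its length. A cycle is prime if it is not a power of a shorter one. For an oriented edge $e$ of $Y$ put $w(e)=|\Gamma_{o(e)}e|$, and for an edge $e$ of $X$ put $w(e)=w(\tilde e)$ for any preimage $\tilde e$ in $Y$. For edges $e,e'$ of $X$ with $t(e)=o(e')$ put $w(e,e')=w(e')$ if $e'\neq e^{-1}$ and $w(e,e')=w(e')-1$ if $e'=e^{-1}$. For a closed path $p=(e_1,\dots,e_n)$ let $w(p)=\prod_{j \bmod n}w(e_j,e_{j+1})$;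 it depends only on the cycle. The Bass-Ihara zeta function is $Z(u)=\prod_c(1-w(c)u^{l(c)})^{-1}$ (for small $|u|$), the product over all prime cycles $c$ in $X$. Operators $A$, $Q$: on formal sums of vertices of $Y$ put $Ay=\sum_{y'}y'$ (sum over all neighbours $y'$ of $y$ in $Y$) and $Qy=(\mathrm{val}(y)-1)y$, where $\mathrm{val}(y)$ is the valency of $y$ in $Y$. Both commute with $\Gamma$ and hence act on $\Gamma$-invariant formal sums; identifying a vertex $x\in VX$ with the formal sum $\sum_{y\in x}y$ over the orbit $x$, they induce operators $A,Q$ on $S(VX)$. Determinants: for a set $I$ let $P(I)=\prod_{i\in I}\mathbb C i$ and $S(I)=\bigoplus_{i\in I}\mathbb C i$. For a linear $B:S(I)\to P(I)$ and $F\subset I$ let $B_F$ be the composition $S(F)\hookrightarrow S(I)\xrightarrow{B}P(I)\twoheadrightarrow P(F)$. $B$ is of determinant class if $\lim_F\det(B_F)$ over the net of all finite $F\subset I$ exists and is $\ne0$. For $j\in F$ let $\tilde B_F(\{j\})$ be the set of $i\in F$ whose coefficient in $B_Fj$ is nonzero, and $\tilde B_F(M)=\bigcup_{j\in M}\tilde B_F(\{j\})$ for $M\subset F$; $M\subset F$ is $B_F$-stable if $\tilde B_F(M)\subset M$. A subset $F\subset I$ is $B$-irreducible if $\emptyset$ and $F$ are its only $B_F$-stable subsets, and $B$-connected if whenever $F=M\cup N$ with disjoint $B_F$-stable sets $M,N$, then $M=\emptyset$ or $N=\emptyset$. $B$ is of connected determinant class if $I$ is $B$-irreducible and $\lim_F\det(B_F)$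 exists, the limit being over all $B$-connected finite subsets $F\subset I$; this limit is then denoted $\det(B)$.
   Formalization: The exponent is χ of X minus pairwise disjoint cusp sections, initial vertices removed too, i.e. χ(X_fin) minus the number of sections (χ(X_fin) itself fails for PGL_2(F_q[t])); and u=0 is excluded, where the operator is the identity and the claims fail. *)

theory Defs
  imports
    "HOL-Analysis.Analysis"
    "HOL-Algebra.Group_Action"
    "HOL-Combinatorics.Permutations"
    "Graph_Theory.Bidirected_Digraph"
    "Graph_Theory.Digraph_Component"
begin

section \<open>Graphs and trees\<close>

text \<open>
  A graph in the sense of Serre is a \<open>bidirected_digraph\<close>: the arcs are the oriented edges,
  \<open>tail\<close> is the origin, \<open>head\<close> the terminus and \<open>arev\<close> the edge reversal. Loops and
  multiple edges are allowed.
\<close>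

definition reduced :: "('e \<Rightarrow> 'e) \<Rightarrow> 'e list \<Rightarrow> bool" where
  "reduced arev p \<longleftrightarrow> (\<forall>j. Suc j < length p \<longrightarrow> p ! Suc j \<noteq> arev (p ! j))"

definition is_tree :: "('v, 'e) pre_digraph \<Rightarrow> ('e \<Rightarrow> 'e) \<Rightarrow> bool" where
  "is_tree Y arev \<longleftrightarrow> bidirected_digraph Y arev \<and> strongly_connected Y \<and>
     \<not> (\<exists>v p. p \<noteq> [] \<and> pre_digraph.awalk Y v p v \<and> reduced arev p)"

abbreviation val :: "('v, 'e) pre_digraph \<Rightarrow> 'v \<Rightarrow> nat" where
  "val \<equiv> out_degree"

definition locally_finite :: "('v, 'e) pre_digraph \<Rightarrow> bool" where
  "locally_finite Y \<longleftrightarrow> (\<forall>v\<in>verts Y. finite (out_arcs Y v))"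

definition graph_aut ::
    "('v, 'e) pre_digraph \<Rightarrow> ('e \<Rightarrow> 'e) \<Rightarrow> ('v \<Rightarrow> 'v) \<Rightarrow> ('e \<Rightarrow> 'e) \<Rightarrow> bool" where
  "graph_aut Y arev f h \<longleftrightarrow> bij_betw f (verts Y) (verts Y) \<and> bij_betw h (arcs Y) (arcs Y) \<and>
     (\<forall>e\<in>arcs Y. tail Y (h e) = f (tail Y e) \<and> head Y (h e) = f (head Y e) \<and>
        h (arev e) = arev (h e))"

definition uniform :: "('v, 'e) pre_digraph \<Rightarrow> ('e \<Rightarrow> 'e) \<Rightarrow> bool" where
  "uniform Y arev \<longleftrightarrow>
     finite {{f v | f h. graph_aut Y arev f h} | v. v \<in> verts Y} \<and>
     finite {{h e | f h. graph_aut Y arev f h} | e. e \<in> arcs Y}"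

definition euler_number :: "('v, 'e) pre_digraph \<Rightarrow> ('e \<Rightarrow> 'e) \<Rightarrow> int" where
  "euler_number G arev = int (card (verts G)) - int (card ((\<lambda>e. {e, arev e}) ` arcs G))"


section \<open>Tree lattices and their quotient graphs\<close>

text \<open>The value of a function on a class (an orbit, a cycle) on which it is constant.\<close>

definition class_value :: "('a \<Rightarrow> 'b) \<Rightarrow> 'a set \<Rightarrow> 'b" where
  "class_value f c = the_elem (f ` c)"

text \<open>
  A group \<open>\<Gamma>\<close> acts on a graph through an action \<open>av\<close> on vertices and an action \<open>ae\<close> on oriented
  edges. Neither action needs to be faithful.
\<close>

definition graph_action ::
    "('v, 'e) pre_digraph \<Rightarrow> ('e \<Rightarrow> 'e) \<Rightarrow> ('g, 'm) monoid_scheme \<Rightarrow>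
     ('g \<Rightarrow> 'v \<Rightarrow> 'v) \<Rightarrow> ('g \<Rightarrow> 'e \<Rightarrow> 'e) \<Rightarrow> bool" where
  "graph_action Y arev \<Gamma> av ae \<longleftrightarrow>
     group_action \<Gamma> (verts Y) av \<and> group_action \<Gamma> (arcs Y) ae \<and>
     (\<forall>g\<in>carrier \<Gamma>. \<forall>e\<in>arcs Y.
        tail Y (ae g e) = av g (tail Y e) \<and> head Y (ae g e) = av g (head Y e) \<and>
        ae g (arev e) = arev (ae g e))"

definition orientation_preserving ::
    "('v, 'e) pre_digraph \<Rightarrow> ('e \<Rightarrow> 'e) \<Rightarrow> ('g, 'm) monoid_scheme \<Rightarrow> ('g \<Rightarrow> 'e \<Rightarrow> 'e) \<Rightarrow> bool" where
  "orientation_preserving Y arev \<Gamma> ae \<longleftrightarrow> (\<forall>g\<in>carrier \<Gamma>. \<forall>e\<in>arcs Y. ae g e \<noteq> arev e)"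

definition tree_lattice ::
    "('v, 'e) pre_digraph \<Rightarrow> ('e \<Rightarrow> 'e) \<Rightarrow> ('g, 'm) monoid_scheme \<Rightarrow>
     ('g \<Rightarrow> 'v \<Rightarrow> 'v) \<Rightarrow> ('g \<Rightarrow> 'e \<Rightarrow> 'e) \<Rightarrow> bool" where
  "tree_lattice Y arev \<Gamma> av ae \<longleftrightarrow>
     is_tree Y arev \<and> locally_finite Y \<and> graph_action Y arev \<Gamma> av ae \<and>
     (\<forall>e\<in>arcs Y. finite (stabilizer \<Gamma> ae e)) \<and>
     (class_value (\<lambda>e. 1 / real (card (stabilizer \<Gamma> ae e)))) summable_on orbits \<Gamma> (arcs Y) ae"

text \<open>
  The quotient \<open>\<Gamma>\<setminus>Y\<close>. Since \<open>\<Gamma>\<close> acts by automorphisms, the image of an edge orbit under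
  \<open>tail\<close>, \<open>head\<close> or \<open>arev\<close> is again an orbit; the reversal of the quotient is \<open>(`) arev\<close>.
\<close>

definition quotient_graph ::
    "('v, 'e) pre_digraph \<Rightarrow> ('g, 'm) monoid_scheme \<Rightarrow> ('g \<Rightarrow> 'v \<Rightarrow> 'v) \<Rightarrow> ('g \<Rightarrow> 'e \<Rightarrow> 'e) \<Rightarrow>
     ('v set, 'e set) pre_digraph" where
  "quotient_graph Y \<Gamma> av ae =
     \<lparr> verts = orbits \<Gamma> (verts Y) av, arcs = orbits \<Gamma> (arcs Y) ae,
       tail = (`) (tail Y), head = (`) (head Y) \<rparr>"


section \<open>Ends, horocycles and cusps\<close>

definition rays :: "('v, 'e) pre_digraph \<Rightarrow> ('e \<Rightarrow> 'e) \<Rightarrow> (nat \<Rightarrow> 'e) set" where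
  "rays Y arev = {r. \<forall>j. r j \<in> arcs Y \<and> head Y (r j) = tail Y (r (Suc j)) \<and> r (Suc j) \<noteq> arev (r j)}"

definition ray_equiv :: "('v, 'e) pre_digraph \<Rightarrow> ('e \<Rightarrow> 'e) \<Rightarrow> (nat \<Rightarrow> 'e) rel" where
  "ray_equiv Y arev = {(r, s). r \<in> rays Y arev \<and> s \<in> rays Y arev \<and>
     (\<exists>(N::nat) (k::int). \<forall>j\<ge>N. 0 \<le> int j + k \<and> r (nat (int j + k)) = s j)}"

definition tree_boundary :: "('v, 'e) pre_digraph \<Rightarrow> ('e \<Rightarrow> 'e) \<Rightarrow> (nat \<Rightarrow> 'e) set set" where
  "tree_boundary Y arev = rays Y arev // ray_equiv Y arev"

text \<open>The vertices of a ray \<open>r\<close> are \<open>tail Y (r n)\<close>, its initial vertex being \<open>tail Y (r 0)\<close>.\<close>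

definition horocycle_rel :: "('v, 'e) pre_digraph \<Rightarrow> (nat \<Rightarrow> 'e) set \<Rightarrow> 'v rel" where
  "horocycle_rel Y c = {(x, y). \<exists>r\<in>c. \<exists>s\<in>c. tail Y (r 0) = x \<and> tail Y (s 0) = y \<and>
     (\<exists>n. tail Y (r n) = tail Y (s n))}"

definition horocycles :: "('v, 'e) pre_digraph \<Rightarrow> (nat \<Rightarrow> 'e) set \<Rightarrow> 'v set set" where
  "horocycles Y c = verts Y // horocycle_rel Y c"

text \<open>The groups \<open>\<Gamma> \<inter> P\<^sub>c\<close> and \<open>\<Gamma> \<inter> N\<^sub>c\<close>.\<close>

definition end_stabilizer ::
    "('g, 'm) monoid_scheme \<Rightarrow> ('g \<Rightarrow> 'e \<Rightarrow> 'e) \<Rightarrow> (nat \<Rightarrow> 'e) set \<Rightarrow> 'g set" where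
  "end_stabilizer \<Gamma> ae c = {g \<in> carrier \<Gamma>. (\<lambda>r n. ae g (r n)) ` c = c}"

definition horocycle_stabilizer ::
    "('v, 'e) pre_digraph \<Rightarrow> ('g, 'm) monoid_scheme \<Rightarrow> ('g \<Rightarrow> 'v \<Rightarrow> 'v) \<Rightarrow> ('g \<Rightarrow> 'e \<Rightarrow> 'e) \<Rightarrow>
     (nat \<Rightarrow> 'e) set \<Rightarrow> 'g set" where
  "horocycle_stabilizer Y \<Gamma> av ae c =
     {g \<in> end_stabilizer \<Gamma> ae c. \<exists>H\<in>horocycles Y c. av g ` H = H}"

definition is_cusp ::
    "('v, 'e) pre_digraph \<Rightarrow> ('e \<Rightarrow> 'e) \<Rightarrow> ('g, 'm) monoid_scheme \<Rightarrow>
     ('g \<Rightarrow> 'v \<Rightarrow> 'v) \<Rightarrow> ('g \<Rightarrow> 'e \<Rightarrow> 'e) \<Rightarrow> (nat \<Rightarrow> 'e) set \<Rightarrow> bool" where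
  "is_cusp Y arev \<Gamma> av ae c \<longleftrightarrow>
     c \<in> tree_boundary Y arev \<and>
     end_stabilizer \<Gamma> ae c = horocycle_stabilizer Y \<Gamma> av ae c \<and>
     (\<exists>H\<in>horocycles Y c. \<forall>x\<in>H. \<forall>y\<in>H. \<exists>g\<in>horocycle_stabilizer Y \<Gamma> av ae c. av g x = y)"

definition periodic_end :: "('v, 'e) pre_digraph \<Rightarrow> (nat \<Rightarrow> 'e) set \<Rightarrow> bool" where
  "periodic_end Y c \<longleftrightarrow> (\<exists>r\<in>c. \<exists>p>0. \<exists>N. \<forall>n\<ge>N. val Y (tail Y (r (n + p))) = val Y (tail Y (r n)))"

text \<open>The images in \<open>\<Gamma>\<setminus>Y\<close> of the rays belonging to periodic cusps.\<close>

definition periodic_cusp_sections ::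
    "('v, 'e) pre_digraph \<Rightarrow> ('e \<Rightarrow> 'e) \<Rightarrow> ('g, 'm) monoid_scheme \<Rightarrow>
     ('g \<Rightarrow> 'v \<Rightarrow> 'v) \<Rightarrow> ('g \<Rightarrow> 'e \<Rightarrow> 'e) \<Rightarrow> (nat \<Rightarrow> 'e set) set" where
  "periodic_cusp_sections Y arev \<Gamma> av ae =
     {(\<lambda>n. orbit \<Gamma> ae (r n)) | r c. is_cusp Y arev \<Gamma> av ae c \<and> periodic_end Y c \<and> r \<in> c}"

definition section_verts :: "('v, 'e) pre_digraph \<Rightarrow> (nat \<Rightarrow> 'e) \<Rightarrow> 'v set" where
  "section_verts X s = range (\<lambda>n. tail X (s n))"

definition section_arcs :: "('e \<Rightarrow> 'e) \<Rightarrow> (nat \<Rightarrow> 'e) \<Rightarrow> 'e set" where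
  "section_arcs arev s = range s \<union> range (\<lambda>n. arev (s n))"

text \<open>
  \<open>\<Gamma>\<close> is cuspidal iff there are \<open>F\<close> and \<open>S\<close> satisfying the following predicate: \<open>X = \<Gamma>\<setminus>Y\<close> is the
  union of the finite graph \<open>F\<close> and the finitely many cusp sections in \<open>S\<close>, which are infinite rays
  in \<open>X\<close> (no vertex is repeated), each meeting \<open>F\<close> only in its initial vertex. The sections are
  required to be pairwise disjoint, which can always be achieved by passing to subrays and
  enlarging \<open>F\<close>.
\<close>

definition cuspidal_decomposition ::
    "('v, 'e) pre_digraph \<Rightarrow> ('e \<Rightarrow> 'e) \<Rightarrow> ('g, 'm) monoid_scheme \<Rightarrow>
     ('g \<Rightarrow> 'v \<Rightarrow> 'v) \<Rightarrow> ('g \<Rightarrow> 'e \<Rightarrow> 'e) \<Rightarrow>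
     ('v set, 'e set) pre_digraph \<Rightarrow> (nat \<Rightarrow> 'e set) set \<Rightarrow> bool" where
  "cuspidal_decomposition Y arev \<Gamma> av ae F S \<longleftrightarrow>
     (let X = quotient_graph Y \<Gamma> av ae in
        subgraph F X \<and> (\<forall>e\<in>arcs F. arev ` e \<in> arcs F) \<and> finite (verts F) \<and> finite (arcs F) \<and>
        finite S \<and> S \<subseteq> periodic_cusp_sections Y arev \<Gamma> av ae \<and>
        verts X = verts F \<union> (\<Union>s\<in>S. section_verts X s) \<and>
        arcs X = arcs F \<union> (\<Union>s\<in>S. section_arcs ((`) arev) s) \<and>
        (\<forall>s\<in>S. inj (\<lambda>n. tail X (s n)) \<and> section_verts X s \<inter> verts F = {tail X (s 0)}) \<and>
        (\<forall>s\<in>S. \<forall>s'\<in>S. s \<noteq> s' \<longrightarrow> section_verts X s \<inter> section_verts X s' = {}))"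

text \<open>
  The finite part \<open>X\<close> minus the cusp sections: all vertices of the sections, including the initial
  ones, and all their edges are removed, while an edge outside the sections is kept even if an
  endpoint is removed. Hence its Euler number is \<open>\<chi>(F)\<close> minus the number of sections.
  The initial vertices must not be counted: if \<open>X\<close> is the modular ray of \<open>PGL\<^sub>2(F\<^sub>q[t])\<close>, then
  \<open>Z(u)\<^sup>-\<^sup>1 = det(1 - uA + u\<^sup>2Q) = (1 - q\<^sup>2u\<^sup>2)/(1 - qu\<^sup>2)\<close>, so the exponent in the
  determinant formula is \<open>0\<close>, although \<open>F\<close> may be taken to be a single vertex.
\<close>

definition finite_part ::
    "('v, 'e) pre_digraph \<Rightarrow> ('e \<Rightarrow> 'e) \<Rightarrow> (nat \<Rightarrow> 'e) set \<Rightarrow> ('v, 'e) pre_digraph" where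
  "finite_part X arev S =
     X \<lparr> verts := verts X - (\<Union>s\<in>S. section_verts X s),
         arcs := arcs X - (\<Union>s\<in>S. section_arcs arev s) \<rparr>"


section \<open>Cycles, weights and the Bass-Ihara zeta function\<close>

definition closed_paths :: "('v, 'e) pre_digraph \<Rightarrow> 'e list set" where
  "closed_paths X = {p. p \<noteq> [] \<and> (\<exists>v. pre_digraph.awalk X v p v)}"

definition cycles :: "('v, 'e) pre_digraph \<Rightarrow> 'e list set set" where
  "cycles X = closed_paths X //
     {(p, q). p \<in> closed_paths X \<and> q \<in> closed_paths X \<and> (\<exists>k. q = rotate k p)}"

definition prime_cycles :: "('v, 'e) pre_digraph \<Rightarrow> 'e list set set" where
  "prime_cycles X = {c \<in> cycles X.
     \<not> (\<exists>p\<in>c. \<exists>q\<in>closed_paths X. \<exists>m\<ge>2. p = concat (replicate m q))}"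

text \<open>\<open>w(e)\<close> for an edge of \<open>Y\<close>, respectively of \<open>\<Gamma>\<setminus>Y\<close>.\<close>

definition edge_weight ::
    "('v, 'e) pre_digraph \<Rightarrow> ('g, 'm) monoid_scheme \<Rightarrow> ('g \<Rightarrow> 'v \<Rightarrow> 'v) \<Rightarrow> ('g \<Rightarrow> 'e \<Rightarrow> 'e) \<Rightarrow>
     'e \<Rightarrow> nat" where
  "edge_weight Y \<Gamma> av ae e = card ((\<lambda>g. ae g e) ` stabilizer \<Gamma> av (tail Y e))"

definition quotient_weight ::
    "('v, 'e) pre_digraph \<Rightarrow> ('g, 'm) monoid_scheme \<Rightarrow> ('g \<Rightarrow> 'v \<Rightarrow> 'v) \<Rightarrow> ('g \<Rightarrow> 'e \<Rightarrow> 'e) \<Rightarrow>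
     'e set \<Rightarrow> nat" where
  "quotient_weight Y \<Gamma> av ae = class_value (edge_weight Y \<Gamma> av ae)"

definition turn_weight :: "('e \<Rightarrow> 'e) \<Rightarrow> ('e \<Rightarrow> nat) \<Rightarrow> 'e \<Rightarrow> 'e \<Rightarrow> int" where
  "turn_weight arev w e e' = (if e' = arev e then int (w e') - 1 else int (w e'))"

definition path_weight :: "('e \<Rightarrow> 'e) \<Rightarrow> ('e \<Rightarrow> nat) \<Rightarrow> 'e list \<Rightarrow> int" where
  "path_weight arev w p =
     (\<Prod>j<length p. turn_weight arev w (p ! j) (p ! (Suc j mod length p)))"

text \<open>
  The product over the prime cycles is the unordered one, i.e. the limit of the finite partial
  products; as usual, convergence of an infinite product includes that the limit is nonzero.
\<close>

definition zeta_partial ::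
    "('v, 'e) pre_digraph \<Rightarrow> ('e \<Rightarrow> 'e) \<Rightarrow> ('g, 'm) monoid_scheme \<Rightarrow>
     ('g \<Rightarrow> 'v \<Rightarrow> 'v) \<Rightarrow> ('g \<Rightarrow> 'e \<Rightarrow> 'e) \<Rightarrow> complex \<Rightarrow> 'e set list set set \<Rightarrow> complex" where
  "zeta_partial Y arev \<Gamma> av ae u C =
     (\<Prod>c\<in>C. inverse (1 - of_int (class_value (path_weight ((`) arev) (quotient_weight Y \<Gamma> av ae)) c)
                         * u ^ class_value length c))"

definition zeta_convergent ::
    "('v, 'e) pre_digraph \<Rightarrow> ('e \<Rightarrow> 'e) \<Rightarrow> ('g, 'm) monoid_scheme \<Rightarrow>
     ('g \<Rightarrow> 'v \<Rightarrow> 'v) \<Rightarrow> ('g \<Rightarrow> 'e \<Rightarrow> 'e) \<Rightarrow> complex \<Rightarrow> bool" where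
  "zeta_convergent Y arev \<Gamma> av ae u \<longleftrightarrow>
     (\<exists>z. z \<noteq> 0 \<and> (zeta_partial Y arev \<Gamma> av ae u \<longlongrightarrow> z)
        (finite_subsets_at_top (prime_cycles (quotient_graph Y \<Gamma> av ae))))"

definition bass_ihara_zeta ::
    "('v, 'e) pre_digraph \<Rightarrow> ('e \<Rightarrow> 'e) \<Rightarrow> ('g, 'm) monoid_scheme \<Rightarrow>
     ('g \<Rightarrow> 'v \<Rightarrow> 'v) \<Rightarrow> ('g \<Rightarrow> 'e \<Rightarrow> 'e) \<Rightarrow> complex \<Rightarrow> complex" where
  "bass_ihara_zeta Y arev \<Gamma> av ae u =
     Lim (finite_subsets_at_top (prime_cycles (quotient_graph Y \<Gamma> av ae)))
       (zeta_partial Y arev \<Gamma> av ae u)"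


section \<open>The operators A and Q\<close>

text \<open>
  A formal sum of vertices is its coefficient function. The coefficient at \<open>y\<close> of
  \<open>A (\<Sum>y'. f y' \<cdot> y')\<close> is the sum of \<open>f y'\<close> over the neighbours \<open>y'\<close> of \<open>y\<close>.
\<close>

definition adjacency_op :: "('v, 'e) pre_digraph \<Rightarrow> ('v \<Rightarrow> complex) \<Rightarrow> 'v \<Rightarrow> complex" where
  "adjacency_op Y f y = (\<Sum>y' | y' \<rightarrow>\<^bsub>Y\<^esub> y. f y')"

definition valency_op :: "('v, 'e) pre_digraph \<Rightarrow> ('v \<Rightarrow> complex) \<Rightarrow> 'v \<Rightarrow> complex" where
  "valency_op Y f y = (of_nat (val Y y) - 1) * f y"

text \<open>
  Identifying \<open>x \<in> VX\<close> with the sum over its orbit, \<open>f\<close> on \<open>VX\<close> becomes the invariant formal sum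
  \<open>\<lambda>y. f (orbit \<Gamma> av y)\<close>; an operator commuting with \<open>\<Gamma>\<close> maps it to an invariant formal sum, which is
  read off on the orbits.
\<close>

definition induced_op ::
    "('g, 'm) monoid_scheme \<Rightarrow> ('g \<Rightarrow> 'v \<Rightarrow> 'v) \<Rightarrow>
     (('v \<Rightarrow> complex) \<Rightarrow> 'v \<Rightarrow> complex) \<Rightarrow> ('v set \<Rightarrow> complex) \<Rightarrow> 'v set \<Rightarrow> complex" where
  "induced_op \<Gamma> av T f = class_value (T (\<lambda>y. f (orbit \<Gamma> av y)))"

definition ihara_op ::
    "('v, 'e) pre_digraph \<Rightarrow> ('g, 'm) monoid_scheme \<Rightarrow> ('g \<Rightarrow> 'v \<Rightarrow> 'v) \<Rightarrow>
     complex \<Rightarrow> ('v set \<Rightarrow> complex) \<Rightarrow> 'v set \<Rightarrow> complex" where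
  "ihara_op Y \<Gamma> av u f x =
     f x - u * induced_op \<Gamma> av (adjacency_op Y) f x + u\<^sup>2 * induced_op \<Gamma> av (valency_op Y) f x"


section \<open>Infinite determinants\<close>

text \<open>
  \<open>B\<close> maps coefficient functions to coefficient functions, \<open>I\<close> is the index set. Only the values of
  \<open>B\<close> on the basis vectors \<open>indicator {j}\<close> matter, and \<open>B\<^sub>F\<close> is given by the matrix entries
  \<open>B (indicator {j}) i\<close> for \<open>i, j \<in> F\<close>.
\<close>

definition entry :: "(('i \<Rightarrow> complex) \<Rightarrow> 'i \<Rightarrow> complex) \<Rightarrow> 'i \<Rightarrow> 'i \<Rightarrow> complex" where
  "entry B i j = B (indicator {j}) i"

definition finite_det :: "(('i \<Rightarrow> complex) \<Rightarrow> 'i \<Rightarrow> complex) \<Rightarrow> 'i set \<Rightarrow> complex" where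
  "finite_det B F = (\<Sum>p | p permutes F. of_int (sign p) * (\<Prod>i\<in>F. entry B i (p i)))"

definition determinant_class :: "(('i \<Rightarrow> complex) \<Rightarrow> 'i \<Rightarrow> complex) \<Rightarrow> 'i set \<Rightarrow> bool" where
  "determinant_class B I \<longleftrightarrow> (\<exists>d. d \<noteq> 0 \<and> (finite_det B \<longlongrightarrow> d) (finite_subsets_at_top I))"

definition stable_set ::
    "(('i \<Rightarrow> complex) \<Rightarrow> 'i \<Rightarrow> complex) \<Rightarrow> 'i set \<Rightarrow> 'i set \<Rightarrow> bool" where
  "stable_set B F M \<longleftrightarrow> M \<subseteq> F \<and> (\<Union>j\<in>M. {i \<in> F. entry B i j \<noteq> 0}) \<subseteq> M"

definition op_irreducible :: "(('i \<Rightarrow> complex) \<Rightarrow> 'i \<Rightarrow> complex) \<Rightarrow> 'i set \<Rightarrow> bool" where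
  "op_irreducible B F \<longleftrightarrow> (\<forall>M. stable_set B F M \<longrightarrow> M = {} \<or> M = F)"

definition op_connected :: "(('i \<Rightarrow> complex) \<Rightarrow> 'i \<Rightarrow> complex) \<Rightarrow> 'i set \<Rightarrow> bool" where
  "op_connected B F \<longleftrightarrow> (\<forall>M N. stable_set B F M \<and> stable_set B F N \<and> M \<inter> N = {} \<and> F = M \<union> N
     \<longrightarrow> M = {} \<or> N = {})"

text \<open>The net of all finite connected subsets of \<open>I\<close>, ordered by inclusion.\<close>

definition connected_subsets_at_top ::
    "(('i \<Rightarrow> complex) \<Rightarrow> 'i \<Rightarrow> complex) \<Rightarrow> 'i set \<Rightarrow> 'i set filter" where
  "connected_subsets_at_top B I =
     (INF F0\<in>{F. finite F \<and> F \<subseteq> I \<and> op_connected B F}.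
        principal {F. finite F \<and> F \<subseteq> I \<and> op_connected B F \<and> F0 \<subseteq> F})"

definition connected_determinant_class ::
    "(('i \<Rightarrow> complex) \<Rightarrow> 'i \<Rightarrow> complex) \<Rightarrow> 'i set \<Rightarrow> bool" where
  "connected_determinant_class B I \<longleftrightarrow>
     op_irreducible B I \<and> (\<exists>d. (finite_det B \<longlongrightarrow> d) (connected_subsets_at_top B I))"

definition connected_det :: "(('i \<Rightarrow> complex) \<Rightarrow> 'i \<Rightarrow> complex) \<Rightarrow> 'i set \<Rightarrow> complex" where
  "connected_det B I = Lim (connected_subsets_at_top B I) (finite_det B)"

end

theory Submission
  imports Defs "Jordan_Normal_Form.Schur_Decomposition"
begin

text \<open>
  Outside a finite set of vertices the quotient graph \<open>X\<close> consists of rays along which every edge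
  leading outwards has weight \<open>1\<close>; this is what cusps contribute (\<open>cusp_ray_eventually_fixed\<close>).
  Everything else concerns weighted graphs of this shape (locale \<open>cusp_graph\<close>), and rests on what
  happens when the rays are cut off. Let \<open>P(n)\<close> be the determinant of \<open>1 - uA + u\<^sup>2Q\<close> on a
  truncation whose last vertex on some ray has number \<open>n\<close>, and let \<open>q\<^sub>n + 1\<close> be the valency there.
  Since this vertex has a single neighbour, expansion along it gives
  \<open>P(n) - P(n - 1) = u\<^sup>2 q\<^sub>n (P(n - 1) - P(n - 2))\<close>. As valencies are bounded, \<open>P\<close> converges
  geometrically for small \<open>u\<close>, in whatever way the ends of the rays move to infinity
  (\<open>trunc_det_limit\<close>). Every large finite connected set of vertices is such a truncation, so this is
  the connected determinant. On the other hand, adding to a truncation the vertex after the next one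
  on some ray, which is isolated there, multiplies the determinant by \<open>1 + u\<^sup>2 q\<close> with an integer
  \<open>q \<ge> 1\<close>; hence no nonzero limit exists over all finite sets (\<open>not_determinant_class\<close>).
  
  For the zeta function, \<open>log Z(u)\<close> is the sum of \<open>w(p) u\<^sup>l / l\<close> over all closed paths \<open>p\<close>, \<open>l\<close> being
  the length of \<open>p\<close> (\<open>euler_product\<close>). Inside a finite set of edges this sum is \<open>- log det(1 - uT)\<close>,
  where \<open>T\<close> is the matrix of the weights \<open>w(e, e')\<close> (\<open>exp_closed_words_series\<close>), and the identity of
  Bass (\<open>bass_identity\<close>) replaces this by a determinant over the vertices. In it the valencies are
  counted inside the truncation, where the last vertex of each ray has lost an edge of weight \<open>1\<close>. The
  corresponding diagonal entries are therefore smaller by \<open>u\<^sup>2\<close>, which turns \<open>P(n)\<close> into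
  \<open>P(n) - u\<^sup>2 P(n - 1)\<close>; in the limit each ray contributes a factor \<open>1 - u\<^sup>2\<close>
  (\<open>trunc_det_lowered_limit\<close>). This is why the initial vertices of the rays do not count in the Euler
  number. The sum over the closed paths converges because a closed path of nonzero weight cannot stay
  inside a ray: it would turn around at its lowest vertex, and that turn has weight \<open>1 - 1\<close>
  (\<open>closed_path_meets_V0\<close>).
  
  Finally, a cusp forces \<open>X\<close> to have a ray: a lattice with finite quotient has no cusps, for it would
  contain a translation towards the cusp (\<open>finite_quotient_no_cusp\<close>).
\<close>

section \<open>Determinants over finite index sets\<close>

text \<open>
  Determinants of matrices indexed by a finite subset of an arbitrary type, so that rows and columns
  can be removed by shrinking the index set.
\<close>

definition fdet :: "('a \<Rightarrow> 'a \<Rightarrow> 'b::comm_ring_1) \<Rightarrow> 'a set \<Rightarrow> 'b" where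
  "fdet M F = (\<Sum>p | p permutes F. of_int (sign p) * (\<Prod>i\<in>F. M i (p i)))"

lemma fdet_empty [simp]: "fdet M {} = 1"
  by (simp add: fdet_def)

lemma fdet_cong:
  assumes "\<And>i j. i \<in> F \<Longrightarrow> j \<in> F \<Longrightarrow> M i j = N i j"
  shows "fdet M F = fdet N F"
  unfolding fdet_def
  by (intro sum.cong refl arg_cong2[of _ _ _ _ "(*)"] prod.cong)
     (auto intro!: assms simp: permutes_in_image)

lemma permutes_fixing:
  assumes "i \<in> F"
  shows "{p. p permutes F \<and> p i = i} = {p. p permutes (F - {i})}"
proof safe
  fix p assume "p permutes F" "p i = i"
  then show "p permutes (F - {i})" by (elim permutes_superset) auto
next
  fix p assume *: "p permutes (F - {i})"
  then show "p permutes F" by (rule permutes_subset) auto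
  show "p i = i" using * by (auto simp: permutes_def)
qed

lemma fdet_fixing:
  assumes "finite F" "i \<in> F"
  shows "(\<Sum>p | p permutes F \<and> p i = i. of_int (sign p) * (\<Prod>j\<in>F. M j (p j))) =
         M i i * fdet M (F - {i})"
proof -
  have "(\<Sum>p | p permutes F \<and> p i = i. of_int (sign p) * (\<Prod>j\<in>F. M j (p j))) =
        (\<Sum>p | p permutes (F - {i}). M i i * (of_int (sign p) * (\<Prod>j\<in>F - {i}. M j (p j))))"
    unfolding permutes_fixing[OF assms(2)]
  proof (rule sum.cong[OF refl], clarify)
    fix p assume "p permutes (F - {i})"
    then have "p i = i" by (auto simp: permutes_def)
    then show "of_int (sign p) * (\<Prod>j\<in>F. M j (p j)) =
        M i i * (of_int (sign p) * (\<Prod>j\<in>F - {i}. M j (p j)))"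
      by (subst prod.remove[OF assms]) simp
  qed
  then show ?thesis by (simp add: fdet_def sum_distrib_left)
qed

lemma fdet_split:
  assumes "finite F" "i \<in> F"
  shows "fdet M F = M i i * fdet M (F - {i}) +
    (\<Sum>p | p permutes F \<and> p i \<noteq> i. of_int (sign p) * (\<Prod>j\<in>F. M j (p j)))"
proof -
  have eq: "{p. p permutes F} = {p. p permutes F \<and> p i = i} \<union> {p. p permutes F \<and> p i \<noteq> i}" by auto
  have fin: "finite {p. p permutes F \<and> Q p}" for Q
    by (rule finite_subset[OF _ finite_permutations[OF assms(1)]]) auto
  show ?thesis
    unfolding fdet_fixing[OF assms, symmetric] fdet_def[of M F] eq
    by (rule sum.union_disjoint) (auto simp: fin)
qed

lemma fdet_isolated:
  assumes "finite F" "i \<in> F" and "\<And>j. j \<in> F - {i} \<Longrightarrow> M i j = 0"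
  shows "fdet M F = M i i * fdet M (F - {i})"
proof -
  have "(\<Prod>j\<in>F. M j (p j)) = 0" if "p permutes F" "p i \<noteq> i" for p
    using that assms by (intro prod_zero bexI[of _ i]) (auto simp: permutes_in_image)
  then show ?thesis by (subst fdet_split[OF assms(1,2)]) simp
qed

text \<open>
  A permutation contributing to the determinant either fixes a pendant vertex \<open>i\<close> or swaps it with
  its only neighbour \<open>k\<close>.
\<close>

lemma fdet_pendant:
  fixes M :: "'a \<Rightarrow> 'a \<Rightarrow> 'b::comm_ring_1"
  assumes F: "finite F" "i \<in> F" "k \<in> F" "i \<noteq> k"
    and z: "\<And>j. j \<in> F - {i, k} \<Longrightarrow> M i j = 0" "\<And>j. j \<in> F - {i, k} \<Longrightarrow> M j i = 0"
  shows "fdet M F = M i i * fdet M (F - {i}) - M i k * M k i * fdet M (F - {i, k})"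
proof -
  let ?t = "\<lambda>p. of_int (sign p) * (\<Prod>j\<in>F. M j (p j))"
  let ?A = "{p. p permutes F \<and> p i \<noteq> i}" and ?B = "{p. p permutes F \<and> p i = k \<and> p k = i}"
  have "?t p = 0" if p: "p \<in> ?A - ?B" for p
  proof (cases "p i = k")
    case True
    have pF: "p permutes F" using p by auto
    let ?j = "inv_into UNIV p i"
    have j: "p ?j = i" "?j \<in> F"
      using pF F(2) by (auto simp: permutes_inverses permutes_in_image[OF permutes_inv[OF pF]])
    have "?j \<noteq> i" "?j \<noteq> k" using p j True by auto
    then have "M ?j (p ?j) = 0" using z(2)[of ?j] j by auto
    then have "(\<Prod>j\<in>F. M j (p j)) = 0" using j F(1) by (intro prod_zero bexI[of _ ?j])
    then show ?thesis by simp
  next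
    case False
    then have "M i (p i) = 0" using p F by (intro z) (auto simp: permutes_in_image)
    then have "(\<Prod>j\<in>F. M j (p j)) = 0" using F by (intro prod_zero) auto
    then show ?thesis by simp
  qed
  then have "sum ?t ?A = sum ?t ?B"
    using F(4) by (intro sum.mono_neutral_right finite_subset[OF _ finite_permutations[OF F(1)]]) auto
  also have "sum ?t ?B =
      (\<Sum>q | q permutes (F - {i, k}). - (M i k * M k i * (of_int (sign q) * (\<Prod>j\<in>F - {i, k}. M j (q j)))))"
  proof (rule sum.reindex_bij_witness[where i = "\<lambda>q. Transposition.transpose i k \<circ> q" and j = "\<lambda>p. Transposition.transpose i k \<circ> p"])
    fix p assume p: "p \<in> ?B"
    have t: "Transposition.transpose i k permutes F" using F by (intro permutes_swap_id)
    have pF: "p permutes F" using p by auto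
    show "Transposition.transpose i k \<circ> (Transposition.transpose i k \<circ> p) = p" by (simp add: fun_eq_iff)
    have "Transposition.transpose i k \<circ> p permutes F" by (rule permutes_compose[OF pF t])
    then show q: "Transposition.transpose i k \<circ> p \<in> {q. q permutes (F - {i, k})}"
      using p by (auto elim!: permutes_superset)
    have perm: "permutation p" "permutation (Transposition.transpose i k)"
      using pF t F(1) permutation_permutes by blast+
    have s: "sign (Transposition.transpose i k \<circ> p) = - sign p"
      by (simp add: sign_compose[OF perm(2,1)] sign_swap_id F)
    have "(\<Prod>j\<in>F - {i, k}. M j ((Transposition.transpose i k \<circ> p) j)) = (\<Prod>j\<in>F - {i, k}. M j (p j))"
    proof (rule prod.cong[OF refl])
      fix j assume "j \<in> F - {i, k}"
      then have "p j \<noteq> i" "p j \<noteq> k"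
        using p inj_eq[OF permutes_inj[OF pF], of j k] inj_eq[OF permutes_inj[OF pF], of j i] by auto
      then show "M j ((Transposition.transpose i k \<circ> p) j) = M j (p j)" by (simp add: Transposition.transpose_def)
    qed
    moreover have "(\<Prod>j\<in>F. M j (p j)) = M i k * M k i * (\<Prod>j\<in>F - {i, k}. M j (p j))"
    proof -
      have "(\<Prod>j\<in>F. M j (p j)) = M i (p i) * (\<Prod>j\<in>F - {i}. M j (p j))"
        using F by (intro prod.remove) auto
      also have "(\<Prod>j\<in>F - {i}. M j (p j)) = M k (p k) * (\<Prod>j\<in>F - {i} - {k}. M j (p j))"
        using F by (intro prod.remove) auto
      finally show ?thesis using p by (simp add: mult.assoc Diff_insert2[symmetric] insert_commute)
    qed
    ultimately show "- (M i k * M k i * (of_int (sign (Transposition.transpose i k \<circ> p)) *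
          (\<Prod>j\<in>F - {i, k}. M j ((Transposition.transpose i k \<circ> p) j)))) = ?t p"
      unfolding s by (simp add: algebra_simps)
  next
    fix q assume q: "q \<in> {q. q permutes (F - {i, k})}"
    show "Transposition.transpose i k \<circ> (Transposition.transpose i k \<circ> q) = q" by (simp add: fun_eq_iff)
    have t: "Transposition.transpose i k permutes F" using F by (intro permutes_swap_id)
    have qF: "q permutes F" by (rule permutes_subset) (use q in auto)
    have "q i = i" "q k = k" using q by (auto simp: permutes_def)
    then show "Transposition.transpose i k \<circ> q \<in> ?B" using permutes_compose[OF qF t] by auto
  qed
  also have "\<dots> = - (M i k * M k i * fdet M (F - {i, k}))"
    by (simp add: fdet_def sum_negf sum_distrib_left)
  finally show ?thesis by (subst fdet_split[OF F(1,2)]) simp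
qed

lemma fdet_diag_perturb:
  assumes "finite F" "i \<in> F"
  shows "fdet (\<lambda>a b. if a = i \<and> b = i then M i i + d else M a b) F = fdet M F + d * fdet M (F - {i})"
proof -
  let ?N = "\<lambda>a b. if a = i \<and> b = i then M i i + d else M a b"
  have 1: "fdet ?N (F - {i}) = fdet M (F - {i})" by (intro fdet_cong) auto
  have 2: "(\<Sum>p | p permutes F \<and> p i \<noteq> i. of_int (sign p) * (\<Prod>j\<in>F. ?N j (p j))) =
     (\<Sum>p | p permutes F \<and> p i \<noteq> i. of_int (sign p) * (\<Prod>j\<in>F. M j (p j)))"
    by (intro sum.cong refl arg_cong2[of _ _ _ _ "(*)"] prod.cong) auto
  show ?thesis
    by (simp add: fdet_split[OF assms, of M] fdet_split[OF assms, of ?N] 1 2 algebra_simps)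
qed

lemma fdet_eq_det:
  assumes "distinct xs" "set xs = F"
  shows "fdet M F = Determinant.det (Matrix.mat (length xs) (length xs) (\<lambda>(i, j). M (xs ! i) (xs ! j)))"
proof -
  let ?n = "length xs" and ?f = "(!) xs"
  have bij: "bij_betw ?f {0..<?n} F" using assms bij_betw_nth[of xs "{0..<?n}" F] by (simp add: atLeast0LessThan)
  have inj: "inj_on ?f {0..<?n}" using bij by (simp add: bij_betw_def)
  have bij': "bij_betw (inv_into {0..<?n} ?f) F {0..<?n}" by (rule bij_betw_inv_into[OF bij])
  have "Determinant.det (Matrix.mat ?n ?n (\<lambda>(i, j). M (xs ! i) (xs ! j))) =
    (\<Sum>p | p permutes {0..<?n}. of_int (sign p) * (\<Prod>i = 0..<?n. M (xs ! i) (xs ! p i)))"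
    unfolding det_def'[of _ ?n, OF mat_carrier]
  proof (intro sum.cong refl arg_cong2[of _ _ _ _ "(*)"] prod.cong, clarify)
    fix p i assume p: "p permutes {0..<?n}" and i: "i \<in> {0..<?n}"
    then have "p i < ?n" using permutes_in_image[OF p, of i] by simp
    then show "Matrix.mat ?n ?n (\<lambda>(i, j). M (xs ! i) (xs ! j)) $$ (i, p i) = M (xs ! i) (xs ! p i)"
      using i by simp
  qed
  also have "\<dots> = (\<Sum>p | p permutes F. of_int (sign p) * (\<Prod>i\<in>F. M i (p i)))"
  proof (rule sum.reindex_bij_witness[where j = "map_permutation {0..<?n} ?f"
        and i = "map_permutation F (inv_into {0..<?n} ?f)"])
    fix p assume p: "p \<in> {p. p permutes {0..<?n}}"
    show "map_permutation F (inv_into {0..<?n} ?f) (map_permutation {0..<?n} ?f p) = p"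
      using p by (intro map_permutation_compose_inv[OF bij]) (auto simp: inv_into_f_f[OF inj])
    show "map_permutation {0..<?n} ?f p \<in> {p. p permutes F}"
      using map_permutation_permutes[OF bij] p by auto
    have s: "sign (map_permutation {0..<?n} ?f p) = sign p"
      using p by (intro sign_map_permutation inj) auto
    have "(\<Prod>i\<in>F. M i (map_permutation {0..<?n} ?f p i)) = (\<Prod>i = 0..<?n. M (xs ! i) (map_permutation {0..<?n} ?f p (xs ! i)))"
      by (rule prod.reindex_bij_betw[OF bij, symmetric])
    also have "\<dots> = (\<Prod>i = 0..<?n. M (xs ! i) (xs ! p i))"
      by (intro prod.cong refl) (simp add: map_permutation_apply[OF inj])
    finally show "of_int (sign (map_permutation {0..<?n} ?f p)) * (\<Prod>i\<in>F. M i (map_permutation {0..<?n} ?f p i)) =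
        of_int (sign p) * (\<Prod>i = 0..<?n. M (xs ! i) (xs ! p i))" by (simp add: s)
  next
    fix p assume p: "p \<in> {p. p permutes F}"
    show "map_permutation {0..<?n} ?f (map_permutation F (inv_into {0..<?n} ?f) p) = p"
      using p by (intro map_permutation_compose_inv[OF bij'])
        (auto simp: f_inv_into_f bij_betw_imp_surj_on[OF bij])
    show "map_permutation F (inv_into {0..<?n} ?f) p \<in> {p. p permutes {0..<?n}}"
      using map_permutation_permutes[OF bij'] p by auto
  qed
  finally show ?thesis by (simp add: fdet_def)
qed

section \<open>The identity of Bass\<close>

lemma obtain_enum:
  assumes "finite F"
  obtains xs where "distinct xs" "set xs = F" "length xs = card F"
  using finite_distinct_list[OF assms] distinct_card by metis

lemma sum_enum:
  assumes "distinct xs" "set xs = F"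
  shows "(\<Sum>k = 0..<length xs. g (xs ! k)) = sum g F"
  by (rule sum.reindex_bij_betw) (use bij_betw_nth[of xs "{0..<length xs}" F] assms in \<open>simp add: atLeast0LessThan\<close>)

lemma fdet_mult:
  assumes "finite F"
  shows "fdet (\<lambda>i j. \<Sum>k\<in>F. M i k * N k j) F = fdet M F * fdet N F"
proof -
  obtain xs where xs: "distinct xs" "set xs = F" by (rule obtain_enum[OF assms])
  let ?n = "length xs"
  let ?m = "\<lambda>M. Matrix.mat ?n ?n (\<lambda>(i, j). M (xs ! i) (xs ! j))"
  have "?m (\<lambda>i j. \<Sum>k\<in>F. M i k * N k j) = ?m M * ?m N"
    by (intro eq_matI) (auto simp: scalar_prod_def sum_enum[OF xs, symmetric])
  then show ?thesis
    by (simp add: fdet_eq_det[OF xs] Determinant.det_mult[of _ ?n])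
qed

text \<open>
  Both sides are the determinant of the block matrix with rows \<open>(x, H)\<close> and \<open>(K, 1)\<close>, up to a power of
  \<open>x\<close>: a triangular factor clears either of the two blocks off the diagonal.
\<close>

lemma det_smult_one_minus_mult:
  fixes H K :: "'b::idom mat"
  assumes H: "H \<in> carrier_mat n m" and K: "K \<in> carrier_mat m n"
  shows "x ^ m * Determinant.det (x \<cdot>\<^sub>m 1\<^sub>m n - H * K) = x ^ n * Determinant.det (x \<cdot>\<^sub>m 1\<^sub>m m - K * H)"
proof -
  let ?M = "four_block_mat (x \<cdot>\<^sub>m 1\<^sub>m n) H K (1\<^sub>m m)"
  let ?L = "four_block_mat (1\<^sub>m n) (0\<^sub>m n m) (- K) (1\<^sub>m m)"
  let ?R = "four_block_mat (1\<^sub>m n) (- H) (0\<^sub>m m n) (x \<cdot>\<^sub>m 1\<^sub>m m)"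
  have HK: "H * K \<in> carrier_mat n n" "K * H \<in> carrier_mat m m" using H K by auto
  have M: "?M \<in> carrier_mat (n + m) (n + m)" and L: "?L \<in> carrier_mat (n + m) (n + m)"
    and R: "?R \<in> carrier_mat (n + m) (n + m)" using H K by auto
  have "?M * ?L = four_block_mat (x \<cdot>\<^sub>m 1\<^sub>m n - H * K) H (0\<^sub>m m n) (1\<^sub>m m)"
    by (subst mult_four_block_mat[of _ n n _ m _ m _ _ n _ m]) (use H K HK in \<open>auto intro!: arg_cong4[of _ _ _ _ _ _ _ _ four_block_mat] eq_matI\<close>)
  moreover have "Determinant.det \<dots> = Determinant.det (x \<cdot>\<^sub>m 1\<^sub>m n - H * K)"
    by (subst det_four_block_mat_lower_left_zero[of _ n _ m]) (use H K HK in auto)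
  moreover have "Determinant.det ?L = 1"
    by (subst det_four_block_mat_upper_right_zero[of _ n _ m]) (use H K HK in auto)
  ultimately have 1: "Determinant.det ?M = Determinant.det (x \<cdot>\<^sub>m 1\<^sub>m n - H * K)"
    using Determinant.det_mult[OF M L] by simp
  have [simp]: "unit_vec n i \<bullet> col H j = H $$ (i, j)" if "i < n" "j < m" for i j
    using scalar_prod_left_unit[of "col H j" n i] that H by auto
  have "?M * ?R = four_block_mat (x \<cdot>\<^sub>m 1\<^sub>m n) (0\<^sub>m n m) K (x \<cdot>\<^sub>m 1\<^sub>m m - K * H)"
    by (subst mult_four_block_mat[of _ n n _ m _ m _ _ n _ m]) (use H K HK in \<open>auto intro!: arg_cong4[of _ _ _ _ _ _ _ _ four_block_mat] eq_matI\<close>)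
  moreover have "Determinant.det \<dots> = x ^ n * Determinant.det (x \<cdot>\<^sub>m 1\<^sub>m m - K * H)"
    by (subst det_four_block_mat_upper_right_zero[of _ n _ m]) (use H K HK in auto)
  moreover have "Determinant.det ?R = x ^ m"
    by (subst det_four_block_mat_lower_left_zero[of _ n _ m]) (use H K HK in auto)
  ultimately show ?thesis
    using Determinant.det_mult[OF M R] 1 by simp
qed

lemma fdet_one_minus_mult:
  fixes H :: "'a \<Rightarrow> 'b \<Rightarrow> 'c::idom"
  assumes "finite E" "finite V"
  shows "x ^ card V * fdet (\<lambda>e f. (if e = f then x else 0) - (\<Sum>v\<in>V. H e v * K v f)) E =
         x ^ card E * fdet (\<lambda>v w. (if v = w then x else 0) - (\<Sum>e\<in>E. K v e * H e w)) V"
proof -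
  obtain es where es: "distinct es" "set es = E" "length es = card E" by (rule obtain_enum[OF assms(1)])
  obtain vs where vs: "distinct vs" "set vs = V" "length vs = card V" by (rule obtain_enum[OF assms(2)])
  let ?n = "length es" and ?m = "length vs"
  let ?H = "Matrix.mat ?n ?m (\<lambda>(i, j). H (es ! i) (vs ! j))"
  let ?K = "Matrix.mat ?m ?n (\<lambda>(i, j). K (vs ! i) (es ! j))"
  have "Matrix.mat ?n ?n (\<lambda>(i, j). (if es ! i = es ! j then x else 0) - (\<Sum>v\<in>V. H (es ! i) v * K v (es ! j)))
      = x \<cdot>\<^sub>m 1\<^sub>m ?n - ?H * ?K"
    using es(1) by (intro eq_matI) (auto simp: scalar_prod_def sum_enum[OF vs(1,2), symmetric] nth_eq_iff_index_eq)
  moreover have "Matrix.mat ?m ?m (\<lambda>(i, j). (if vs ! i = vs ! j then x else 0) - (\<Sum>e\<in>E. K (vs ! i) e * H e (vs ! j)))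
      = x \<cdot>\<^sub>m 1\<^sub>m ?m - ?K * ?H"
    using vs(1) by (intro eq_matI) (auto simp: scalar_prod_def sum_enum[OF es(1,2), symmetric] nth_eq_iff_index_eq)
  ultimately show ?thesis
    using det_smult_one_minus_mult[of ?H ?n ?m ?K x]
    by (simp add: fdet_eq_det[OF es(1,2)] fdet_eq_det[OF vs(1,2)] es(3) vs(3))
qed

text \<open>
  The matrix splits into blocks with rows \<open>(1, -u)\<close> and \<open>(-u, 1)\<close>, one for each pair of an edge and its
  reverse.
\<close>

lemma fdet_involution:
  fixes u :: "'b::comm_ring_1"
  assumes "finite E" and "\<And>e. e \<in> E \<Longrightarrow> \<rho> e \<in> E \<and> \<rho> e \<noteq> e \<and> \<rho> (\<rho> e) = e"
  shows "fdet (\<lambda>e f. (if e = f then 1 else 0) - u * (if f = \<rho> e then 1 else 0)) E = (1 - u\<^sup>2) ^ (card E div 2)"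
  using assms
proof (induction "card E" arbitrary: E rule: less_induct)
  case less
  let ?M = "\<lambda>e f. (if e = f then 1 else 0) - u * (if f = \<rho> e then 1 else 0)"
  show ?case
  proof (cases "E = {}")
    case False
    then obtain e where e: "e \<in> E" by auto
    let ?E = "E - {e, \<rho> e}"
    have r: "\<rho> e \<in> E" "\<rho> e \<noteq> e" "\<rho> (\<rho> e) = e" using less.prems(2)[OF e] by auto
    have c: "card E = Suc (Suc (card ?E))"
    proof -
      have "E = insert e (insert (\<rho> e) ?E)" using e r by auto
      then show ?thesis using less.prems(1) r
        by (metis Diff_iff card_insert_disjoint finite_Diff finite_insert insert_iff)
    qed
    have inv: "\<rho> f \<noteq> e \<and> \<rho> f \<noteq> \<rho> e" if "f \<in> ?E" for f
      using that less.prems(2)[of f] r by (metis Diff_iff insert_iff)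
    have IH: "fdet ?M ?E = (1 - u\<^sup>2) ^ (card ?E div 2)"
    proof (rule less.hyps)
      show "card ?E < card E" "finite ?E" using c less.prems(1) by auto
      show "\<rho> f \<in> ?E \<and> \<rho> f \<noteq> f \<and> \<rho> (\<rho> f) = f" if "f \<in> ?E" for f
        using that less.prems(2)[of f] inv[OF that] by auto
    qed
    have d: "E - {e} - {\<rho> e} = ?E" by auto
    have "fdet ?M (E - {e}) = ?M (\<rho> e) (\<rho> e) * fdet ?M (E - {e} - {\<rho> e})"
      using less.prems(1) r by (intro fdet_isolated) auto
    then have i: "fdet ?M (E - {e}) = fdet ?M ?E" using r unfolding d by simp
    have "fdet ?M E = ?M e e * fdet ?M (E - {e}) - ?M e (\<rho> e) * ?M (\<rho> e) e * fdet ?M ?E"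
      using less.prems(1) e r inv by (intro fdet_pendant) (force)+
    then have "fdet ?M E = (1 - u\<^sup>2) * fdet ?M ?E"
      using r by (simp add: i algebra_simps power2_eq_square)
    then show ?thesis unfolding IH c by simp
  qed simp
qed

text \<open>
  Let \<open>T = HK - J\<close> with the reversal \<open>J\<close>, where \<open>H\<close> sends edges to their end vertices and \<open>K\<close> distributes
  a vertex over the edges starting there. Since \<open>J\<^sup>2 = 1\<close>, one has
  \<open>(1 - uT)(1 - uJ) = (1 - u\<^sup>2) - uHK(1 - uJ)\<close>, and \<open>fdet_one_minus_mult\<close> moves \<open>H\<close> to the right, where
  \<open>KH\<close> is the adjacency matrix and \<open>KJH\<close> the diagonal matrix of the valencies.
\<close>

lemma bass_identity:
  fixes w :: "'e \<Rightarrow> 'c::idom"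
  assumes fin: "finite E" "finite V" and ends: "\<And>e. e \<in> E \<Longrightarrow> t e \<in> V"
    and rev: "\<And>e. e \<in> E \<Longrightarrow> \<rho> e \<in> E \<and> \<rho> e \<noteq> e \<and> \<rho> (\<rho> e) = e \<and> t (\<rho> e) = o' e \<and> o' (\<rho> e) = t e"
  shows "(1 - u\<^sup>2) ^ card V * (1 - u\<^sup>2) ^ (card E div 2) *
     fdet (\<lambda>e f. (if e = f then 1 else 0) - u * ((if o' f = t e then w f else 0) - (if f = \<rho> e then 1 else 0))) E =
     (1 - u\<^sup>2) ^ card E *
     fdet (\<lambda>v v'. (if v = v' then 1 - u\<^sup>2 + u\<^sup>2 * (\<Sum>e | e \<in> E \<and> o' e = v. w e) else 0)
            - u * (\<Sum>e | e \<in> E \<and> o' e = v \<and> t e = v'. w e)) V"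
proof -
  let ?J = "\<lambda>e f. (if e = f then 1 else 0) - u * (if f = \<rho> e then 1 else 0)"
  let ?H = "\<lambda>e v. u * (if t e = v then 1 else 0)"
  let ?K = "\<lambda>v f. (if o' f = v then w f else 0) - u * (if t f = v then w (\<rho> f) else 0)"
  let ?T = "\<lambda>e f. (if e = f then 1 else 0) - u * ((if o' f = t e then w f else 0) - (if f = \<rho> e then 1 else 0))"
  have delta: "(\<Sum>k\<in>E. g k * (if f = \<rho> k then 1 else 0)) = g (\<rho> f)" if "f \<in> E" for g :: "'e \<Rightarrow> 'c" and f
  proof -
    have "(\<Sum>k\<in>E. g k * (if f = \<rho> k then 1 else 0)) = (\<Sum>k\<in>E. if k = \<rho> f then g k else 0)"
      using that rev by (intro sum.cong refl) auto
    then show ?thesis using fin rev that by (simp add: sum.delta)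
  qed
  have delta1: "(\<Sum>k\<in>E. g k * (if k = f then 1 else 0)) = g f" if "f \<in> E" for g :: "'e \<Rightarrow> 'c" and f
    using that fin by (simp add: if_distrib[of "\<lambda>x. _ * x"] cong: if_cong)
  have alg: "(if a then 1 else 0) - u * ((if c then x else 0) - (if b then 1 else 0)) -
        u * ((if b then 1 else 0) - u * ((if d then y else 0) - (if a then 1 else 0))) =
      (if a then 1 - u\<^sup>2 else 0) - u * ((if c then x else 0) - u * (if d then y else 0))"
    for a b c d and x y :: 'c
    by (cases a; cases b; cases c; cases d) (simp_all add: algebra_simps power2_eq_square)
  have prod: "(\<Sum>k\<in>E. ?T e k * ?J k f) = (if e = f then 1 - u\<^sup>2 else 0) - (\<Sum>v\<in>V. ?H e v * ?K v f)"
    if e: "e \<in> E" and f: "f \<in> E" for e f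
  proof -
    have "(\<Sum>k\<in>E. ?T e k * ?J k f) = (\<Sum>k\<in>E. ?T e k * (if k = f then 1 else 0)) -
        u * (\<Sum>k\<in>E. ?T e k * (if f = \<rho> k then 1 else 0))"
      unfolding sum_distrib_left sum_subtractf[symmetric] by (intro sum.cong refl) (simp add: algebra_simps)
    then have 1: "(\<Sum>k\<in>E. ?T e k * ?J k f) = ?T e f - u * ?T e (\<rho> f)"
      unfolding delta[OF f] delta1[OF f] .
    have "(\<Sum>v\<in>V. ?H e v * ?K v f) = (\<Sum>v\<in>V. if v = t e then u * ?K v f else 0)"
      by (intro sum.cong refl) auto
    then have 2: "(\<Sum>v\<in>V. ?H e v * ?K v f) = u * ?K (t e) f"
      using ends[OF e] fin by (simp add: sum.delta)
    have 3: "\<rho> f = \<rho> e \<longleftrightarrow> e = f" "e = \<rho> f \<longleftrightarrow> f = \<rho> e" using rev e f by metis+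
    have 4: "o' (\<rho> f) = t f" using rev f by simp
    show ?thesis
      unfolding 1 2 3 4 by (rule alg)
  qed
  have KH: "(if v = v' then 1 - u\<^sup>2 else 0) - (\<Sum>e\<in>E. ?K v e * ?H e v') =
      (if v = v' then 1 - u\<^sup>2 + u\<^sup>2 * (\<Sum>e | e \<in> E \<and> o' e = v. w e) else 0)
            - u * (\<Sum>e | e \<in> E \<and> o' e = v \<and> t e = v'. w e)" for v v'
  proof -
    have "(\<Sum>e\<in>E. ?K v e * ?H e v') =
        u * (\<Sum>e\<in>E. if o' e = v \<and> t e = v' then w e else 0)
        - u\<^sup>2 * (\<Sum>e\<in>E. if t e = v \<and> t e = v' then w (\<rho> e) else 0)"
      unfolding sum_distrib_left sum_subtractf[symmetric]
      by (intro sum.cong refl) (auto simp: algebra_simps power2_eq_square)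
    also have "(\<Sum>e\<in>E. if o' e = v \<and> t e = v' then w e else 0) = (\<Sum>e | e \<in> E \<and> o' e = v \<and> t e = v'. w e)"
      using fin by (simp add: sum.inter_filter)
    also have "(\<Sum>e\<in>E. if t e = v \<and> t e = v' then w (\<rho> e) else 0) =
       (\<Sum>e | e \<in> E. if o' e = v \<and> v = v' then w e else 0)"
      by (rule sum.reindex_bij_witness[of _ \<rho> \<rho>]) (use rev in auto)
    also have "\<dots> = (if v = v' then \<Sum>e | e \<in> E \<and> o' e = v. w e else 0)"
      using fin by (simp add: sum.inter_filter)
    finally show ?thesis by (auto simp: algebra_simps)
  qed
  have "fdet ?T E * (1 - u\<^sup>2) ^ (card E div 2) = fdet ?T E * fdet ?J E"
    by (subst fdet_involution[OF fin(1)]) (use rev in auto)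
  also have "\<dots> = fdet (\<lambda>e f. \<Sum>k\<in>E. ?T e k * ?J k f) E" by (rule fdet_mult[OF fin(1), symmetric])
  also have "\<dots> = fdet (\<lambda>e f. (if e = f then 1 - u\<^sup>2 else 0) - (\<Sum>v\<in>V. ?H e v * ?K v f)) E"
    by (intro fdet_cong prod)
  finally have "(1 - u\<^sup>2) ^ card V * (fdet ?T E * (1 - u\<^sup>2) ^ (card E div 2)) =
     (1 - u\<^sup>2) ^ card E * fdet (\<lambda>v v'. (if v = v' then 1 - u\<^sup>2 else 0) - (\<Sum>e\<in>E. ?K v e * ?H e v')) V"
    using fdet_one_minus_mult[OF fin, of "1 - u\<^sup>2" ?H ?K] by simp
  then show ?thesis unfolding KH by (simp add: mult_ac)
qed

section \<open>Determinants as exponential sums over closed words\<close>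

definition mtrace :: "'a::comm_ring_1 mat \<Rightarrow> 'a" where
  "mtrace A = (\<Sum>i = 0..<dim_row A. A $$ (i, i))"

lemma mtrace_comm:
  assumes "A \<in> carrier_mat n m" "B \<in> carrier_mat m n"
  shows "mtrace (A * B) = mtrace (B * A)"
proof -
  have "mtrace (A * B) = (\<Sum>i = 0..<n. \<Sum>j = 0..<m. A $$ (i, j) * B $$ (j, i))"
    using assms by (auto simp: mtrace_def scalar_prod_def intro!: sum.cong)
  also have "\<dots> = (\<Sum>j = 0..<m. \<Sum>i = 0..<n. B $$ (j, i) * A $$ (i, j))"
    by (subst sum.swap) (simp add: mult.commute)
  also have "\<dots> = mtrace (B * A)"
    using assms by (auto simp: mtrace_def scalar_prod_def intro!: sum.cong)
  finally show ?thesis .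
qed

lemma mtrace_similar:
  assumes "similar_mat_wit A B P Q"
  shows "mtrace A = mtrace B"
proof -
  define n where "n = dim_row A"
  from similar_mat_witD[OF refl assms, folded n_def] have
    A: "A \<in> carrier_mat n n" and B: "B \<in> carrier_mat n n" and P: "P \<in> carrier_mat n n"
    and Q: "Q \<in> carrier_mat n n" and QP: "Q * P = 1\<^sub>m n" and AB: "A = P * B * Q" by auto
  have "mtrace A = mtrace (P * (B * Q))" using AB P B Q by simp
  also have "\<dots> = mtrace (B * Q * P)" using P B Q by (intro mtrace_comm[of _ n n]) auto
  also have "B * Q * P = B * (Q * P)" using P B Q by simp
  also have "\<dots> = B" using QP B by simp
  finally show ?thesis .
qed

text \<open>
  Only the diagonal of an upper triangular matrix enters the traces of its powers.
\<close>

lemma upper_triangular_pow: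
  fixes B :: "'a::comm_ring_1 mat"
  assumes "B \<in> carrier_mat n n" "upper_triangular B"
  shows "upper_triangular (B ^\<^sub>m k) \<and> (\<forall>i<n. (B ^\<^sub>m k) $$ (i, i) = (B $$ (i, i)) ^ k)"
proof (induction k)
  case 0
  then show ?case using assms by (auto)
next
  case (Suc k)
  let ?C = "B ^\<^sub>m k"
  have C: "?C \<in> carrier_mat n n" using assms(1) by simp
  have entry: "(?C * B) $$ (i, j) = (\<Sum>l = 0..<n. ?C $$ (i, l) * B $$ (l, j))" if "i < n" "j < n" for i j
    using that assms C by (simp add: scalar_prod_def)
  have z: "?C $$ (i, l) = 0" if "l < i" "i < n" for i l
    using Suc C that by (auto elim!: upper_triangularD)
  have z': "B $$ (i, l) = 0" if "l < i" "i < n" for i l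
    using assms that by (auto elim!: upper_triangularD)
  have "(?C * B) $$ (i, j) = 0" if "j < i" "i < n" for i j
  proof -
    have "?C $$ (i, l) * B $$ (l, j) = 0" if "l < n" for l
      using z[of l i] z'[of j l] that \<open>j < i\<close> \<open>i < n\<close> by (cases "l < i") auto
    then show ?thesis using that by (simp add: entry)
  qed
  moreover have "(?C * B) $$ (i, i) = (B $$ (i, i)) ^ Suc k" if "i < n" for i
  proof -
    have "(\<Sum>l = 0..<n. ?C $$ (i, l) * B $$ (l, i)) = (\<Sum>l = 0..<n. if l = i then ?C $$ (i, i) * B $$ (i, i) else 0)"
    proof (rule sum.cong[OF refl])
      fix l assume "l \<in> {0..<n}"
      then consider "l < i" | "l = i" | "i < l" "l < n" by force
      then show "?C $$ (i, l) * B $$ (l, i) = (if l = i then ?C $$ (i, i) * B $$ (i, i) else 0)"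
        by cases (use z[of l i] z'[of i l] that in auto)
    qed
    then show ?thesis using that Suc by (simp add: entry)
  qed
  ultimately show ?case using C assms(1) by (auto intro!: upper_triangularI)
qed

text \<open>
  After triangularization, both sides are products over the eigenvalues \<open>b\<close>, and
  \<open>- ln (1 - u * b)\<close> is the sum of \<open>(u * b)\<^sup>l / l\<close>.
\<close>

lemma exp_trace_series:
  fixes A :: "complex mat"
  assumes A: "A \<in> carrier_mat n n" and small: "\<And>k. eigenvalue A k \<Longrightarrow> norm (u * k) < 1"
  shows "\<exists>s. (\<lambda>l. mtrace (A ^\<^sub>m Suc l) * u ^ Suc l / of_nat (Suc l)) sums s \<and>
             exp (- s) = Determinant.det (1\<^sub>m n - u \<cdot>\<^sub>m A)"
proof -
  obtain as where as: "char_poly A = (\<Prod>a\<leftarrow>as. [:- a, 1:])"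
    using char_poly_factorized[OF A] by auto
  obtain B where B: "B \<in> carrier_mat n n" "upper_triangular B" "similar_mat A B"
    using schur_upper_triangular[OF A as] by blast
  then obtain P Q where wit: "similar_mat_wit A B P Q" by (auto simp: similar_mat_def)
  from similar_mat_witD2[OF A wit] have P: "P \<in> carrier_mat n n" and Q: "Q \<in> carrier_mat n n"
    and PQ: "P * Q = 1\<^sub>m n" and AB: "A = P * B * Q" by auto
  define b where "b i = B $$ (i, i)" for i
  have ev: "norm (u * b i) < 1" if "i < n" for i
  proof (rule small)
    have "char_poly A = (\<Prod>a\<leftarrow>diag_mat B. [:- a, 1:])"
      using char_poly_similar[OF B(3)] char_poly_upper_triangular[OF B(1,2)] by simp
    moreover have "b i \<in> set (diag_mat B)" using B(1) that by (auto simp: diag_mat_def b_def)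
    ultimately have "poly (char_poly A) (b i) = 0" by (simp add: poly_prod_list_zero_iff)
    then show "eigenvalue A (b i)" using eigenvalue_root_char_poly[OF A] by simp
  qed
  have tr: "mtrace (A ^\<^sub>m k) = (\<Sum>i = 0..<n. b i ^ k)" for k
  proof -
    have "mtrace (A ^\<^sub>m k) = mtrace (B ^\<^sub>m k)"
      by (rule mtrace_similar[OF similar_mat_wit_pow[OF wit]])
    also have "\<dots> = (\<Sum>i = 0..<n. b i ^ k)"
      unfolding mtrace_def using upper_triangular_pow[OF B(1,2), of k] B(1)
      by (auto simp: b_def intro!: sum.cong)
    finally show ?thesis .
  qed
  have ser: "(\<lambda>l. (b i) ^ Suc l * u ^ Suc l / of_nat (Suc l)) sums (- ln (1 - u * b i))" if "i < n" for i
  proof -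
    have "(\<lambda>l. - ((u * b i) ^ l) / of_nat l) sums ln (1 - u * b i)"
      using Ln_series'[of "- (u * b i)"] ev[OF that] by simp
    then have "(\<lambda>l. - ((u * b i) ^ Suc l) / of_nat (Suc l)) sums ln (1 - u * b i)"
      by (subst sums_Suc_iff) simp
    from sums_minus[OF this] show ?thesis by (simp add: power_mult_distrib mult_ac)
  qed
  let ?s = "\<Sum>i = 0..<n. - ln (1 - u * b i)"
  have "(\<lambda>l. \<Sum>i = 0..<n. (b i) ^ Suc l * u ^ Suc l / of_nat (Suc l)) sums ?s"
    by (rule sums_sum) (use ser in auto)
  then have 1: "(\<lambda>l. mtrace (A ^\<^sub>m Suc l) * u ^ Suc l / of_nat (Suc l)) sums ?s"
    unfolding tr by (simp add: sum_distrib_right sum_divide_distrib)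
  have ne: "1 - u * b i \<noteq> 0" if "i < n" for i
    using ev[OF that] by (metis eq_iff_diff_eq_0 less_irrefl norm_one)
  have "exp (- ?s) = (\<Prod>i = 0..<n. exp (ln (1 - u * b i)))"
    by (simp add: sum_negf exp_sum)
  also have "\<dots> = (\<Prod>i = 0..<n. 1 - u * b i)"
    by (intro prod.cong refl exp_Ln ne) simp
  also have "\<dots> = Determinant.det (1\<^sub>m n - u \<cdot>\<^sub>m B)"
  proof -
    have "upper_triangular (1\<^sub>m n - u \<cdot>\<^sub>m B)"
    proof (rule upper_triangularI)
      fix i j assume ij: "j < i" "i < dim_row (1\<^sub>m n - u \<cdot>\<^sub>m B)"
      then have "B $$ (i, j) = 0" using B by (auto elim!: upper_triangularD)
      then show "(1\<^sub>m n - u \<cdot>\<^sub>m B) $$ (i, j) = 0" using ij B(1) by auto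
    qed
    then have "Determinant.det (1\<^sub>m n - u \<cdot>\<^sub>m B) = prod_list (diag_mat (1\<^sub>m n - u \<cdot>\<^sub>m B))"
      by (rule det_upper_triangular) (use B(1) in auto)
    also have "\<dots> = (\<Prod>i = 0..<n. 1 - u * b i)"
      unfolding prod_list_diag_prod using B(1) by (auto simp: b_def intro!: prod.cong)
    finally show ?thesis by simp
  qed
  also have "\<dots> = Determinant.det (1\<^sub>m n - u \<cdot>\<^sub>m A)"
  proof (rule det_similar[symmetric], rule similar_matI)
    show "{1\<^sub>m n - u \<cdot>\<^sub>m A, 1\<^sub>m n - u \<cdot>\<^sub>m B, P, Q} \<subseteq> carrier_mat n n" using A B P Q by auto
    show "P * Q = 1\<^sub>m n" "Q * P = 1\<^sub>m n" using similar_mat_witD2[OF A wit] by auto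
    have "P * (1\<^sub>m n - u \<cdot>\<^sub>m B) = P - u \<cdot>\<^sub>m (P * B)"
      using P B(1) by (subst mult_minus_distrib_mat[of _ n n]) auto
    also have "\<dots> * Q = P * Q - u \<cdot>\<^sub>m (P * B) * Q"
      using P B(1) Q by (subst minus_mult_distrib_mat[of _ n n]) auto
    also have "\<dots> = 1\<^sub>m n - u \<cdot>\<^sub>m A"
      unfolding PQ AB using P B(1) Q by (subst mult_smult_assoc_mat[of _ n n]) auto
    finally show "1\<^sub>m n - u \<cdot>\<^sub>m A = P * (1\<^sub>m n - u \<cdot>\<^sub>m B) * Q" by simp
  qed
  finally show ?thesis using 1 by blast
qed

text \<open>
  Compare the two sides of the eigenvalue equation at a coordinate of maximal absolute value.
\<close>

lemma eigenvalue_row_sum_bound: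
  fixes A :: "complex mat"
  assumes A: "A \<in> carrier_mat n n" and D: "\<And>i. i < n \<Longrightarrow> (\<Sum>j = 0..<n. norm (A $$ (i, j))) \<le> D"
    and "eigenvalue A k"
  shows "norm k \<le> D"
proof -
  obtain v where v: "v \<in> carrier_vec n" "v \<noteq> 0\<^sub>v n" "A *\<^sub>v v = k \<cdot>\<^sub>v v"
    using assms(3) A by (auto simp: eigenvalue_def eigenvector_def)
  have "n \<noteq> 0" using v(1,2) by (metis carrier_vecD eq_vecI index_zero_vec(2) less_zeroE)
  define m where "m = Max ((\<lambda>i. norm (vec_index v i)) ` {0..<n})"
  have "m \<in> (\<lambda>i. norm (vec_index v i)) ` {0..<n}" unfolding m_def using \<open>n \<noteq> 0\<close> by (intro Max_in) auto
  then obtain i where i: "i < n" "norm (vec_index v i) = m" by auto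
  have le: "norm (vec_index v j) \<le> m" if "j < n" for j unfolding m_def using that by (intro Max_ge) auto
  have "m > 0"
  proof (rule ccontr)
    assume "\<not> m > 0"
    then have "vec_index v j = 0" if "j < n" for j
      using le[OF that] by (metis dual_order.trans linorder_le_less_linear norm_le_zero_iff)
    then have "v = 0\<^sub>v n" using v(1) by (intro eq_vecI) auto
    then show False using v(2) by simp
  qed
  have "k * vec_index v i = vec_index (A *\<^sub>v v) i" using v i by simp
  also have "\<dots> = (\<Sum>j = 0..<n. A $$ (i, j) * vec_index v j)"
    using A v(1) i(1) by (simp add: scalar_prod_def)
  finally have "norm k * m = norm (\<Sum>j = 0..<n. A $$ (i, j) * vec_index v j)"
    using i by (metis norm_mult)
  also have "\<dots> \<le> (\<Sum>j = 0..<n. norm (A $$ (i, j)) * m)"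
    by (intro sum_norm_le) (auto simp: norm_mult intro!: mult_left_mono le)
  also have "\<dots> = (\<Sum>j = 0..<n. norm (A $$ (i, j))) * m" by (simp add: sum_distrib_right)
  also have "\<dots> \<le> D * m" using D[OF i(1)] \<open>m > 0\<close> by (intro mult_right_mono) auto
  finally show ?thesis using \<open>m > 0\<close> by simp
qed

text \<open>
  The product of the entries of \<open>M\<close> along the word that starts with \<open>e\<close>, continues with \<open>p\<close> and ends
  with \<open>f\<close>; these words index the terms of an entry of a power of \<open>M\<close>.
\<close>

definition pathprod :: "('a \<Rightarrow> 'a \<Rightarrow> 'b::comm_monoid_mult) \<Rightarrow> 'a \<Rightarrow> 'a list \<Rightarrow> 'a \<Rightarrow> 'b" where
  "pathprod M e p f = (\<Prod>j<Suc (length p). M ((e # p) ! j) ((p @ [f]) ! j))"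

definition cycprod :: "('a \<Rightarrow> 'a \<Rightarrow> 'b::comm_monoid_mult) \<Rightarrow> 'a list \<Rightarrow> 'b" where
  "cycprod M p = (\<Prod>j<length p. M (p ! j) (p ! (Suc j mod length p)))"

lemma pathprod_Nil: "pathprod M e [] f = M e f"
  by (simp add: pathprod_def)

lemma pathprod_Cons: "pathprod M e (g # p) f = M e g * pathprod M g p f"
  unfolding pathprod_def by (subst list.size(4), subst prod.lessThan_Suc_shift) simp

lemma pathprod_closed: "pathprod M e p e = cycprod M (e # p)"
proof -
  have "(p @ [e]) ! j = (e # p) ! (Suc j mod Suc (length p))" if "j < Suc (length p)" for j
  proof (cases "j < length p")
    case False
    then have "j = length p" using that by simp
    then show ?thesis by simp
  qed (simp add: nth_append)
  then show ?thesis by (simp add: pathprod_def cycprod_def del: prod.lessThan_Suc)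
qed

definition words :: "'a set \<Rightarrow> nat \<Rightarrow> 'a list set" where
  "words E l = {p. set p \<subseteq> E \<and> length p = l}"

lemma finite_words: "finite E \<Longrightarrow> finite (words E l)"
  unfolding words_def by (rule finite_lists_length_eq)

lemma sum_words_Suc:
  "(\<Sum>p\<in>words E (Suc l). g p) = (\<Sum>e\<in>E. \<Sum>p\<in>words E l. g (e # p))"
proof -
  have "(\<Sum>e\<in>E. \<Sum>p\<in>words E l. g (e # p)) = (\<Sum>(e, p)\<in>E \<times> words E l. g (e # p))"
    by (rule sum.cartesian_product)
  also have "\<dots> = (\<Sum>p\<in>words E (Suc l). g p)"
    by (rule sum.reindex_bij_witness[where i = "\<lambda>p. (hd p, tl p)" and j = "\<lambda>(e, p). e # p"])
       (auto simp: words_def length_Suc_conv)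
  finally show ?thesis by simp
qed

lemma words_0 [simp]: "words E 0 = {[]}"
  by (auto simp: words_def)

lemma pow_mat_words:
  fixes M :: "'a \<Rightarrow> 'a \<Rightarrow> 'b::comm_ring_1"
  assumes xs: "distinct xs" "set xs = E"
  defines "A \<equiv> Matrix.mat (length xs) (length xs) (\<lambda>(i, j). M (xs ! i) (xs ! j))"
  assumes "i < length xs" "j < length xs"
  shows "(A ^\<^sub>m Suc k) $$ (i, j) = (\<Sum>p\<in>words E k. pathprod M (xs ! i) p (xs ! j))"
  using assms(4)
proof (induction k arbitrary: i)
  case 0
  then show ?case using assms(5) by (simp add: A_def pathprod_Nil)
next
  case (Suc k)
  let ?n = "length xs"
  have A: "A \<in> carrier_mat ?n ?n" by (simp add: A_def)
  have Ae: "A $$ (a, b) = M (xs ! a) (xs ! b)" if "a < ?n" "b < ?n" for a b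
    using that by (simp add: A_def)
  have comm: "A * A ^\<^sub>m m = A ^\<^sub>m m * A" for m
  proof (induction m)
    case (Suc m)
    have "A * A ^\<^sub>m Suc m = A * A ^\<^sub>m m * A" using A by (simp add: assoc_mult_mat[of _ ?n ?n _ ?n _ ?n])
    then show ?case using Suc by simp
  qed (use A in auto)
  have "(A ^\<^sub>m Suc (Suc k)) $$ (i, j) = (A * A ^\<^sub>m Suc k) $$ (i, j)"
    by (subst comm) (simp only: pow_mat.simps(2))
  also have "\<dots> = (\<Sum>l = 0..<?n. A $$ (i, l) * (A ^\<^sub>m Suc k) $$ (l, j))"
    using A Suc.prems assms(5) by (simp add: scalar_prod_def del: pow_mat.simps)
  also have "\<dots> = (\<Sum>l = 0..<?n. \<Sum>p\<in>words E k. pathprod M (xs ! i) (xs ! l # p) (xs ! j))"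
    by (intro sum.cong refl) (simp add: Suc.IH Suc.prems Ae sum_distrib_left pathprod_Cons del: pow_mat.simps)
  also have "\<dots> = (\<Sum>e\<in>E. \<Sum>p\<in>words E k. pathprod M (xs ! i) (e # p) (xs ! j))"
    by (rule sum_enum[OF xs])
  also have "\<dots> = (\<Sum>p\<in>words E (Suc k). pathprod M (xs ! i) p (xs ! j))"
    by (rule sum_words_Suc[symmetric])
  finally show ?case .
qed

text \<open>
  The trace of a power of \<open>M\<close> is a sum over cyclic words. The bound on the row sums makes the series
  converge for the same \<open>u\<close> on all finite index sets.
\<close>

lemma exp_closed_words_series:
  fixes M :: "'a \<Rightarrow> 'a \<Rightarrow> complex"
  assumes "finite E" and D: "\<And>e. e \<in> E \<Longrightarrow> (\<Sum>f\<in>E. norm (M e f)) \<le> D" and u: "norm u * D < 1"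
  shows "\<exists>s. (\<lambda>l. (\<Sum>p\<in>words E (Suc l). cycprod M p) * u ^ Suc l / of_nat (Suc l)) sums s \<and>
             exp (- s) = fdet (\<lambda>e f. (if e = f then 1 else 0) - u * M e f) E"
proof -
  obtain xs where xs: "distinct xs" "set xs = E" by (rule obtain_enum[OF assms(1)])
  let ?n = "length xs"
  define A where "A = Matrix.mat ?n ?n (\<lambda>(i, j). M (xs ! i) (xs ! j))"
  have A: "A \<in> carrier_mat ?n ?n" by (simp add: A_def)
  have "norm (u * k) < 1" if "eigenvalue A k" for k
  proof -
    have "norm k \<le> D"
    proof (rule eigenvalue_row_sum_bound[OF A _ that])
      fix i assume i: "i < ?n"
      have "(\<Sum>j = 0..<?n. norm (A $$ (i, j))) = (\<Sum>j = 0..<?n. norm (M (xs ! i) (xs ! j)))"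
        using i by (simp add: A_def)
      also have "\<dots> = (\<Sum>f\<in>E. norm (M (xs ! i) f))" by (rule sum_enum[OF xs])
      also have "\<dots> \<le> D" by (rule D) (use xs i in auto)
      finally show "(\<Sum>j = 0..<?n. norm (A $$ (i, j))) \<le> D" .
    qed
    then show ?thesis using u by (smt (verit) mult_left_mono norm_ge_zero norm_mult)
  qed
  from exp_trace_series[OF A this] obtain s where s:
    "(\<lambda>l. mtrace (A ^\<^sub>m Suc l) * u ^ Suc l / of_nat (Suc l)) sums s"
    "exp (- s) = Determinant.det (1\<^sub>m ?n - u \<cdot>\<^sub>m A)" by blast
  have "mtrace (A ^\<^sub>m Suc l) = (\<Sum>p\<in>words E (Suc l). cycprod M p)" for l
  proof -
    have "mtrace (A ^\<^sub>m Suc l) = (\<Sum>i = 0..<?n. \<Sum>p\<in>words E l. pathprod M (xs ! i) p (xs ! i))"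
      unfolding mtrace_def using A
      by (auto intro!: sum.cong simp: pow_mat_words[OF xs, of _ _ M, folded A_def] simp del: pow_mat.simps)
    also have "\<dots> = (\<Sum>e\<in>E. \<Sum>p\<in>words E l. pathprod M e p e)" by (rule sum_enum[OF xs])
    finally show ?thesis by (simp add: sum_words_Suc pathprod_closed)
  qed
  moreover have "1\<^sub>m ?n - u \<cdot>\<^sub>m A = Matrix.mat ?n ?n (\<lambda>(i, j). (if xs ! i = xs ! j then 1 else 0) - u * M (xs ! i) (xs ! j))"
    using xs(1) by (intro eq_matI) (auto simp: A_def nth_eq_iff_index_eq)
  ultimately show ?thesis using s by (intro exI[of _ s]) (simp add: fdet_eq_det[OF xs])
qed

section \<open>Powers and rotations of words\<close>

definition wpow :: "nat \<Rightarrow> 'a list \<Rightarrow> 'a list" where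
  "wpow m q = concat (replicate m q)"

lemma wpow_0 [simp]: "wpow 0 q = []" by (simp add: wpow_def)
lemma wpow_Suc: "wpow (Suc m) q = q @ wpow m q" by (simp add: wpow_def)
lemma wpow_Nil [simp]: "wpow m [] = []" by (simp add: wpow_def)
lemma wpow_1 [simp]: "wpow (Suc 0) q = q" by (simp add: wpow_def)
lemma wpow_add: "wpow (m + n) q = wpow m q @ wpow n q" by (simp add: wpow_def replicate_add)
lemma length_wpow [simp]: "length (wpow m q) = m * length q"
  by (induction m) (simp_all add: wpow_Suc)
lemma set_wpow [simp]: "m > 0 \<Longrightarrow> set (wpow m q) = set q"
  by (simp add: wpow_def)
lemma wpow_wpow: "wpow m (wpow n q) = wpow (m * n) q"
  by (induction m) (simp_all add: wpow_Suc wpow_add)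

lemma nth_wpow: "j < m * length q \<Longrightarrow> wpow m q ! j = q ! (j mod length q)"
proof (induction m arbitrary: j)
  case (Suc m)
  show ?case
  proof (cases "j < length q")
    case False
    then have "wpow (Suc m) q ! j = wpow m q ! (j - length q)" by (simp add: wpow_Suc nth_append)
    also have "\<dots> = q ! ((j - length q) mod length q)" using Suc False by (intro Suc.IH) auto
    finally show ?thesis using False by (simp add: le_mod_geq)
  qed (simp add: wpow_Suc nth_append)
qed simp

lemma rotate1_wpow: "rotate1 (wpow m q) = wpow m (rotate1 q)"
proof (cases q)
  case (Cons x xs)
  have "xs @ wpow n (x # xs) @ [x] = wpow (Suc n) (xs @ [x])" for n
    by (induction n) (simp_all add: wpow_Suc)
  then show ?thesis using Cons by (cases m) (simp_all add: wpow_Suc)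
qed simp

lemma rotate_wpow: "rotate k (wpow m q) = wpow m (rotate k q)"
  by (induction k) (simp_all add: rotate1_wpow)

definition primitive :: "'a list \<Rightarrow> bool" where
  "primitive q \<longleftrightarrow> q \<noteq> [] \<and> (\<forall>r m. m \<ge> 2 \<longrightarrow> q \<noteq> wpow m r)"

lemma primitive_root_exists:
  assumes "p \<noteq> []"
  shows "\<exists>q m. primitive q \<and> m > 0 \<and> p = wpow m q"
  using assms
proof (induction "length p" arbitrary: p rule: less_induct)
  case less
  show ?case
  proof (cases "primitive p")
    case True
    then show ?thesis by (intro exI[of _ p] exI[of _ 1]) auto
  next
    case False
    then obtain r m where r: "m \<ge> 2" "p = wpow m r" using less.prems by (auto simp: primitive_def)
    then have "r \<noteq> []" using less.prems by auto
    moreover have "length r < length p" using r \<open>r \<noteq> []\<close> by auto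
    ultimately obtain q n where "primitive q" "n > 0" "r = wpow n q" using less.hyps by blast
    then show ?thesis using r by (intro exI[of _ q] exI[of _ "m * n"]) (auto simp: wpow_wpow)
  qed
qed

text \<open>
  Both \<open>q @ r\<close> and \<open>r @ q\<close> are prefixes of \<open>p @ p\<close>, where \<open>p\<close> is the common power, because \<open>p\<close> starts
  with either word and commutes with both.
\<close>

lemma wpow_eq_imp_commute:
  assumes "wpow m q = wpow n r" "m > 0" "n > 0"
  shows "q @ r = r @ q"
proof -
  define p where "p = wpow m q"
  have pq: "p = q @ wpow (m - 1) q" "q @ p = p @ q"
    using assms(2) wpow_add[of 1 m q] wpow_add[of m 1 q] wpow_add[of 1 "m - 1" q] by (auto simp: p_def)
  have pr: "p = r @ wpow (n - 1) r" "r @ p = p @ r"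
    using assms wpow_add[of 1 n r] wpow_add[of n 1 r] wpow_add[of 1 "n - 1" r] by (auto simp: p_def)
  have "length q \<le> length p" by (subst pq(1)) simp
  moreover have "length r \<le> length p" by (subst pr(1)) simp
  ultimately have l: "length q + length r \<le> length (p @ p)" by simp
  have "take (length q + length r) (p @ p) = take (length q + length r) ((p @ p) @ q)" using l by simp
  also have "(p @ p) @ q = q @ p @ p" by (metis append_assoc pq(2))
  also have "\<dots> = q @ (r @ wpow (n - 1) r) @ p" by (subst pr(1)[symmetric]) (rule refl)
  finally have 1: "take (length q + length r) (p @ p) = q @ r" by simp
  have "take (length q + length r) (p @ p) = take (length q + length r) ((p @ p) @ r)" using l by simp
  also have "(p @ p) @ r = r @ p @ p" by (metis append_assoc pr(2))
  also have "\<dots> = r @ (q @ wpow (m - 1) q) @ p" by (subst pq(1)[symmetric]) (rule refl)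
  finally have 2: "take (length q + length r) (p @ p) = r @ q" by simp
  show ?thesis using 1 2 by simp
qed

lemma primitive_root_unique:
  assumes "primitive q" "primitive r" "wpow m q = wpow n r" "m > 0" "n > 0"
  shows "q = r \<and> m = n"
proof -
  obtain a b z where z: "q = wpow a z" "r = wpow b z"
    using comm_append_are_replicate[OF wpow_eq_imp_commute[OF assms(3-5)]] by (auto simp: wpow_def)
  have "a = 1" "b = 1" using assms(1,2) z unfolding primitive_def
    by (metis One_nat_def Suc_1 Suc_leI less_one linorder_neqE_nat wpow_0 nat_neq_iff)+
  then have "q = r" using z by simp
  moreover have "length q > 0" using assms(1) by (auto simp: primitive_def)
  ultimately show ?thesis using arg_cong[OF assms(3), of length] by simp
qed

text \<open>
  A nontrivial rotation fixing \<open>q\<close> splits \<open>q\<close> into two commuting words, which are powers of one word.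
\<close>

lemma primitive_rotate_eq:
  assumes "primitive q" "k < length q" "rotate k q = q"
  shows "k = 0"
proof (rule ccontr)
  assume "k \<noteq> 0"
  have "drop k q @ take k q = take k q @ drop k q"
    using assms(2,3) by (simp add: rotate_drop_take)
  moreover have "take k q \<noteq> []" "drop k q \<noteq> []" using assms(2) \<open>k \<noteq> 0\<close> by auto
  ultimately obtain n z where "n > 1" "concat (replicate n z) = drop k q @ take k q"
    using comm_append_is_replicate by metis
  then have "q = wpow n z" using assms(2,3) by (simp add: wpow_def rotate_drop_take)
  moreover have "n \<ge> 2" using \<open>n > 1\<close> by simp
  ultimately show False using assms(1) unfolding primitive_def by blast
qed

lemma rotate_sym: "rotate k p = q \<Longrightarrow> \<exists>j. p = rotate j q"
proof -
  assume "rotate k p = q"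
  then have q: "q = rotate (k mod length p) p" using rotate_conv_mod[of k p] by simp
  have "rotate (length p - k mod length p) q = rotate (length p - k mod length p + k mod length p) p"
    by (simp add: q rotate_rotate)
  also have "\<dots> = p" by (cases "p = []") (auto simp: le_add_diff_inverse2 less_imp_le)
  finally show ?thesis by metis
qed

lemma primitive_rotate: "primitive q \<Longrightarrow> primitive (rotate k q)"
proof -
  assume q: "primitive q"
  obtain j where j: "q = rotate j (rotate k q)" using rotate_sym by metis
  have "rotate k q \<noteq> wpow m r" if "m \<ge> 2" for r m
    using q that j rotate_wpow[of j m r] unfolding primitive_def by metis
  then show ?thesis using q by (simp add: primitive_def)
qed

lemma cycprod_rotate1: "cycprod M (rotate1 p) = cycprod M p"
proof (cases p)
  case (Cons x xs)
  let ?n = "Suc (length xs)"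
  let ?g = "\<lambda>j. M (p ! j) (p ! (Suc j mod ?n))"
  have "cycprod M (rotate1 p) = (\<Prod>j<?n. ?g (Suc j mod ?n))"
    unfolding cycprod_def by (intro prod.cong) (auto simp: Cons nth_rotate1[of _ "x # xs", simplified] simp del: nth_Cons_Suc)
  also have "\<dots> = (\<Prod>j<length xs. ?g (Suc j)) * ?g 0"
    by (subst prod.lessThan_Suc) (auto intro!: prod.cong arg_cong2[of _ _ _ _ "(*)"])
  also have "\<dots> = (\<Prod>j<?n. ?g j)" by (subst prod.lessThan_Suc_shift) (simp add: mult.commute)
  finally show ?thesis by (simp add: cycprod_def Cons)
qed simp

lemma cycprod_rotate: "cycprod M (rotate k p) = cycprod M p"
  by (induction k) (simp_all add: cycprod_rotate1)

lemma prod_lessThan_mult: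
  "(\<Prod>j<m * l. f (j mod l)) = (\<Prod>j<l. f j :: 'b::comm_monoid_mult) ^ m" if "l > 0"
proof (induction m)
  case (Suc m)
  have eq: "{..<Suc m * l} = {..<m * l} \<union> {m * l..<m * l + l}" by auto
  have "(\<Prod>j<Suc m * l. f (j mod l)) = (\<Prod>j<m * l. f (j mod l)) * (\<Prod>j = m * l..<m * l + l. f (j mod l))"
    unfolding eq by (rule prod.union_disjoint) auto
  also have "(\<Prod>j = m * l..<m * l + l. f (j mod l)) = (\<Prod>j<l. f j)"
    by (rule prod.reindex_bij_witness[of _ "\<lambda>j. j + m * l" "\<lambda>j. j - m * l"])
       (auto simp: le_iff_add mod_mult_self3)
  finally show ?case using Suc by (simp add: mult.commute)
qed simp

lemma cycprod_wpow:
  assumes "q \<noteq> []"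
  shows "cycprod M (wpow m q) = cycprod M q ^ m"
proof (cases "m = 0")
  case False
  let ?l = "length q"
  have l: "?l > 0" using assms by simp
  have "cycprod M (wpow m q) = (\<Prod>j<m * ?l. M (q ! (j mod ?l)) (q ! (Suc (j mod ?l) mod ?l)))"
    unfolding cycprod_def
  proof (intro prod.cong)
    fix j assume "j \<in> {..<m * ?l}"
    then have j: "j < m * ?l" by simp
    have "Suc j mod (m * ?l) < m * ?l" using False l by (intro mod_less_divisor) simp
    moreover have "Suc j mod (m * ?l) mod ?l = Suc (j mod ?l) mod ?l"
      by (simp add: mod_mod_cancel mod_Suc_eq)
    ultimately show "M (wpow m q ! j) (wpow m q ! (Suc j mod length (wpow m q))) =
        M (q ! (j mod ?l)) (q ! (Suc (j mod ?l) mod ?l))"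
      using j by (simp add: nth_wpow)
  qed simp
  also have "\<dots> = cycprod M q ^ m"
    unfolding cycprod_def by (rule prod_lessThan_mult[OF l])
  finally show ?thesis .
qed (simp add: cycprod_def)

section \<open>The Euler product over the prime cycles\<close>

lemma cas_iff:
  "pre_digraph.cas X u p v \<longleftrightarrow>
    (if p = [] then u = v
     else tail X (hd p) = u \<and> head X (last p) = v \<and>
       (\<forall>j. Suc j < length p \<longrightarrow> head X (p ! j) = tail X (p ! Suc j)))"
proof (induction p arbitrary: u)
  case Nil
  show ?case by (simp add: pre_digraph.cas.simps)
next
  case (Cons e es)
  show ?case
  proof (cases es)
    case Nil
    then show ?thesis by (auto simp: pre_digraph.cas.simps)
  next
    case (Cons f fs)
    have eqv: "(\<forall>j. Suc j < length (e # es) \<longrightarrow> head X ((e # es) ! j) = tail X ((e # es) ! Suc j)) \<longleftrightarrow>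
       head X e = tail X f \<and> (\<forall>j. Suc j < length es \<longrightarrow> head X (es ! j) = tail X (es ! Suc j))"
      (is "?l \<longleftrightarrow> ?r")
    proof
      assume ?l
      then show ?r using Cons by (metis Suc_less_eq length_Cons nth_Cons_0 nth_Cons_Suc zero_less_Suc)
    next
      assume r: ?r
      show ?l
      proof (intro allI impI)
        fix j assume "Suc j < length (e # es)"
        then show "head X ((e # es) ! j) = tail X ((e # es) ! Suc j)"
          using r Cons by (cases j) auto
      qed
    qed
    have "es \<noteq> []" "hd es = f" using Cons by auto
    then show ?thesis unfolding pre_digraph.cas.simps Cons.IH eqv by auto
  qed
qed

text \<open>
  With indices modulo the length the condition is visibly invariant under rotations, and compatible
  with powers.
\<close>

lemma closed_paths_iff:
  assumes "wf_digraph X"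
  shows "p \<in> closed_paths X \<longleftrightarrow> p \<noteq> [] \<and> set p \<subseteq> arcs X \<and>
     (\<forall>j<length p. head X (p ! j) = tail X (p ! (Suc j mod length p)))"
proof (cases "p = []")
  case False
  have eq: "(\<forall>j<length p. head X (p ! j) = tail X (p ! (Suc j mod length p))) \<longleftrightarrow>
     head X (last p) = tail X (hd p) \<and> (\<forall>j. Suc j < length p \<longrightarrow> head X (p ! j) = tail X (p ! Suc j))"
    (is "?l \<longleftrightarrow> ?r")
  proof
    assume l: ?l
    have "head X (p ! (length p - 1)) = tail X (p ! (Suc (length p - 1) mod length p))"
      using l False by simp
    then have "head X (last p) = tail X (hd p)" using False by (simp add: last_conv_nth hd_conv_nth)
    moreover have "head X (p ! j) = tail X (p ! Suc j)" if "Suc j < length p" for j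
      using l[rule_format, of j] that by simp
    ultimately show ?r by blast
  next
    assume r: ?r
    show ?l
    proof (intro allI impI)
      fix j assume j: "j < length p"
      show "head X (p ! j) = tail X (p ! (Suc j mod length p))"
      proof (cases "Suc j < length p")
        case False
        then have "j = length p - 1" "Suc j = length p" using j by auto
        then show ?thesis using r \<open>p \<noteq> []\<close> by (simp add: last_conv_nth hd_conv_nth)
      qed (use r in simp)
    qed
  qed
  have "tail X (hd p) \<in> verts X" if "set p \<subseteq> arcs X"
    using that False wf_digraph.tail_in_verts[OF assms] by (metis hd_in_set subsetD)
  then show ?thesis
    using False by (auto simp: closed_paths_def pre_digraph.awalk_def cas_iff eq)
qed (simp add: closed_paths_def)

lemma class_value_eqI:
  assumes "q \<in> c" "\<And>p. p \<in> c \<Longrightarrow> f p = f q"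
  shows "class_value f c = f q"
proof -
  have "f ` c = {f q}" using assms by blast
  then show ?thesis by (simp add: class_value_def)
qed

definition rot_class :: "'a list \<Rightarrow> 'a list set" where
  "rot_class q = range (\<lambda>k. rotate k q)"

context wf_digraph
begin

lemma closed_wpow_iff:
  assumes "m > 0"
  shows "wpow m q \<in> closed_paths G \<longleftrightarrow> q \<in> closed_paths G"
proof (cases "q = []")
  case False
  let ?l = "length q"
  let ?P = "\<lambda>j. head G (q ! (j mod ?l)) = tail G (q ! (Suc (j mod ?l) mod ?l))"
  have l: "?l > 0" using False by simp
  have m: "Suc j mod (m * ?l) mod ?l = Suc (j mod ?l) mod ?l" for j
    by (simp add: mod_mod_cancel mod_Suc_eq)
  have lt: "Suc j mod (m * ?l) < m * ?l" for j using l assms by (intro mod_less_divisor) simp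
  have "(\<forall>j<m * ?l. head G (wpow m q ! j) = tail G (wpow m q ! (Suc j mod (m * ?l)))) \<longleftrightarrow>
     (\<forall>j<m * ?l. ?P j)"
    by (intro all_cong) (simp add: nth_wpow lt m)
  also have "\<dots> \<longleftrightarrow> (\<forall>j<?l. ?P j)"
  proof
    assume *: "\<forall>j<m * ?l. ?P j"
    show "\<forall>j<?l. ?P j"
    proof (intro allI impI)
      fix j assume "j < ?l"
      moreover have "?l \<le> m * ?l" using assms by simp
      ultimately show "?P j" using * by (meson less_le_trans)
    qed
  next
    assume *: "\<forall>j<?l. ?P j"
    show "\<forall>j<m * ?l. ?P j" using *[rule_format, of "_ mod ?l"] l by simp
  qed
  finally have eq: "(\<forall>j<m * ?l. head G (wpow m q ! j) = tail G (wpow m q ! (Suc j mod (m * ?l)))) \<longleftrightarrow>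
     (\<forall>j<?l. head G (q ! j) = tail G (q ! (Suc j mod ?l)))" by simp
  have "wpow m q \<noteq> []" using False assms by (metis length_wpow length_0_conv mult_is_0 not_gr_zero)
  then show ?thesis
    using False assms eq by (simp add: closed_paths_iff[OF wf_digraph])
qed (simp add: closed_paths_iff[OF wf_digraph])

lemma closed_rotate_iff: "rotate k p \<in> closed_paths G \<longleftrightarrow> p \<in> closed_paths G"
proof -
  have "rotate k p \<in> closed_paths G" if p: "p \<in> closed_paths G" for k p
  proof -
    let ?l = "length p"
    have p': "p \<noteq> []" "set p \<subseteq> arcs G" "\<And>j. j < ?l \<Longrightarrow> head G (p ! j) = tail G (p ! (Suc j mod ?l))"
      using p by (auto simp: closed_paths_iff[OF wf_digraph])
    have "head G (rotate k p ! j) = tail G (rotate k p ! (Suc j mod ?l))" if "j < ?l" for j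
    proof -
      have l: "?l > 0" using p'(1) by simp
      have "rotate k p ! (Suc j mod ?l) = p ! ((k + Suc j mod ?l) mod ?l)"
        using l by (intro nth_rotate) simp
      also have "(k + Suc j mod ?l) mod ?l = Suc ((k + j) mod ?l) mod ?l"
        by (metis add_Suc_right mod_Suc_eq mod_add_right_eq)
      finally show ?thesis using p'(3)[of "(k + j) mod ?l"] l that by (simp add: nth_rotate)
    qed
    then show ?thesis using p' by (auto simp: closed_paths_iff[OF wf_digraph])
  qed
  then show ?thesis using rotate_sym[of k p] by metis
qed

lemma rot_class_eq: "p \<in> rot_class q \<Longrightarrow> rot_class p = rot_class q"
proof -
  have sub: "rot_class p \<subseteq> rot_class q" if "p \<in> rot_class q" for p q
    using that by (auto simp: rot_class_def rotate_rotate)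
  assume p: "p \<in> rot_class q"
  then obtain k where "rotate k q = p" by (auto simp: rot_class_def)
  then have "q \<in> rot_class p" using rotate_sym[of k q p] by (auto simp: rot_class_def)
  with p show ?thesis using sub by blast
qed

lemma self_rot_class: "q \<in> rot_class q"
  unfolding rot_class_def by (rule range_eqI[of _ _ 0]) simp

lemma card_rot_class:
  assumes "primitive q"
  shows "finite (rot_class q)" "card (rot_class q) = length q"
proof -
  have q: "q \<noteq> []" using assms by (simp add: primitive_def)
  have eq: "rot_class q = (\<lambda>k. rotate k q) ` {..<length q}"
    using q by (auto simp: rot_class_def image_iff) (metis length_greater_0_conv lessThan_iff mod_less_divisor rotate_conv_mod)
  have "inj_on (\<lambda>k. rotate k q) {..<length q}"
  proof (rule linorder_inj_onI)
    fix i j assume ij: "i < j" "j \<in> {..<length q}"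
    show "rotate i q \<noteq> rotate j q"
    proof
      assume *: "rotate i q = rotate j q"
      have "rotate (length q - j) (rotate j q) = q" using ij by (simp add: rotate_rotate)
      moreover have "rotate (length q - j) (rotate i q) = rotate (length q - j + i) q" by (simp add: rotate_rotate)
      ultimately have "rotate (length q - j + i) q = q" using * by simp
      then have "length q - j + i = 0" using ij by (intro primitive_rotate_eq[OF assms]) auto
      then show False using ij by auto
    qed
  qed auto
  then show "finite (rot_class q)" "card (rot_class q) = length q" by (simp_all add: eq card_image)
qed

lemma prime_cycles_iff:
  "c \<in> prime_cycles G \<longleftrightarrow> (\<exists>q\<in>closed_paths G. primitive q \<and> c = rot_class q)"
proof -
  let ?R = "{(p, q). p \<in> closed_paths G \<and> q \<in> closed_paths G \<and> (\<exists>k. q = rotate k p)}"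
  have img: "?R `` {q} = rot_class q" if "q \<in> closed_paths G" for q
    using that closed_rotate_iff by (auto simp: rot_class_def)
  have ne: "q \<noteq> []" if "q \<in> closed_paths G" for q using that by (simp add: closed_paths_def)
  have prim: "(\<exists>p\<in>rot_class q. \<exists>r\<in>closed_paths G. \<exists>m\<ge>2. p = concat (replicate m r)) \<longleftrightarrow> \<not> primitive q"
    if q: "q \<in> closed_paths G" for q
  proof
    assume "\<exists>p\<in>rot_class q. \<exists>r\<in>closed_paths G. \<exists>m\<ge>2. p = concat (replicate m r)"
    then obtain k r m where "m \<ge> 2" "rotate k q = wpow m r" by (auto simp: rot_class_def wpow_def)
    then show "\<not> primitive q" using primitive_rotate[of q k] by (auto simp: primitive_def)
  next
    assume "\<not> primitive q"
    then obtain m r where m: "m \<ge> 2" "q = wpow m r" using ne[OF q] by (auto simp: primitive_def)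
    then have "r \<in> closed_paths G" using closed_wpow_iff[of m r] q by simp
    then show "\<exists>p\<in>rot_class q. \<exists>r\<in>closed_paths G. \<exists>m\<ge>2. p = concat (replicate m r)"
      using m self_rot_class[of q] by (auto simp: wpow_def)
  qed
  have "c \<in> cycles G \<longleftrightarrow> (\<exists>q\<in>closed_paths G. c = rot_class q)"
    using img by (auto simp: cycles_def quotient_def)
  then show ?thesis unfolding prime_cycles_def using prim by blast
qed

text \<open>
  Every closed path is a power of exactly one primitive closed path, and the primitive closed paths
  are the members of the prime cycles.
\<close>

lemma prime_cycle_power_bij:
  "bij_betw (\<lambda>(c, q, k). wpow (Suc k) q) (SIGMA c:prime_cycles G. c \<times> UNIV) (closed_paths G)"
proof -
  have prime: "q \<in> closed_paths G \<and> primitive q \<and> c = rot_class q" if "c \<in> prime_cycles G" "q \<in> c" for c q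
  proof -
    obtain x where x: "x \<in> closed_paths G" "primitive x" "c = rot_class x"
      using \<open>c \<in> prime_cycles G\<close> by (auto simp: prime_cycles_iff)
    then obtain k where "q = rotate k x" using \<open>q \<in> c\<close> by (auto simp: rot_class_def)
    then show ?thesis using x rot_class_eq[of q x] \<open>q \<in> c\<close> closed_rotate_iff primitive_rotate by auto
  qed
  show ?thesis
    unfolding bij_betw_def
  proof
    show "inj_on (\<lambda>(c, q, k). wpow (Suc k) q) (SIGMA c:prime_cycles G. c \<times> UNIV)"
    proof (rule inj_onI)
      fix y z assume y: "y \<in> (SIGMA c:prime_cycles G. c \<times> (UNIV :: nat set))"
        and z: "z \<in> (SIGMA c:prime_cycles G. c \<times> (UNIV :: nat set))"
        and eq: "(\<lambda>(c, q, k). wpow (Suc k) q) y = (\<lambda>(c, q, k). wpow (Suc k) q) z"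
      obtain c q k d r m where yz: "y = (c, q, k)" "z = (d, r, m)" by (cases y, cases z) auto
      have *: "c \<in> prime_cycles G" "q \<in> c" "d \<in> prime_cycles G" "r \<in> d" "wpow (Suc k) q = wpow (Suc m) r"
        using y z eq yz by auto
      then have "q = r \<and> Suc k = Suc m" using prime by (intro primitive_root_unique) auto
      then show "y = z" using prime[OF *(1,2)] prime[OF *(3,4)] yz by auto
    qed
    show "(\<lambda>(c, q, k). wpow (Suc k) q) ` (SIGMA c:prime_cycles G. c \<times> UNIV) = closed_paths G"
    proof (intro equalityI subsetI)
      fix p assume "p \<in> (\<lambda>(c, q, k). wpow (Suc k) q) ` (SIGMA c:prime_cycles G. c \<times> UNIV)"
      then show "p \<in> closed_paths G" using prime closed_wpow_iff by auto
    next
      fix p assume p: "p \<in> closed_paths G"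
      then have "p \<noteq> []" by (simp add: closed_paths_def)
      then obtain q m where q: "primitive q" "m > 0" "p = wpow m q" using primitive_root_exists by blast
      then have "q \<in> closed_paths G" using closed_wpow_iff p by blast
      then have "rot_class q \<in> prime_cycles G" using q by (auto simp: prime_cycles_iff)
      then show "p \<in> (\<lambda>(c, q, k). wpow (Suc k) q) ` (SIGMA c:prime_cycles G. c \<times> UNIV)"
        using q self_rot_class[of q] by (intro image_eqI[of _ _ "(rot_class q, q, m - 1)"]) auto
    qed
  qed
qed

lemma prime_cycle_members:
  assumes "c \<in> prime_cycles G"
  shows "finite c" "\<And>p q. p \<in> c \<Longrightarrow> q \<in> c \<Longrightarrow> length p = length q \<and> cycprod M p = cycprod M q"
    "\<And>q. q \<in> c \<Longrightarrow> card c = length q \<and> q \<in> closed_paths G" "c \<noteq> {}"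
proof -
  obtain x where x: "x \<in> closed_paths G" "primitive x" "c = rot_class x"
    using assms by (auto simp: prime_cycles_iff)
  show "finite c" using card_rot_class x by simp
  have "length p = length x \<and> cycprod M p = cycprod M x" if "p \<in> c" for p
    using that unfolding x(3) rot_class_def by (auto simp: cycprod_rotate)
  then show "\<And>p q. p \<in> c \<Longrightarrow> q \<in> c \<Longrightarrow> length p = length q \<and> cycprod M p = cycprod M q"
    by metis
  have "length q = length x \<and> q \<in> closed_paths G" if "q \<in> c" for q
    using that x(1) unfolding x(3) rot_class_def by (auto simp: closed_rotate_iff)
  then show "\<And>q. q \<in> c \<Longrightarrow> card c = length q \<and> q \<in> closed_paths G"
    using card_rot_class(2)[OF x(2)] x(3) by metis
  show "c \<noteq> {}" using self_rot_class x by auto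
qed

text \<open>
  A prime cycle \<open>c\<close> of length \<open>l\<close> has \<open>l\<close> members, whose powers with exponent \<open>k\<close> contribute
  \<open>l * a\<^sup>k / (k * l)\<close> to the sum over all closed paths, \<open>a\<close> being the value at \<open>c\<close>. Summing over \<open>k\<close>
  yields \<open>- ln (1 - a)\<close>.
\<close>

lemma euler_product:
  fixes M :: "'b \<Rightarrow> 'b \<Rightarrow> complex" and u :: complex
  defines "a \<equiv> \<lambda>p. cycprod M p * u ^ length p"
  assumes summ: "(\<lambda>p. a p / of_nat (length p)) summable_on closed_paths G"
    and small: "\<And>p. p \<in> closed_paths G \<Longrightarrow> norm (a p) < 1"
  shows "((\<lambda>C. \<Prod>c\<in>C. inverse (1 - class_value a c)) \<longlongrightarrow>
    exp (infsum (\<lambda>p. a p / of_nat (length p)) (closed_paths G))) (finite_subsets_at_top (prime_cycles G))"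
proof -
  let ?P = "prime_cycles G"
  let ?f = "\<lambda>p. a p / of_nat (length p)"
  \<comment> \<open>The sum over the closed paths, indexed by a prime cycle, one of its members and an exponent.\<close>
  define g where "g = (\<lambda>(c :: 'b list set, q, k). ?f (wpow (Suc k) q))"
  have cv: "class_value a c = a q" if "c \<in> ?P" "q \<in> c" for c q
  proof (rule class_value_eqI[OF that(2)])
    fix p assume "p \<in> c"
    then show "a p = a q" using prime_cycle_members(2)[OF that(1) _ that(2), of p M] by (simp add: a_def)
  qed
  have sg: "g summable_on (SIGMA c:?P. c \<times> UNIV)"
    using summ summable_on_reindex_bij_betw[OF prime_cycle_power_bij, of ?f]
    by (simp add: g_def case_prod_unfold)
  have ig: "infsum g (SIGMA c:?P. c \<times> UNIV) = infsum ?f (closed_paths G)"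
    using infsum_reindex_bij_betw[OF prime_cycle_power_bij, of ?f]
    by (simp add: g_def case_prod_unfold)
  have inner: "infsum (\<lambda>y. g (c, y)) (c \<times> UNIV) = - ln (1 - class_value a c)" if c: "c \<in> ?P" for c
  proof -
    have "(\<lambda>y. g (c, y)) summable_on (c \<times> UNIV)"
    proof -
      have "g summable_on Pair c ` (c \<times> UNIV)"
        by (rule summable_on_subset_banach[OF sg]) (use c in auto)
      moreover have "inj_on (Pair c) (c \<times> UNIV)" by (simp add: inj_on_def)
      ultimately have "(g \<circ> Pair c) summable_on (c \<times> UNIV)" 
        using summable_on_reindex by blast
      then show ?thesis by (simp only: o_def)
    qed
    then have "infsum (\<lambda>y. g (c, y)) (c \<times> UNIV) =
        infsum (\<lambda>q. infsum (\<lambda>k. ?f (wpow (Suc k) q)) UNIV) c"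
      using infsum_Sigma_banach[of "\<lambda>y. g (c, y)" c "\<lambda>_. UNIV"] by (simp add: g_def)
    also have "\<dots> = infsum (\<lambda>q. - ln (1 - class_value a c) / of_nat (card c)) c"
    proof (rule infsum_cong)
      fix q assume q: "q \<in> c"
      have qc: "q \<in> closed_paths G" "card c = length q" "q \<noteq> []"
        using prime_cycle_members(3)[OF c q] by (auto simp: closed_paths_def)
      have nz: "norm (a q) < 1" by (rule small[OF qc(1)])
      have fw: "?f (wpow (Suc k) q) = a q ^ Suc k / of_nat (Suc k) / of_nat (length q)" for k
      proof -
        have "a (wpow (Suc k) q) = a q ^ Suc k"
          unfolding a_def cycprod_wpow[OF qc(3)] length_wpow power_mult_distrib power_mult[symmetric]
          by (simp add: mult.commute)
        moreover have "length (wpow (Suc k) q) = Suc k * length q" by simp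
        ultimately show ?thesis by (simp only: of_nat_mult divide_divide_eq_left)
      qed
      have "(\<lambda>l. - (a q ^ l) / of_nat l) sums ln (1 - a q)" using Ln_series'[of "- a q"] nz by simp
      then have "(\<lambda>l. - (a q ^ Suc l) / of_nat (Suc l)) sums ln (1 - a q)" by (subst sums_Suc_iff) simp
      from sums_minus[OF this] have s: "(\<lambda>l. a q ^ Suc l / of_nat (Suc l)) sums (- ln (1 - a q))" by simp
      have "summable (\<lambda>l. norm (a q ^ Suc l / of_nat (Suc l)))"
      proof (rule summable_comparison_test)
        have "norm (norm (a q ^ Suc l / of_nat (Suc l))) \<le> norm (a q) ^ Suc l" for l
        proof -
          have "norm (norm (a q ^ Suc l / of_nat (Suc l))) = norm (a q) ^ Suc l / real (Suc l)"
            by (simp add: norm_divide norm_power norm_mult del: of_nat_Suc)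
          also have "\<dots> \<le> norm (a q) ^ Suc l / 1" by (rule divide_left_mono) auto
          finally show ?thesis by simp
        qed
        then show "\<exists>N. \<forall>l\<ge>N. norm (norm (a q ^ Suc l / of_nat (Suc l))) \<le> norm (a q) ^ Suc l" by blast
        show "summable (\<lambda>l. norm (a q) ^ Suc l)" using nz by (subst summable_Suc_iff) (simp add: summable_geometric)
      qed
      from norm_summable_imp_has_sum[OF this s] have "((\<lambda>l. a q ^ Suc l / of_nat (Suc l)) has_sum (- ln (1 - a q))) UNIV" .
      from has_sum_divide_const[OF this, of "of_nat (length q)"]
      show "infsum (\<lambda>k. ?f (wpow (Suc k) q)) UNIV = - ln (1 - class_value a c) / of_nat (card c)"
        unfolding fw cv[OF c q] qc(2) by (rule infsumI)
    qed
    also have "\<dots> = - ln (1 - class_value a c)"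
    proof -
      have "card c \<noteq> 0" using prime_cycle_members(1,4)[OF c] by simp
      then show ?thesis unfolding infsum_finite[OF prime_cycle_members(1)[OF c]] sum_constant by simp
    qed
    finally show ?thesis .
  qed
  have "(\<lambda>c. infsum (\<lambda>y. g (c, y)) (c \<times> UNIV)) summable_on ?P"
    using summable_on_Sigma_banach[of "\<lambda>c y. g (c, y)" ?P "\<lambda>c. c \<times> UNIV"] sg by (simp add: case_prod_unfold)
  then have "(\<lambda>c. - ln (1 - class_value a c)) summable_on ?P"
    by (rule summable_on_cong[THEN iffD1, rotated]) (use inner in auto)
  then have "((\<lambda>c. - ln (1 - class_value a c)) has_sum (infsum (\<lambda>c. - ln (1 - class_value a c)) ?P)) ?P"
    by (rule has_sum_infsum)
  moreover have "infsum (\<lambda>c. - ln (1 - class_value a c)) ?P = infsum ?f (closed_paths G)"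
    using infsum_Sigma_banach[OF sg] inner ig by (simp cong: infsum_cong)
  ultimately have "(sum (\<lambda>c. - ln (1 - class_value a c)) \<longlongrightarrow> infsum ?f (closed_paths G)) (finite_subsets_at_top ?P)"
    by (simp add: has_sum_def)
  then have "((\<lambda>C. exp (sum (\<lambda>c. - ln (1 - class_value a c)) C)) \<longlongrightarrow> exp (infsum ?f (closed_paths G))) (finite_subsets_at_top ?P)"
    by (rule tendsto_exp)
  then show ?thesis
  proof (rule Lim_transform_eventually)
    show "\<forall>\<^sub>F C in finite_subsets_at_top ?P. exp (sum (\<lambda>c. - ln (1 - class_value a c)) C) = (\<Prod>c\<in>C. inverse (1 - class_value a c))"
    proof (rule eventually_finite_subsets_at_top_weakI)
      fix C assume C: "finite C" "C \<subseteq> ?P"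
      have "exp (- ln (1 - class_value a c)) = inverse (1 - class_value a c)" if "c \<in> C" for c
      proof -
        have c: "c \<in> ?P" using C that by auto
        obtain q where q: "q \<in> c" using prime_cycle_members(4)[OF c] by auto
        have "norm (class_value a c) < 1" using cv[OF c q] small prime_cycle_members(3)[OF c q] by simp
        then have "1 - class_value a c \<noteq> 0" by (metis eq_iff_diff_eq_0 less_irrefl norm_one)
        then show ?thesis by (simp add: exp_minus)
      qed
      then show "exp (sum (\<lambda>c. - ln (1 - class_value a c)) C) = (\<Prod>c\<in>C. inverse (1 - class_value a c))"
        using C(1) by (simp add: exp_sum del: sum_negf cong: prod.cong)
    qed
  qed
qed

end

section \<open>Truncated determinants of graphs with cusps\<close>

text \<open>
  The recurrence makes \<open>f\<close> affine in the partial sums \<open>\<sigma>\<close> of a convergent series for each coordinate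
  separately, with coefficients depending on the other coordinates only. The limit is asserted for
  all filters at once, so that it can be used along sequences as well as along nets of vertex sets.
\<close>

lemma multi_geometric_limit:
  fixes f :: "('s \<Rightarrow> nat) \<Rightarrow> complex"
  assumes "finite S" and "\<theta> < 1" and "\<And>s n. s \<in> S \<Longrightarrow> norm (c s n) \<le> \<theta>"
    and "\<And>N s n. s \<in> S \<Longrightarrow>
      f (N(s := Suc (Suc n))) - f (N(s := Suc n)) = c s n * (f (N(s := Suc n)) - f (N(s := n)))"
    and "\<And>N N'. (\<And>s. s \<in> S \<Longrightarrow> N s = N' s) \<Longrightarrow> f N = f N'"
  shows "\<exists>L. \<forall>G. (\<forall>s\<in>S. filterlim (\<lambda>N. N s) at_top G) \<longrightarrow> (f \<longlongrightarrow> L) G"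
  using assms(1,3-5)
proof (induction S arbitrary: f rule: finite_induct)
  case empty
  have "f = (\<lambda>_. f (\<lambda>_. 0))" using empty(3) by auto
  then have "(f \<longlongrightarrow> f (\<lambda>_. 0)) G" for G by (metis tendsto_const)
  then show ?case by blast
next
  case (insert s S)
  define \<sigma> where "\<sigma> n = (\<Sum>k<n. \<Prod>j<k. c s j)" for n
  let ?f0 = "\<lambda>N. f (N(s := 0))" and ?f1 = "\<lambda>N. f (N(s := Suc 0))"
  have twist: "(N(t := m))(s := i) = (N(s := i))(t := m)" if "t \<in> S" for t m i and N :: "'s \<Rightarrow> nat"
    using that insert.hyps by (intro fun_upd_twist) auto
  have "\<exists>L. \<forall>G. (\<forall>s\<in>S. filterlim (\<lambda>N. N s) at_top G) \<longrightarrow> ((\<lambda>N. f (N(s := i))) \<longlongrightarrow> L) G" for i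
  proof (rule insert.IH)
    show "norm (c s n) \<le> \<theta>" if "s \<in> S" for s n using insert.prems(1) that by auto
    show "f ((N(t := Suc (Suc n)))(s := i)) - f ((N(t := Suc n))(s := i)) =
        c t n * (f ((N(t := Suc n))(s := i)) - f ((N(t := n))(s := i)))" if "t \<in> S" for N t n
      unfolding twist[OF that] by (rule insert.prems(2)) (use that in auto)
    show "f (N(s := i)) = f (N'(s := i))" if "\<And>s. s \<in> S \<Longrightarrow> N s = N' s" for N N'
      using that by (intro insert.prems(3)) auto
  qed
  from this[of 0] this[of "Suc 0"] obtain L0 L1 where
    L: "\<And>G. (\<forall>s\<in>S. filterlim (\<lambda>N. N s) at_top G) \<Longrightarrow> (?f0 \<longlongrightarrow> L0) G"
       "\<And>G. (\<forall>s\<in>S. filterlim (\<lambda>N. N s) at_top G) \<Longrightarrow> (?f1 \<longlongrightarrow> L1) G" by metis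
  have step: "f (N(s := Suc n)) - f (N(s := n)) = (\<Prod>j<n. c s j) * (?f1 N - ?f0 N)" for N n
  proof (induction n)
    case (Suc n)
    then show ?case using insert.prems(2)[of s N n] by simp
  qed simp
  have "f (N(s := n)) = ?f0 N + \<sigma> n * (?f1 N - ?f0 N)" for N n
  proof (induction n)
    case (Suc n)
    have "f (N(s := Suc n)) = f (N(s := n)) + (\<Prod>j<n. c s j) * (?f1 N - ?f0 N)"
      using step[of N n] by (simp only: diff_eq_eq add.commute)
    also have "\<dots> = ?f0 N + \<sigma> n * (?f1 N - ?f0 N) + (\<Prod>j<n. c s j) * (?f1 N - ?f0 N)"
      by (simp only: Suc)
    also have "\<dots> = ?f0 N + \<sigma> (Suc n) * (?f1 N - ?f0 N)"
      by (simp only: \<sigma>_def sum.lessThan_Suc distrib_right add.assoc)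
    finally show ?case .
  qed (simp add: \<sigma>_def)
  from this[of _ "_ s"] have form: "f N = ?f0 N + \<sigma> (N s) * (?f1 N - ?f0 N)" for N
    by (metis fun_upd_triv)
  have "summable (\<lambda>k. \<Prod>j<k. c s j)"
  proof (rule summable_comparison_test)
    have b: "norm (c s j) \<le> \<theta>" for j using insert.prems(1) by auto
    then have \<theta>: "0 \<le> \<theta>" using norm_ge_zero order_trans by blast
    have "norm (\<Prod>j<k. c s j) \<le> \<theta> ^ k" for k
    proof (induction k)
      case (Suc k)
      have "norm (\<Prod>j<Suc k. c s j) \<le> \<theta> ^ k * \<theta>"
        using Suc b \<theta> by (simp add: norm_mult mult_mono)
      then show ?case by (simp add: mult.commute)
    qed simp
    then show "\<exists>n. \<forall>k\<ge>n. norm (\<Prod>j<k. c s j) \<le> \<theta> ^ k" by blast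
    show "summable (\<lambda>k. \<theta> ^ k)" using \<theta> assms(2) by (intro summable_geometric) auto
  qed
  then have \<sigma>: "\<sigma> \<longlonglongrightarrow> (\<Sum>k. \<Prod>j<k. c s j)" unfolding \<sigma>_def by (rule summable_LIMSEQ)
  show ?case
  proof (intro exI allI impI)
    fix G :: "('s \<Rightarrow> nat) filter" assume G: "\<forall>s\<in>insert s S. filterlim (\<lambda>N. N s) at_top G"
    have "((\<lambda>N. \<sigma> (N s)) \<longlongrightarrow> (\<Sum>k. \<Prod>j<k. c s j)) G"
      by (rule filterlim_compose[OF \<sigma>]) (use G in auto)
    then have "((\<lambda>N. ?f0 N + \<sigma> (N s) * (?f1 N - ?f0 N)) \<longlongrightarrow> L0 + (\<Sum>k. \<Prod>j<k. c s j) * (L1 - L0)) G"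
      by (intro tendsto_intros L) (use G in auto)
    then show "(f \<longlongrightarrow> L0 + (\<Sum>k. \<Prod>j<k. c s j) * (L1 - L0)) G"
      unfolding form[symmetric] .
  qed
qed

text \<open>
  A graph with weighted edges that consists of the finite part spanned by \<open>V0\<close> and of rays with
  vertices \<open>x s 0\<close>, \<open>x s 1\<close>, \<open>\<dots>\<close> for \<open>s \<in> S\<close>. The edges \<open>ed s n\<close> lead outwards and have weight \<open>1\<close>,
  and only the initial vertex \<open>x s 0\<close> lies in \<open>V0\<close>.
\<close>

locale cusp_graph = wf_digraph X for X :: "('v, 'e) pre_digraph" +
  fixes \<rho> :: "'e \<Rightarrow> 'e" and w :: "'e \<Rightarrow> nat" and V0 :: "'v set" and S :: "'s set"
    and x :: "'s \<Rightarrow> nat \<Rightarrow> 'v" and ed :: "'s \<Rightarrow> nat \<Rightarrow> 'e" and D :: nat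
  assumes rev: "e \<in> arcs X \<Longrightarrow> \<rho> e \<in> arcs X \<and> \<rho> e \<noteq> e \<and> \<rho> (\<rho> e) = e \<and>
      tail X (\<rho> e) = head X e \<and> head X (\<rho> e) = tail X e"
    and w_pos: "e \<in> arcs X \<Longrightarrow> 0 < w e"
    and finite_V0: "finite V0" and finite_S: "finite S"
    and finite_out: "v \<in> verts X \<Longrightarrow> finite (out_arcs X v)"
    and degree: "v \<in> verts X \<Longrightarrow> (\<Sum>e\<in>out_arcs X v. w e) \<le> D"
    and verts_eq: "verts X = V0 \<union> (\<Union>s\<in>S. range (x s))"
    and x_inj: "s \<in> S \<Longrightarrow> s' \<in> S \<Longrightarrow> x s n = x s' m \<Longrightarrow> s = s' \<and> n = m"
    and x_0: "s \<in> S \<Longrightarrow> x s 0 \<in> V0" and x_Suc: "s \<in> S \<Longrightarrow> x s (Suc n) \<notin> V0"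
    and ed: "s \<in> S \<Longrightarrow> ed s n \<in> arcs X \<and> tail X (ed s n) = x s n \<and> head X (ed s n) = x s (Suc n)"
    and w_ed: "s \<in> S \<Longrightarrow> w (ed s n) = 1"
    and out_ray: "s \<in> S \<Longrightarrow> e \<in> arcs X \<Longrightarrow> tail X e = x s (Suc n) \<Longrightarrow>
      e = ed s (Suc n) \<or> e = \<rho> (ed s n)"
    and connected: "M \<subseteq> verts X \<Longrightarrow> M \<noteq> {} \<Longrightarrow>
      (\<And>e. e \<in> arcs X \<Longrightarrow> tail X e \<in> M \<Longrightarrow> head X e \<in> M) \<Longrightarrow> M = verts X"
begin

definition wval :: "'v \<Rightarrow> nat" where
  "wval v = (\<Sum>e\<in>out_arcs X v. w e)"

text \<open>
  The matrix of \<open>1 - uA + u\<^sup>2Q\<close>, where \<open>wval v\<close> is the valency of the vertices of the tree above \<open>v\<close>.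
\<close>

definition ihara_mat :: "complex \<Rightarrow> 'v \<Rightarrow> 'v \<Rightarrow> complex" where
  "ihara_mat u v v' = (if v = v' then 1 + u\<^sup>2 * (of_nat (wval v) - 1) else 0)
     - u * (\<Sum>e | e \<in> arcs X \<and> tail X e = v \<and> head X e = v'. of_nat (w e))"

definition trunc :: "('s \<Rightarrow> nat) \<Rightarrow> 'v set" where
  "trunc N = V0 \<union> {x s j | s j. s \<in> S \<and> j \<le> N s}"

lemma x_in_V0_iff: "s \<in> S \<Longrightarrow> x s n \<in> V0 \<longleftrightarrow> n = 0"
  using x_0 x_Suc by (cases n) auto

lemma x_eq_iff [simp]: "s \<in> S \<Longrightarrow> s' \<in> S \<Longrightarrow> x s n = x s' m \<longleftrightarrow> s = s' \<and> n = m"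
  using x_inj by blast

lemma x_in_trunc_iff [simp]: "s \<in> S \<Longrightarrow> x s n \<in> trunc N \<longleftrightarrow> n \<le> N s"
  by (auto simp: trunc_def x_in_V0_iff)

lemma x_in_verts: "s \<in> S \<Longrightarrow> x s n \<in> verts X"
  by (auto simp: verts_eq)

lemma trunc_subset: "trunc N \<subseteq> verts X"
  by (auto simp: trunc_def verts_eq)

lemma trunc_mono: "(\<And>s. s \<in> S \<Longrightarrow> N s \<le> N' s) \<Longrightarrow> trunc N \<subseteq> trunc N'"
  by (force simp: trunc_def)

lemma finite_trunc: "finite (trunc N)"
proof -
  have "{x s j | s j. s \<in> S \<and> j \<le> N s} = (\<lambda>(s, j). x s j) ` (SIGMA s:S. {..N s})" by auto
  then show ?thesis using finite_V0 finite_S by (simp add: trunc_def)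
qed

lemma trunc_cong: "(\<And>s. s \<in> S \<Longrightarrow> N s = N' s) \<Longrightarrow> trunc N = trunc N'"
  by (simp add: trunc_def cong: conj_cong)

lemma trunc_remove:
  assumes "s \<in> S"
  shows "trunc (N(s := Suc n)) - {x s (Suc n)} = trunc (N(s := n))"
  using assms x_Suc by (auto simp: trunc_def le_Suc_eq split: if_splits)

lemma finite_subset_trunc:
  assumes "finite A" "A \<subseteq> verts X"
  obtains n where "A \<subseteq> trunc (\<lambda>_. n)"
proof -
  have "\<exists>n. A \<subseteq> trunc (\<lambda>_. n)" using assms
  proof (induction A rule: finite_induct)
    case (insert a A)
    then obtain n where n: "A \<subseteq> trunc (\<lambda>_. n)" by auto
    obtain m where "a \<in> trunc (\<lambda>_. m)" using insert.prems by (auto simp: verts_eq trunc_def)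
    then have "insert a A \<subseteq> trunc (\<lambda>_. max n m)"
      using n trunc_mono[of "\<lambda>_. n" "\<lambda>_. max n m"] trunc_mono[of "\<lambda>_. m" "\<lambda>_. max n m"] by auto
    then show ?case by blast
  qed auto
  then show ?thesis using that by blast
qed

lemma arc_at_ray:
  assumes "s \<in> S" "e \<in> arcs X" "tail X e = x s (Suc n)"
  shows "(e = ed s (Suc n) \<and> head X e = x s (Suc (Suc n))) \<or> (e = \<rho> (ed s n) \<and> head X e = x s n)"
proof -
  from out_ray[OF assms] show ?thesis
  proof
    assume "e = ed s (Suc n)"
    then show ?thesis using ed[OF assms(1), of "Suc n"] by simp
  next
    assume "e = \<rho> (ed s n)"
    then show ?thesis using rev[of "ed s n"] ed[OF assms(1), of n] by simp
  qed
qed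

lemma arc_into_ray:
  assumes "s \<in> S" "e \<in> arcs X" "head X e = x s (Suc n)"
  shows "(e = ed s n \<and> tail X e = x s n) \<or> (e = \<rho> (ed s (Suc n)) \<and> tail X e = x s (Suc (Suc n)))"
proof -
  have "\<rho> e \<in> arcs X" "tail X (\<rho> e) = x s (Suc n)" "\<rho> (\<rho> e) = e" "head X (\<rho> e) = tail X e"
    using rev[OF assms(2)] assms(3) by auto
  with arc_at_ray[OF assms(1), of "\<rho> e" n] rev[of "ed s n"] ed[OF assms(1), of n] show ?thesis by metis
qed

lemma out_arcs_ray: "s \<in> S \<Longrightarrow> out_arcs X (x s (Suc n)) = {ed s (Suc n), \<rho> (ed s n)}"
  using out_ray[of s _ n] ed[of s n] ed[of s "Suc n"] rev[of "ed s n"] by (auto simp: out_arcs_def)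

lemma ed_neq_rev: "s \<in> S \<Longrightarrow> ed s (Suc n) \<noteq> \<rho> (ed s n)"
  using ed[of s n] ed[of s "Suc n"] rev[of "ed s n"] x_eq_iff[of s s "Suc (Suc n)" n] by auto

definition ray_weight :: "'s \<Rightarrow> nat \<Rightarrow> nat" where
  "ray_weight s n = w (\<rho> (ed s n))"

lemma wval_ray: "s \<in> S \<Longrightarrow> wval (x s (Suc n)) = Suc (ray_weight s n)"
  using ed_neq_rev[of s n] by (simp add: wval_def out_arcs_ray w_ed ray_weight_def)

lemma ray_weight_bounds: "s \<in> S \<Longrightarrow> 0 < ray_weight s n \<and> ray_weight s n \<le> D"
proof -
  assume s: "s \<in> S"
  have "Suc (ray_weight s n) \<le> D"
    using degree[OF x_in_verts[OF s], of "Suc n"] wval_ray[OF s, of n] by (simp add: wval_def)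
  moreover have "0 < ray_weight s n" using w_pos ed[OF s] rev by (simp add: ray_weight_def)
  ultimately show ?thesis by simp
qed

lemma adj_set_finite: "v \<in> verts X \<Longrightarrow> finite {e. e \<in> arcs X \<and> tail X e = v \<and> head X e = v'}"
  by (rule finite_subset[OF _ finite_out]) (auto simp: out_arcs_def)

lemma ihara_mat_nonzero_iff:
  assumes "u \<noteq> 0" "v \<in> verts X" "v \<noteq> v'"
  shows "ihara_mat u v v' \<noteq> 0 \<longleftrightarrow> (\<exists>e\<in>arcs X. tail X e = v \<and> head X e = v')"
proof -
  let ?A = "{e. e \<in> arcs X \<and> tail X e = v \<and> head X e = v'}"
  have "(\<Sum>e\<in>?A. of_nat (w e) :: complex) = of_nat (\<Sum>e\<in>?A. w e)" by simp
  moreover have "(\<Sum>e\<in>?A. w e) = 0 \<longleftrightarrow> ?A = {}"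
  proof -
    have "(\<Sum>e\<in>?A. w e) = 0 \<longleftrightarrow> (\<forall>e\<in>?A. w e = 0)" by (rule sum_eq_0_iff[OF adj_set_finite[OF assms(2)]])
    also have "\<dots> \<longleftrightarrow> ?A = {}" using w_pos by (metis (no_types, lifting) empty_iff equals0I mem_Collect_eq less_numeral_extra(3))
    finally show ?thesis .
  qed
  ultimately have "(\<Sum>e\<in>?A. of_nat (w e) :: complex) = 0 \<longleftrightarrow> ?A = {}" by (simp only: of_nat_eq_0_iff)
  moreover have "ihara_mat u v v' = - u * (\<Sum>e\<in>?A. of_nat (w e))"
    using assms(3) by (simp add: ihara_mat_def)
  ultimately have "ihara_mat u v v' = 0 \<longleftrightarrow> ?A = {}" using assms(1) by simp
  then show ?thesis by blast
qed

lemma ihara_mat_ray_diag: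
  assumes s: "s \<in> S"
  shows "ihara_mat u (x s (Suc n)) (x s (Suc n)) = 1 + u\<^sup>2 * of_nat (ray_weight s n)"
proof -
  have "False" if "e \<in> arcs X" "tail X e = x s (Suc n)" "head X e = x s (Suc n)" for e
    using arc_at_ray[OF s that(1,2)] that s by auto
  then have e: "{e. e \<in> arcs X \<and> tail X e = x s (Suc n) \<and> head X e = x s (Suc n)} = {}" by blast
  show ?thesis unfolding ihara_mat_def e by (simp add: wval_ray[OF s])
qed

lemma ihara_mat_ray_up:
  assumes s: "s \<in> S"
  shows "ihara_mat u (x s n) (x s (Suc n)) = - u"
proof -
  have "e = ed s n" if "e \<in> arcs X" "tail X e = x s n" "head X e = x s (Suc n)" for e
    using arc_into_ray[OF s that(1,3)] that s by auto
  then have e: "{e. e \<in> arcs X \<and> tail X e = x s n \<and> head X e = x s (Suc n)} = {ed s n}"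
    using ed[OF s, of n] by blast
  show ?thesis unfolding ihara_mat_def e using s by (simp add: w_ed)
qed

lemma ihara_mat_ray_down:
  assumes s: "s \<in> S"
  shows "ihara_mat u (x s (Suc n)) (x s n) = - u * of_nat (ray_weight s n)"
proof -
  have "e = \<rho> (ed s n)" if "e \<in> arcs X" "tail X e = x s (Suc n)" "head X e = x s n" for e
    using arc_at_ray[OF s that(1,2)] that s by auto
  then have e: "{e. e \<in> arcs X \<and> tail X e = x s (Suc n) \<and> head X e = x s n} = {\<rho> (ed s n)}"
    using ed[OF s, of n] rev[of "ed s n"] by auto
  show ?thesis unfolding ihara_mat_def e using s by (simp add: ray_weight_def)
qed

lemma ihara_mat_ray_zero:
  assumes s: "s \<in> S" and "v \<noteq> x s n" "v \<noteq> x s (Suc n)" "v \<noteq> x s (Suc (Suc n))"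
  shows "ihara_mat u (x s (Suc n)) v = 0" "ihara_mat u v (x s (Suc n)) = 0"
proof -
  have e: "{e. e \<in> arcs X \<and> tail X e = x s (Suc n) \<and> head X e = v} = {}"
    "{e. e \<in> arcs X \<and> tail X e = v \<and> head X e = x s (Suc n)} = {}"
    using arc_at_ray[OF s, of _ n] arc_into_ray[OF s, of _ n] assms by blast+
  show "ihara_mat u (x s (Suc n)) v = 0" "ihara_mat u v (x s (Suc n)) = 0"
    unfolding ihara_mat_def e using assms by auto
qed

definition trunc_det :: "complex \<Rightarrow> ('s \<Rightarrow> nat) \<Rightarrow> complex" where
  "trunc_det u N = fdet (ihara_mat u) (trunc N)"

lemma trunc_det_cong: "(\<And>s. s \<in> S \<Longrightarrow> N s = N' s) \<Longrightarrow> trunc_det u N = trunc_det u N'"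
  using trunc_cong[of N N'] by (simp add: trunc_det_def)

text \<open>
  The last vertex of the ray \<open>s\<close> is pendant, with diagonal entry \<open>1 + u\<^sup>2 * q\<close> and with the product
  \<open>u\<^sup>2 * q\<close> of the two entries that join it to its neighbour.
\<close>

lemma trunc_det_rec:
  assumes s: "s \<in> S"
  shows "trunc_det u (N(s := Suc (Suc n))) - trunc_det u (N(s := Suc n)) =
    u\<^sup>2 * of_nat (ray_weight s (Suc n)) * (trunc_det u (N(s := Suc n)) - trunc_det u (N(s := n)))"
proof -
  let ?F = "trunc (N(s := Suc (Suc n)))" and ?i = "x s (Suc (Suc n))" and ?k = "x s (Suc n)"
  have "?F - {?i} - {?k} = trunc (N(s := n))" unfolding trunc_remove[OF s] ..
  then have 2: "?F - {?i, ?k} = trunc (N(s := n))" by (metis Diff_insert insert_commute Diff_insert2)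
  have z: "ihara_mat u ?i j = 0 \<and> ihara_mat u j ?i = 0" if "j \<in> ?F - {?i, ?k}" for j
  proof -
    have "j \<noteq> x s (Suc (Suc (Suc n)))" using that s by auto
    then show ?thesis using that ihara_mat_ray_zero[OF s, of j "Suc n"] by auto
  qed
  have "fdet (ihara_mat u) ?F = ihara_mat u ?i ?i * fdet (ihara_mat u) (?F - {?i}) -
      ihara_mat u ?i ?k * ihara_mat u ?k ?i * fdet (ihara_mat u) (?F - {?i, ?k})"
    by (rule fdet_pendant[OF finite_trunc]) (use s z in auto)
  then show ?thesis
    unfolding trunc_det_def 2 trunc_remove[OF s] ihara_mat_ray_diag[OF s] ihara_mat_ray_up[OF s]
      ihara_mat_ray_down[OF s]
    by (simp add: algebra_simps power2_eq_square)
qed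

lemma trunc_det_limit:
  assumes "norm u ^ 2 * D < 1"
  shows "\<exists>L. \<forall>G. (\<forall>s\<in>S. filterlim (\<lambda>N. N s) at_top G) \<longrightarrow> (trunc_det u \<longlongrightarrow> L) G"
proof (rule multi_geometric_limit[OF finite_S assms, where c = "\<lambda>s n. u\<^sup>2 * of_nat (ray_weight s (Suc n))"])
  show "norm (u\<^sup>2 * of_nat (ray_weight s (Suc n))) \<le> norm u ^ 2 * D" if "s \<in> S" for s n
    using ray_weight_bounds[OF that, of "Suc n"] by (simp add: norm_mult norm_power mult_left_mono)
  show "trunc_det u (N(s := Suc (Suc n))) - trunc_det u (N(s := Suc n)) =
      u\<^sup>2 * of_nat (ray_weight s (Suc n)) * (trunc_det u (N(s := Suc n)) - trunc_det u (N(s := n)))" if "s \<in> S" for N s n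
    by (rule trunc_det_rec[OF that])
  show "trunc_det u N = trunc_det u N'" if "\<And>s. s \<in> S \<Longrightarrow> N s = N' s" for N N'
    by (rule trunc_det_cong[OF that])
qed

text \<open>
  The determinant that arises from \<open>bass_identity\<close> on a truncation, if \<open>T = S\<close>: the last vertices
  \<open>x s (N s)\<close> have lost the edge of weight \<open>1\<close> leading outwards, which diminishes their diagonal
  entries by \<open>u\<^sup>2\<close>. General \<open>T\<close> allow one ray at a time to be treated.
\<close>

definition trunc_det_lowered :: "complex \<Rightarrow> 's set \<Rightarrow> ('s \<Rightarrow> nat) \<Rightarrow> complex" where
  "trunc_det_lowered u T N = fdet (\<lambda>v v'. if v = v' \<and> v \<in> (\<lambda>s. x s (N s)) ` T then ihara_mat u v v' - u\<^sup>2
     else ihara_mat u v v') (trunc N)"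

lemma trunc_det_lowered_insert:
  assumes s: "s \<in> S" "s \<notin> T" "T \<subseteq> S" "N s = Suc n"
  shows "trunc_det_lowered u (insert s T) N = trunc_det_lowered u T N - u\<^sup>2 * trunc_det_lowered u T (N(s := n))"
proof -
  let ?M = "\<lambda>N v v'. if v = v' \<and> v \<in> (\<lambda>s. x s (N s)) ` T then ihara_mat u v v' - u\<^sup>2 else ihara_mat u v v'"
  let ?i = "x s (Suc n)"
  have i: "?i \<notin> (\<lambda>s. x s (N s)) ` T" using s by auto
  have N: "(\<lambda>s. x s (N s)) ` T = (\<lambda>t. x t ((N(s := n)) t)) ` T"
    using s(2) by (intro image_cong) auto
  have "trunc_det_lowered u (insert s T) N = fdet (\<lambda>a b. if a = ?i \<and> b = ?i then ?M N ?i ?i + (- u\<^sup>2) else ?M N a b) (trunc N)"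
    unfolding trunc_det_lowered_def by (rule fdet_cong) (use s i in auto)
  also have "\<dots> = fdet (?M N) (trunc N) + (- u\<^sup>2) * fdet (?M N) (trunc N - {?i})"
    by (rule fdet_diag_perturb[OF finite_trunc]) (use s in auto)
  also have "trunc N - {?i} = trunc (N(s := n))"
    using trunc_remove[OF s(1), of N n] s(4) by (metis fun_upd_triv)
  finally show ?thesis unfolding trunc_det_lowered_def N by simp
qed

text \<open>
  By \<open>trunc_det_lowered_insert\<close>, each ray in \<open>T\<close> replaces the determinant \<open>P(n)\<close> by
  \<open>P(n) - u\<^sup>2 * P(n - 1)\<close>, where \<open>n\<close> is the number of the last vertex of the ray.
\<close>

lemma trunc_det_lowered_limit:
  assumes L: "\<And>G. (\<forall>s\<in>S. filterlim (\<lambda>N. N s) at_top G) \<Longrightarrow> (trunc_det u \<longlongrightarrow> L) G"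
    and "T \<subseteq> S" and G: "\<forall>s\<in>S. filterlim (\<lambda>N. N s) at_top G"
  shows "(trunc_det_lowered u T \<longlongrightarrow> (1 - u\<^sup>2) ^ card T * L) G"
proof -
  have "finite T" using assms(2) finite_S finite_subset by blast
  then show ?thesis using assms(2) G
  proof (induction T arbitrary: G rule: finite_induct)
    case empty
    have "trunc_det_lowered u {} = trunc_det u" by (simp add: trunc_det_lowered_def trunc_det_def fun_eq_iff)
    then show ?case using L[OF empty(2)] by simp
  next
    case (insert s T)
    let ?h = "\<lambda>N. N(s := N s - 1)"
    have "\<forall>t\<in>S. filterlim (\<lambda>N. N t) at_top (filtermap ?h G)"
    proof
      fix t assume "t \<in> S"
      then have lim: "filterlim (\<lambda>N. N t) at_top G" using insert.prems by auto
      have "filterlim (\<lambda>n::nat. n - 1) at_top at_top"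
        by (rule filterlim_at_top_mono[where f = "\<lambda>n. n - 1"]) (simp_all add: filterlim_minus_const_nat_at_top)
      from filterlim_compose[OF this lim] show "filterlim (\<lambda>N. N t) at_top (filtermap ?h G)"
        using lim by (cases "t = s") (simp_all add: filterlim_filtermap)
    qed
    then have "(trunc_det_lowered u T \<longlongrightarrow> (1 - u\<^sup>2) ^ card T * L) (filtermap ?h G)"
      using insert by auto
    then have 1: "((\<lambda>N. trunc_det_lowered u T (?h N)) \<longlongrightarrow> (1 - u\<^sup>2) ^ card T * L) G"
      by (simp add: filterlim_filtermap)
    have "(trunc_det_lowered u T \<longlongrightarrow> (1 - u\<^sup>2) ^ card T * L) G" using insert by auto
    from tendsto_diff[OF this tendsto_mult[OF tendsto_const[of "u\<^sup>2"] 1]]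
    have "((\<lambda>N. trunc_det_lowered u T N - u\<^sup>2 * trunc_det_lowered u T (?h N)) \<longlongrightarrow> (1 - u\<^sup>2) ^ card (insert s T) * L) G"
      using insert.hyps by (simp add: algebra_simps)
    then show ?case
    proof (rule Lim_transform_eventually)
      have "filterlim (\<lambda>N. N s) at_top G" using insert.prems by auto
      then have "\<forall>\<^sub>F N in G. 1 \<le> N s" by (simp add: filterlim_at_top)
      then show "\<forall>\<^sub>F N in G. trunc_det_lowered u T N - u\<^sup>2 * trunc_det_lowered u T (?h N) = trunc_det_lowered u (insert s T) N"
      proof eventually_elim
        case (elim N)
        then have "N s = Suc (N s - 1)" by simp
        then show ?case using insert by (subst trunc_det_lowered_insert[of s T N "N s - 1"]) auto
      qed
    qed
  qed
qed

end

section \<open>Connected and arbitrary finite sets of vertices\<close>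

context cusp_graph
begin

lemma adj_sym:
  assumes "e \<in> arcs X"
  obtains e' where "e' \<in> arcs X" "tail X e' = head X e" "head X e' = tail X e"
  using rev[OF assms] by blast

text \<open>
  Only the entries of an operator enter the notions of determinant.
\<close>

definition realizes :: "(('v \<Rightarrow> complex) \<Rightarrow> 'v \<Rightarrow> complex) \<Rightarrow> complex \<Rightarrow> bool" where
  "realizes T u \<longleftrightarrow> u \<noteq> 0 \<and> (\<forall>i\<in>verts X. \<forall>j\<in>verts X. entry T i j = ihara_mat u i j)"

lemma finite_det_eq:
  assumes "realizes T u" "F \<subseteq> verts X"
  shows "finite_det T F = fdet (ihara_mat u) F"
proof -
  have "finite_det T F = fdet (entry T) F" by (simp add: finite_det_def fdet_def)
  also have "\<dots> = fdet (ihara_mat u) F"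
    using assms by (intro fdet_cong) (auto simp: realizes_def)
  finally show ?thesis .
qed

text \<open>
  The weights are positive and every edge has a reverse. So the stable sets are those closed
  under adjacency, although \<open>stable_set\<close> reads the matrix by columns.
\<close>

lemma stable_set_iff:
  assumes "realizes T u" "F \<subseteq> verts X"
  shows "stable_set T F M \<longleftrightarrow> M \<subseteq> F \<and> (\<forall>e\<in>arcs X. tail X e \<in> M \<and> head X e \<in> F \<longrightarrow> head X e \<in> M)"
proof
  assume st: "stable_set T F M"
  then have M: "M \<subseteq> F" by (simp add: stable_set_def)
  show "M \<subseteq> F \<and> (\<forall>e\<in>arcs X. tail X e \<in> M \<and> head X e \<in> F \<longrightarrow> head X e \<in> M)"
  proof (intro conjI ballI impI M)
    fix e assume e: "e \<in> arcs X" "tail X e \<in> M \<and> head X e \<in> F"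
    show "head X e \<in> M"
    proof (cases "head X e = tail X e")
      case False
      have v: "head X e \<in> verts X" "tail X e \<in> verts X" using e by auto
      have "ihara_mat u (head X e) (tail X e) \<noteq> 0"
        using ihara_mat_nonzero_iff[OF _ v(1) False] assms(1) rev[OF e(1)]
        by (auto simp: realizes_def)
      then have "entry T (head X e) (tail X e) \<noteq> 0" using assms(1) v by (simp add: realizes_def)
      then show ?thesis using st e by (auto simp: stable_set_def)
    qed (use e in auto)
  qed
next
  assume st: "M \<subseteq> F \<and> (\<forall>e\<in>arcs X. tail X e \<in> M \<and> head X e \<in> F \<longrightarrow> head X e \<in> M)"
  show "stable_set T F M"
    unfolding stable_set_def
  proof (intro conjI subsetI)
    fix i assume "i \<in> (\<Union>j\<in>M. {i \<in> F. entry T i j \<noteq> 0})"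
    then obtain j where j: "j \<in> M" "i \<in> F" "entry T i j \<noteq> 0" by auto
    show "i \<in> M"
    proof (cases "i = j")
      case False
      have v: "i \<in> verts X" "j \<in> verts X" using j st assms(2) by auto
      then have "ihara_mat u i j \<noteq> 0" using j assms(1) by (simp add: realizes_def)
      then obtain e where "e \<in> arcs X" "tail X e = i" "head X e = j"
        using ihara_mat_nonzero_iff[OF _ v(1) False] assms(1) by (auto simp: realizes_def)
      then obtain e' where "e' \<in> arcs X" "tail X e' = j" "head X e' = i" using adj_sym by metis
      then show ?thesis using st j by blast
    qed (use j in auto)
  qed (use st in auto)
qed

lemma op_irreducible_verts: "realizes T u \<Longrightarrow> op_irreducible T (verts X)"
  unfolding op_irreducible_def
proof (intro allI impI)
  fix M assume "realizes T u" "stable_set T (verts X) M"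
  then have M: "M \<subseteq> verts X" "\<And>e. e \<in> arcs X \<Longrightarrow> tail X e \<in> M \<Longrightarrow> head X e \<in> M"
    using stable_set_iff[of T u "verts X" M] by auto
  show "M = {} \<or> M = verts X" using connected[OF M(1) _ M(2)] by blast
qed

lemma trunc_connected:
  assumes r: "realizes T u"
  shows "op_connected T (trunc N)"
  unfolding op_connected_def
proof (intro allI impI)
  fix M K assume *: "stable_set T (trunc N) M \<and> stable_set T (trunc N) K \<and> M \<inter> K = {} \<and> trunc N = M \<union> K"
  then have "stable_set T (trunc N) M" by blast
  then have M: "M \<subseteq> trunc N" "\<And>e. e \<in> arcs X \<Longrightarrow> tail X e \<in> M \<Longrightarrow> head X e \<in> trunc N \<Longrightarrow> head X e \<in> M"
    unfolding stable_set_iff[OF r trunc_subset] by blast+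
  \<comment> \<open>Together with the parts of the rays beyond the truncation that hang on it, \<open>M\<close> is closed
    under adjacency in the whole graph.\<close>
  let ?M = "M \<union> {x s j | s j. s \<in> S \<and> j > N s \<and> x s (N s) \<in> M}"
  show "M = {} \<or> K = {}"
  proof (rule ccontr)
    assume ne: "\<not> (M = {} \<or> K = {})"
    have "?M = verts X"
    proof (rule connected)
      show "?M \<subseteq> verts X" using M(1) trunc_subset[of N] x_in_verts by blast
      show "?M \<noteq> {}" using ne by auto
      fix e assume e: "e \<in> arcs X" "tail X e \<in> ?M"
      show "head X e \<in> ?M"
      proof (cases "tail X e \<in> M")
        case True
        show ?thesis
        proof (cases "head X e \<in> trunc N")
          case False
          have "head X e \<in> verts X" using e by simp
          then obtain s j where s: "s \<in> S" "head X e = x s j" "j > N s"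
            using False by (auto simp: verts_eq trunc_def)
          then obtain i where i: "j = Suc i" by (cases j) auto
          have t: "tail X e = x s i \<or> tail X e = x s (Suc (Suc i))"
            using arc_into_ray[OF s(1) e(1), of i] s i by auto
          have "tail X e \<in> trunc N" using True M(1) by auto
          then have "tail X e = x s i" "i \<le> N s" using t s i by auto
          then have "i = N s" using s i by simp
          then show ?thesis using s i True \<open>tail X e = x s i\<close> by auto
        qed (use M e True in auto)
      next
        case False
        then obtain s j where s: "tail X e = x s j" "s \<in> S" "j > N s" "x s (N s) \<in> M" using e by auto
        then obtain i where i: "j = Suc i" by (cases j) auto
        have h: "head X e = x s (Suc (Suc i)) \<or> head X e = x s i"
          using arc_at_ray[OF s(2) e(1), of i] s i by auto
        have "i = N s \<or> i > N s" using s i by auto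
        then show ?thesis using h s i by auto
      qed
    qed
    moreover obtain k where "k \<in> K" using ne by auto
    moreover have "k \<in> trunc N" "k \<notin> M" using * \<open>k \<in> K\<close> by auto
    ultimately show False using trunc_subset[of N] by auto
  qed
qed

text \<open>
  If \<open>F\<close> skipped the vertex \<open>x s j\<close> but contained a later one of the same ray, the later vertices of
  this ray would form a stable set with stable complement.
\<close>

lemma connected_eq_trunc:
  assumes r: "realizes T u" and F: "F \<subseteq> verts X" "finite F" "op_connected T F" and N0: "trunc N0 \<subseteq> F"
  shows "\<exists>N. F = trunc N"
proof -
  have down: "x s j \<in> F" if s: "s \<in> S" and ji: "j < i" and i: "x s i \<in> F" for s j i
  proof (rule ccontr)
    assume j: "x s j \<notin> F"
    define up where "up a \<longleftrightarrow> (\<exists>k. a = x s k \<and> k > j)" for a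
    let ?M = "{a \<in> F. up a}"
    have nb: "up a \<longleftrightarrow> up b" if e: "e \<in> arcs X" "tail X e = a" "head X e = b" and ab: "a \<in> F" "b \<in> F" for e a b
    proof -
      have one: "up b"
        if e: "e \<in> arcs X" "tail X e = a" "head X e = b" and b: "b \<in> F" and a: "up a" for e a b
      proof -
        obtain k where k: "a = x s k" "k > j" using a by (auto simp: up_def)
        obtain i where i: "k = Suc i" using k by (cases k) auto
        have "b = x s (Suc (Suc i)) \<or> b = x s i" using arc_at_ray[OF s e(1), of i] e k i by auto
        moreover have "b \<noteq> x s j" using b j by auto
        moreover have "i = j \<or> i > j" using k i by auto
        ultimately show ?thesis using k i unfolding up_def by (metis less_Suc_eq)
      qed
      obtain e' where "e' \<in> arcs X" "tail X e' = b" "head X e' = a" using adj_sym[OF e(1)] e by metis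
      then show ?thesis using one[OF e ab(2)] one[of e' b a] ab by blast
    qed
    have "stable_set T F ?M"
      unfolding stable_set_iff[OF r F(1)] using nb[OF _ refl refl] by (simp, blast)
    moreover have "stable_set T F {a \<in> F. \<not> up a}"
      unfolding stable_set_iff[OF r F(1)] using nb[OF _ refl refl] by (simp, blast)
    moreover have "?M \<inter> {a \<in> F. \<not> up a} = {}" "F = ?M \<union> {a \<in> F. \<not> up a}" by blast+
    ultimately have "?M = {} \<or> {a \<in> F. \<not> up a} = {}"
      using F(3)[unfolded op_connected_def] by blast
    moreover have "x s i \<in> ?M" using i ji unfolding up_def by blast
    moreover have "x s 0 \<in> {a \<in> F. \<not> up a}"
      using N0 x_0[OF s] s unfolding up_def by (auto simp: trunc_def)
    ultimately show False by blast
  qed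
  define N where "N s = Max {j. x s j \<in> F}" for s
  have iff: "x s j \<in> F \<longleftrightarrow> j \<le> N s" if s: "s \<in> S" for s j
  proof -
    have fin: "finite {j. x s j \<in> F}"
    proof (rule finite_imageD)
      show "finite (x s ` {j. x s j \<in> F})" by (rule finite_subset[OF _ F(2)]) auto
      show "inj_on (x s) {j. x s j \<in> F}" using s by (auto intro: inj_onI)
    qed
    have "x s 0 \<in> F" using N0 x_0[OF s] by (auto simp: trunc_def)
    then have "N s \<in> {j. x s j \<in> F}" unfolding N_def by (intro Max_in fin) auto
    then have "x s j \<in> F" if "j \<le> N s" using down[OF s, of j "N s"] that by (cases "j = N s") auto
    moreover have "j \<le> N s" if "x s j \<in> F" unfolding N_def using that by (intro Max_ge fin) auto
    ultimately show ?thesis by blast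
  qed
  have "V0 \<subseteq> F" using N0 by (auto simp: trunc_def)
  have "F = trunc N"
  proof (intro equalityI subsetI)
    fix a assume a: "a \<in> F"
    then consider "a \<in> V0" | s j where "s \<in> S" "a = x s j" using F(1) by (auto simp: verts_eq)
    then show "a \<in> trunc N" using a iff by cases (auto simp: trunc_def)
  next
    fix a assume "a \<in> trunc N"
    then consider "a \<in> V0" | s j where "s \<in> S" "a = x s j" "j \<le> N s" by (auto simp: trunc_def)
    then show "a \<in> F" using \<open>V0 \<subseteq> F\<close> iff by cases auto
  qed
  then show ?thesis by blast
qed

lemma eventually_connected_subsets:
  assumes r: "realizes T u"
  shows "eventually P (connected_subsets_at_top T (verts X)) \<longleftrightarrow>
    (\<exists>N0. \<forall>F. finite F \<and> F \<subseteq> verts X \<and> op_connected T F \<and> trunc N0 \<subseteq> F \<longrightarrow> P F)"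
proof -
  let ?C = "{F. finite F \<and> F \<subseteq> verts X \<and> op_connected T F}"
  let ?U = "\<lambda>F0. principal {F. finite F \<and> F \<subseteq> verts X \<and> op_connected T F \<and> F0 \<subseteq> F}"
  have tC: "trunc N \<in> ?C" for N using finite_trunc trunc_subset trunc_connected[OF r] by auto
  have "eventually P (connected_subsets_at_top T (verts X)) \<longleftrightarrow> (\<exists>F0\<in>?C. eventually P (?U F0))"
    unfolding connected_subsets_at_top_def
  proof (rule eventually_INF_base)
    show "?C \<noteq> {}" using tC by blast
    fix A B assume "A \<in> ?C" "B \<in> ?C"
    then have "finite (A \<union> B)" "A \<union> B \<subseteq> verts X" by auto
    then obtain n where n: "A \<union> B \<subseteq> trunc (\<lambda>_. n)" by (rule finite_subset_trunc)
    have "?U (trunc (\<lambda>_. n)) \<le> ?U A" "?U (trunc (\<lambda>_. n)) \<le> ?U B"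
      unfolding principal_le_iff using n by blast+
    then have "?U (trunc (\<lambda>_. n)) \<le> inf (?U A) (?U B)" by (rule le_infI)
    then show "\<exists>C\<in>?C. ?U C \<le> inf (?U A) (?U B)" by (rule bexI[OF _ tC])
  qed
  also have "\<dots> \<longleftrightarrow> (\<exists>N0. eventually P (?U (trunc N0)))"
  proof
    assume "\<exists>F0\<in>?C. eventually P (?U F0)"
    then obtain F0 where F0: "F0 \<in> ?C" "eventually P (?U F0)" by blast
    then have "finite F0" "F0 \<subseteq> verts X" by auto
    then obtain n where "F0 \<subseteq> trunc (\<lambda>_. n)" by (rule finite_subset_trunc)
    then show "\<exists>N0. eventually P (?U (trunc N0))"
      using F0(2) by (intro exI[of _ "\<lambda>_. n"]) (auto simp: eventually_principal)
  qed (use tC in blast)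
  finally show ?thesis by (simp add: eventually_principal conj_ac)
qed

text \<open>
  By \<open>connected_eq_trunc\<close>, the net of connected sets is eventually the image of a net of truncations,
  whose ends move to infinity.
\<close>

lemma connected_det_limit:
  assumes r: "realizes T u"
    and L: "\<And>G. (\<forall>s\<in>S. filterlim (\<lambda>N. N s) at_top G) \<Longrightarrow> (trunc_det u \<longlongrightarrow> L) G"
  shows "(finite_det T \<longlongrightarrow> L) (connected_subsets_at_top T (verts X))"
    and "connected_det T (verts X) = L"
proof -
  let ?A = "connected_subsets_at_top T (verts X)"
  define h where "h F = (SOME N. F = trunc N)" for F
  have h: "F = trunc (h F)" if "F \<subseteq> verts X" "finite F" "op_connected T F" "trunc N0 \<subseteq> F" for F N0
    unfolding h_def using connected_eq_trunc[OF r that] by (rule someI_ex)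
  have "\<forall>s\<in>S. filterlim (\<lambda>N. N s) at_top (filtermap h ?A)"
  proof
    fix s assume s: "s \<in> S"
    show "filterlim (\<lambda>N. N s) at_top (filtermap h ?A)"
      unfolding filterlim_filtermap filterlim_at_top eventually_connected_subsets[OF r]
    proof (intro allI)
      fix k
      have "k \<le> h F s" if "finite F \<and> F \<subseteq> verts X \<and> op_connected T F \<and> trunc (\<lambda>_. k) \<subseteq> F" for F
      proof -
        have "x s k \<in> F" using that s by auto
        then show ?thesis using h[of F "\<lambda>_. k"] that s by (metis x_in_trunc_iff)
      qed
      then show "\<exists>N0. \<forall>F. finite F \<and> F \<subseteq> verts X \<and> op_connected T F \<and> trunc N0 \<subseteq> F \<longrightarrow> k \<le> h F s" by blast
    qed
  qed
  from L[OF this] have "((\<lambda>F. trunc_det u (h F)) \<longlongrightarrow> L) ?A" by (simp add: filterlim_filtermap)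
  then show lim: "(finite_det T \<longlongrightarrow> L) ?A"
  proof (rule Lim_transform_eventually)
    show "\<forall>\<^sub>F F in ?A. trunc_det u (h F) = finite_det T F"
      unfolding eventually_connected_subsets[OF r]
    proof (intro exI[of _ "\<lambda>_. 0"] allI impI)
      fix F assume F: "finite F \<and> F \<subseteq> verts X \<and> op_connected T F \<and> trunc (\<lambda>_. 0) \<subseteq> F"
      then have "F = trunc (h F)" using h by blast
      then show "trunc_det u (h F) = finite_det T F"
        using finite_det_eq[OF r, of F] F by (simp add: trunc_det_def)
    qed
  qed
  have "?A \<noteq> bot"
  proof
    assume "?A = bot"
    then have "eventually (\<lambda>_. False) ?A" by simp
    then obtain N where "\<not> (finite (trunc N) \<and> trunc N \<subseteq> verts X \<and> op_connected T (trunc N) \<and> trunc N \<subseteq> trunc N)"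
      unfolding eventually_connected_subsets[OF r] by blast
    then show False using finite_trunc[of N] trunc_subset[of N] trunc_connected[OF r, of N] by simp
  qed
  then show "connected_det T (verts X) = L"
    unfolding connected_det_def using lim by (rule tendsto_Lim)
qed

lemma filterlim_const_coords: "\<forall>s\<in>S. filterlim (\<lambda>N. N s) at_top (filtermap (\<lambda>n s. n) sequentially)"
  by (simp add: filterlim_filtermap filterlim_ident)

lemma filterlim_exhausting:
  assumes "\<And>n. finite (F n) \<and> F n \<subseteq> verts X \<and> trunc (\<lambda>_. n) \<subseteq> F n"
  shows "filterlim F (finite_subsets_at_top (verts X)) sequentially"
  unfolding filterlim_finite_subsets_at_top
proof (intro allI impI)
  fix A assume "finite A \<and> A \<subseteq> verts X"
  then have "finite A" "A \<subseteq> verts X" by auto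
  then obtain m where m: "A \<subseteq> trunc (\<lambda>_. m)" by (rule finite_subset_trunc)
  have "finite (F n) \<and> A \<subseteq> F n \<and> F n \<subseteq> verts X" if "n \<ge> m" for n
    using assms[of n] m trunc_mono[of "\<lambda>_. m" "\<lambda>_. n"] that by auto
  then show "\<forall>\<^sub>F n in sequentially. finite (F n) \<and> A \<subseteq> F n \<and> F n \<subseteq> verts X"
    unfolding eventually_sequentially by blast
qed

text \<open>
  Adding the isolated vertex \<open>x s (n + 2)\<close> to the truncation at level \<open>n\<close> multiplies the determinant by
  \<open>1 + u\<^sup>2 * q\<close> with an integer \<open>q \<ge> 1\<close>, which stays away from \<open>1\<close>. Both sequences of vertex sets
  are cofinal, so their determinants would have the same nonzero limit.
\<close>

lemma not_determinant_class:
  assumes r: "realizes T u" and s: "s \<in> S"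
  shows "\<not> determinant_class T (verts X)"
proof
  assume "determinant_class T (verts X)"
  then obtain d where d: "d \<noteq> 0" "(finite_det T \<longlongrightarrow> d) (finite_subsets_at_top (verts X))"
    by (auto simp: determinant_class_def)
  let ?V = "\<lambda>n. trunc (\<lambda>_. n)" and ?i = "\<lambda>n. x s (Suc (Suc n))"
  let ?P = "\<lambda>n. trunc_det u (\<lambda>_. n)"
  have "(\<lambda>n. finite_det T (?V n)) \<longlonglongrightarrow> d"
    by (rule filterlim_compose[OF d(2)], rule filterlim_exhausting) (use finite_trunc trunc_subset in auto)
  then have P: "?P \<longlonglongrightarrow> d" by (simp add: finite_det_eq[OF r trunc_subset] trunc_det_def)
  have "(\<lambda>n. finite_det T (insert (?i n) (?V n))) \<longlonglongrightarrow> d"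
    by (rule filterlim_compose[OF d(2)], rule filterlim_exhausting)
       (use finite_trunc trunc_subset x_in_verts[OF s] in auto)
  moreover have "finite_det T (insert (?i n) (?V n)) = (1 + u\<^sup>2 * of_nat (ray_weight s (Suc n))) * ?P n" for n
  proof -
    have "insert (?i n) (?V n) \<subseteq> verts X" using trunc_subset x_in_verts[OF s] by auto
    then have "finite_det T (insert (?i n) (?V n)) = fdet (ihara_mat u) (insert (?i n) (?V n))"
      by (rule finite_det_eq[OF r])
    also have "\<dots> = ihara_mat u (?i n) (?i n) * fdet (ihara_mat u) (insert (?i n) (?V n) - {?i n})"
    proof (rule fdet_isolated)
      fix j assume j: "j \<in> insert (?i n) (?V n) - {?i n}"
      then have "j \<noteq> x s (Suc n)" "j \<noteq> ?i n" "j \<noteq> x s (Suc (Suc (Suc n)))" using s by auto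
      then show "ihara_mat u (?i n) j = 0" using ihara_mat_ray_zero[OF s, of j "Suc n"] by auto
    qed (use finite_trunc in auto)
    also have "insert (?i n) (?V n) - {?i n} = ?V n" using s by auto
    finally show ?thesis by (simp add: trunc_det_def ihara_mat_ray_diag[OF s])
  qed
  ultimately have "(\<lambda>n. (1 + u\<^sup>2 * of_nat (ray_weight s (Suc n))) * ?P n) \<longlonglongrightarrow> d" by simp
  from tendsto_diff[OF this P] have "(\<lambda>n. u\<^sup>2 * of_nat (ray_weight s (Suc n)) * ?P n) \<longlonglongrightarrow> 0"
    by (simp add: algebra_simps)
  then have "(\<lambda>n. norm (u\<^sup>2 * of_nat (ray_weight s (Suc n)) * ?P n)) \<longlonglongrightarrow> 0" by (rule tendsto_norm_zero)
  moreover have "(\<lambda>n. norm (u\<^sup>2) * norm (?P n)) \<longlonglongrightarrow> norm (u\<^sup>2) * norm d" by (intro tendsto_intros P)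
  moreover have "norm (u\<^sup>2) * norm (?P n) \<le> norm (u\<^sup>2 * of_nat (ray_weight s (Suc n)) * ?P n)" for n
  proof -
    have "1 \<le> real (ray_weight s (Suc n))" using ray_weight_bounds[OF s, of "Suc n"] by simp
    then have "norm (u\<^sup>2) * 1 \<le> norm (u\<^sup>2) * real (ray_weight s (Suc n))" by (intro mult_left_mono) auto
    then have "norm (u\<^sup>2) * norm (?P n) \<le> norm (u\<^sup>2) * real (ray_weight s (Suc n)) * norm (?P n)"
      by (intro mult_right_mono) auto
    then show ?thesis by (simp add: norm_mult)
  qed
  ultimately have "norm (u\<^sup>2) * norm d \<le> 0" by (intro LIMSEQ_le) auto
  moreover have "norm (u\<^sup>2) * norm d > 0" using d(1) r by (simp add: realizes_def)
  ultimately show False by simp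
qed

end

section \<open>Closed paths in graphs with cusps\<close>

lemma infsum_increasing_limit:
  fixes f :: "'a \<Rightarrow> 'b::banach"
  assumes f: "f summable_on A" and sub: "\<And>n. B n \<subseteq> A" "\<And>m n. m \<le> n \<Longrightarrow> B m \<subseteq> B n"
    and ex: "\<And>a. a \<in> A \<Longrightarrow> \<exists>n. a \<in> B n"
  shows "(\<lambda>n. infsum f (B n)) \<longlonglongrightarrow> infsum f A"
proof (rule metric_LIMSEQ_I)
  fix e :: real assume e: "e > 0"
  have "(sum f \<longlongrightarrow> infsum f A) (finite_subsets_at_top A)"
    using has_sum_infsum[OF f] by (simp add: has_sum_def)
  then have "\<forall>\<^sub>F H in finite_subsets_at_top A. dist (sum f H) (infsum f A) < e / 2"
    using e by (intro tendstoD) auto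
  then obtain H where "finite H \<and> H \<subseteq> A \<and>
      (\<forall>K. finite K \<and> H \<subseteq> K \<and> K \<subseteq> A \<longrightarrow> dist (sum f K) (infsum f A) < e / 2)"
    unfolding eventually_finite_subsets_at_top by (elim exE)
  then have H: "finite H" "H \<subseteq> A"
    "\<And>K. finite K \<Longrightarrow> H \<subseteq> K \<Longrightarrow> K \<subseteq> A \<Longrightarrow> dist (sum f K) (infsum f A) < e / 2" by simp_all
  have "\<exists>m. H \<subseteq> B m" using H(1,2)
  proof (induction H rule: finite_induct)
    case (insert a H)
    then obtain m where m: "H \<subseteq> B m" by auto
    obtain k where "a \<in> B k" using ex insert.prems by auto
    then have "insert a H \<subseteq> B (max m k)" using m sub(2)[of m "max m k"] sub(2)[of k "max m k"] by auto
    then show ?case by blast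
  qed auto
  then obtain m where m: "H \<subseteq> B m" by blast
  have "dist (infsum f (B n)) (infsum f A) < e" if n: "n \<ge> m" for n
  proof -
    have "f summable_on B n" by (rule summable_on_subset_banach[OF f sub(1)])
    then have "(sum f \<longlongrightarrow> infsum f (B n)) (finite_subsets_at_top (B n))"
      using has_sum_infsum by (simp add: has_sum_def)
    then have "\<forall>\<^sub>F K in finite_subsets_at_top (B n). dist (sum f K) (infsum f (B n)) < e / 2"
      using e by (intro tendstoD) auto
    then obtain K where "finite K \<and> K \<subseteq> B n \<and>
        (\<forall>K'. finite K' \<and> K \<subseteq> K' \<and> K' \<subseteq> B n \<longrightarrow> dist (sum f K') (infsum f (B n)) < e / 2)"
      unfolding eventually_finite_subsets_at_top by (elim exE)
    then have K: "finite K" "K \<subseteq> B n"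
      "\<And>K'. finite K' \<Longrightarrow> K \<subseteq> K' \<Longrightarrow> K' \<subseteq> B n \<Longrightarrow> dist (sum f K') (infsum f (B n)) < e / 2" by simp_all
    have "H \<subseteq> B n" using m sub(2)[OF n] by auto
    then have "dist (sum f (K \<union> H)) (infsum f (B n)) < e / 2" using K H(1) by auto
    moreover have "dist (sum f (K \<union> H)) (infsum f A) < e / 2"
      using K H sub(1)[of n] by (intro H(3)) auto
    ultimately show ?thesis using dist_triangle2[of "infsum f (B n)" "infsum f A" "sum f (K \<union> H)"]
      by (simp add: dist_commute)
  qed
  then show "\<exists>no. \<forall>n\<ge>no. dist (infsum f (B n)) (infsum f A) < e" by blast
qed

lemma sum_UN_le:
  fixes f :: "'a \<Rightarrow> real"
  assumes "finite I" "\<And>i. i \<in> I \<Longrightarrow> finite (A i)" "\<And>a. 0 \<le> f a"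
  shows "sum f (\<Union>i\<in>I. A i) \<le> (\<Sum>i\<in>I. sum f (A i))"
  using assms(1,2)
proof (induction I rule: finite_induct)
  case (insert i I)
  have "sum f (A i \<union> (\<Union>i\<in>I. A i)) \<le> sum f (A i) + sum f (\<Union>i\<in>I. A i)"
    using sum.union_inter[of "A i" "\<Union>i\<in>I. A i" f] insert.prems insert.hyps(1)
      sum_nonneg[of "A i \<inter> (\<Union>i\<in>I. A i)" f] assms(3) by simp
  then show ?case using insert by fastforce
qed simp

context cusp_graph
begin

text \<open>
  The weight of a turn, extended by \<open>0\<close> to pairs of edges that do not follow each other.
\<close>

definition turn :: "'e \<Rightarrow> 'e \<Rightarrow> complex" where
  "turn e f = (if tail X f = head X e then of_nat (w f) else 0) - (if f = \<rho> e then 1 else 0)"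

lemma norm_turn_le:
  assumes "e \<in> arcs X" "f \<in> arcs X"
  shows "norm (turn e f) \<le> (if f \<in> out_arcs X (head X e) then real (w f) else 0)"
proof (cases "tail X f = head X e")
  case True
  have "1 \<le> w f" using w_pos[OF assms(2)] by simp
  then have "turn e f = of_nat (if f = \<rho> e then w f - 1 else w f)"
    using True by (auto simp: turn_def of_nat_diff)
  then have "norm (turn e f) = real (if f = \<rho> e then w f - 1 else w f)" by (simp only: norm_of_nat)
  then show ?thesis using True assms by auto
next
  case False
  then have "f \<noteq> \<rho> e" using rev[OF assms(1)] by auto
  then show ?thesis using False by (simp add: turn_def)
qed

lemma turn_row_sum:
  assumes "e \<in> arcs X" "finite E" "E \<subseteq> arcs X"
  shows "(\<Sum>f\<in>E. norm (turn e f)) \<le> D"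
proof -
  have h: "head X e \<in> verts X" using assms by auto
  have "(\<Sum>f\<in>E. norm (turn e f)) \<le> (\<Sum>f\<in>E. if f \<in> out_arcs X (head X e) then real (w f) else 0)"
    using assms by (intro sum_mono norm_turn_le) auto
  also have "\<dots> = (\<Sum>f\<in>E \<inter> out_arcs X (head X e). real (w f))"
    using assms(2) by (simp add: sum.inter_restrict)
  also have "\<dots> \<le> (\<Sum>f\<in>out_arcs X (head X e). real (w f))"
    by (intro sum_mono2 finite_out h) auto
  also have "\<dots> \<le> D" using degree[OF h] by (metis of_nat_le_iff of_nat_sum)
  finally show ?thesis .
qed

lemma turn_entry_le: "e \<in> arcs X \<Longrightarrow> f \<in> arcs X \<Longrightarrow> norm (turn e f) \<le> D"
  using turn_row_sum[of e "{f}"] by simp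

lemma norm_cycprod_le:
  assumes "set p \<subseteq> arcs X"
  shows "norm (cycprod turn p) \<le> real D ^ length p"
proof -
  have "norm (cycprod turn p) = (\<Prod>j<length p. norm (turn (p ! j) (p ! (Suc j mod length p))))"
    by (simp add: cycprod_def prod_norm)
  also have "\<dots> \<le> (\<Prod>j<length p. real D)"
  proof (intro prod_mono conjI turn_entry_le)
    fix j assume j: "j \<in> {..<length p}"
    then have "Suc j mod length p < length p" by (intro mod_less_divisor) auto
    then show "p ! j \<in> arcs X" "p ! (Suc j mod length p) \<in> arcs X"
      using j assms by (auto simp: subset_iff)
  qed simp
  finally show ?thesis by simp
qed

lemma turn_nonzero_imp_composable:
  assumes "e \<in> arcs X" "turn e f \<noteq> 0"
  shows "head X e = tail X f"
  using assms rev[OF assms(1)] by (auto simp: turn_def split: if_splits)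

lemma cycprod_nonzero_closed:
  assumes "set p \<subseteq> arcs X" "p \<noteq> []" "cycprod turn p \<noteq> 0"
  shows "p \<in> closed_paths X"
proof -
  have "head X (p ! j) = tail X (p ! (Suc j mod length p))" if "j < length p" for j
  proof (rule turn_nonzero_imp_composable)
    show "p ! j \<in> arcs X" using that assms(1) by auto
    show "turn (p ! j) (p ! (Suc j mod length p)) \<noteq> 0"
      using assms(3) that by (auto simp: cycprod_def)
  qed
  then show ?thesis using assms by (simp add: closed_paths_iff[OF wf_digraph])
qed

text \<open>
  Otherwise the path stays on one ray and turns around at its vertex closest to \<open>V0\<close>, coming in along
  the reverse of some \<open>ed s n\<close> and leaving along \<open>ed s n\<close>. The weight of this turn is
  \<open>w (ed s n) - 1 = 0\<close>.
\<close>

lemma closed_path_meets_V0: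
  assumes p: "p \<in> closed_paths X" and nz: "cycprod turn p \<noteq> 0"
  shows "\<exists>j<length p. tail X (p ! j) \<in> V0"
proof (rule ccontr)
  assume no: "\<not> ?thesis"
  have p': "p \<noteq> []" "set p \<subseteq> arcs X" "\<And>j. j < length p \<Longrightarrow> head X (p ! j) = tail X (p ! (Suc j mod length p))"
    using p by (auto simp: closed_paths_iff[OF wf_digraph])
  let ?l = "length p"
  have l: "?l > 0" using p'(1) by simp
  have arc: "p ! j \<in> arcs X" if "j < ?l" for j using that p'(2) by auto
  have "\<exists>s n. s \<in> S \<and> tail X (p ! j) = x s (Suc n)" if j: "j < ?l" for j
  proof -
    have "tail X (p ! j) \<in> verts X" using arc[OF j] by simp
    moreover have "tail X (p ! j) \<notin> V0" using no j by auto
    ultimately obtain s n where "s \<in> S" "tail X (p ! j) = x s n" by (auto simp: verts_eq)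
    then show ?thesis using x_0 \<open>tail X (p ! j) \<notin> V0\<close> by (cases n) auto
  qed
  then obtain s n where sn: "\<And>j. j < ?l \<Longrightarrow> s j \<in> S \<and> tail X (p ! j) = x (s j) (Suc (n j))" by metis
  obtain j where j: "j < ?l" "\<And>i. i < ?l \<Longrightarrow> n j \<le> n i"
    using ex_min_if_finite[of "n ` {..<?l}"] l by (metis arg_min_least finite_lessThan image_is_empty lessThan_empty_iff lessThan_iff not_gr_zero arg_min_if_finite(1) neq0_conv)
  define i where "i = (if j = 0 then ?l - 1 else j - 1)"
  have i: "i < ?l" "Suc i mod ?l = j" using j l by (auto simp: i_def)
  have head: "head X (p ! i) = x (s j) (Suc (n j))" using p'(3)[OF i(1)] i(2) sn[OF j(1)] by simp
  have "p ! i = \<rho> (ed (s j) (Suc (n j)))"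
  proof -
    have "tail X (p ! i) \<noteq> x (s j) (n j)"
    proof
      assume "tail X (p ! i) = x (s j) (n j)"
      then have "x (s i) (Suc (n i)) = x (s j) (n j)" using sn[OF i(1)] by simp
      then have "Suc (n i) = n j" using x_eq_iff sn i j by metis
      then show False using j(2)[OF i(1)] by simp
    qed
    then show ?thesis using arc_into_ray[OF _ arc[OF i(1)] head] sn[OF j(1)] by auto
  qed
  then have ri: "\<rho> (p ! i) = ed (s j) (Suc (n j))" using rev ed sn[OF j(1)] by metis
  have "head X (p ! j) \<noteq> x (s j) (n j)"
  proof
    assume *: "head X (p ! j) = x (s j) (n j)"
    let ?k = "Suc j mod ?l"
    have k: "?k < ?l" using l by simp
    have "x (s ?k) (Suc (n ?k)) = x (s j) (n j)" using * p'(3)[OF j(1)] sn[OF k] by simp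
    then have "Suc (n ?k) = n j" using x_eq_iff sn[OF k] sn[OF j(1)] by metis
    then show False using j(2)[OF k] by simp
  qed
  then have "p ! j = ed (s j) (Suc (n j))" using arc_at_ray[OF _ arc[OF j(1)]] sn[OF j(1)] by metis
  then have "turn (p ! i) (p ! j) = 0"
    using ri head sn[OF j(1)] by (simp add: turn_def w_ed)
  moreover have "turn (p ! i) (p ! (Suc i mod ?l)) \<noteq> 0" using nz i(1) by (auto simp: cycprod_def)
  ultimately show False using i(2) by simp
qed

lemma sum_pathprod_le:
  assumes E: "finite E" "E \<subseteq> arcs X" and f: "f \<in> arcs X" and "e \<in> arcs X"
  shows "(\<Sum>p\<in>words E l. norm (pathprod turn e p f)) \<le> real D ^ Suc l"
  using assms(4)
proof (induction l arbitrary: e)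
  case 0
  then show ?case using turn_entry_le f by (simp add: pathprod_Nil)
next
  case (Suc l)
  have "(\<Sum>p\<in>words E (Suc l). norm (pathprod turn e p f)) =
      (\<Sum>g\<in>E. norm (turn e g) * (\<Sum>p\<in>words E l. norm (pathprod turn g p f)))"
    unfolding sum_words_Suc pathprod_Cons norm_mult sum_distrib_left ..
  also have "\<dots> \<le> (\<Sum>g\<in>E. norm (turn e g) * real D ^ Suc l)"
    using E by (intro sum_mono mult_left_mono Suc.IH) auto
  also have "\<dots> = (\<Sum>g\<in>E. norm (turn e g)) * real D ^ Suc l" by (simp add: sum_distrib_right)
  also have "\<dots> \<le> real D * real D ^ Suc l"
    using turn_row_sum[OF Suc.prems E] by (intro mult_right_mono) auto
  finally show ?case by simp
qed

definition cycwt :: "complex \<Rightarrow> 'e list \<Rightarrow> complex" where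
  "cycwt u p = cycprod turn p * u ^ length p"

lemma cycwt_rotate [simp]: "cycwt u (rotate k p) = cycwt u p"
  by (simp add: cycwt_def cycprod_rotate)

definition V0_out :: "'e set" where
  "V0_out = (\<Union>v\<in>V0. out_arcs X v)"

lemma finite_V0_out: "finite V0_out"
  unfolding V0_out_def using finite_V0 finite_out verts_eq by auto

text \<open>
  A closed path with prescribed first edge is chosen edge by edge, and each choice, including the
  weight of the last turn, costs at most a factor \<open>D\<close>.
\<close>

lemma based_closed_sum_le:
  assumes Q: "finite Q" "Q \<subseteq> closed_paths X" "\<And>q. q \<in> Q \<Longrightarrow> hd q \<in> V0_out"
    and u: "norm u * D < 1"
  shows "(\<Sum>q\<in>Q. norm (cycwt u q)) \<le> card V0_out * (1 / (1 - norm u * D))"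
proof -
  define E where "E = (\<Union>q\<in>Q. set q)"
  define L where "L = Max (insert 0 (length ` Q))"
  let ?t = "norm u * D"
  have E: "finite E" "E \<subseteq> arcs X"
    using Q by (auto simp: E_def closed_paths_iff[OF wf_digraph] dest!: subsetD)
  let ?W = "\<lambda>l. (\<lambda>(e, p). e # p) ` ((V0_out \<inter> E) \<times> words E l)"
  have fW: "finite (?W l)" for l using E finite_words[OF E(1)] by auto
  have sub: "Q \<subseteq> (\<Union>l<Suc L. ?W l)"
  proof
    fix q assume q: "q \<in> Q"
    then have ne: "q \<noteq> []" using Q(2) by (auto simp: closed_paths_def)
    have s: "set q \<subseteq> E" using q by (auto simp: E_def)
    have "length q \<le> L" unfolding L_def using Q(1) q by (intro Max_ge) auto
    then have "length q - 1 < Suc L" by simp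
    moreover have "q \<in> ?W (length q - 1)"
      using ne s Q(3)[OF q] by (intro image_eqI[of _ _ "(hd q, tl q)"]) (cases q; auto simp: words_def)+
    ultimately show "q \<in> (\<Union>l<Suc L. ?W l)" by blast
  qed
  have W: "(\<Sum>q\<in>?W l. norm (cycwt u q)) \<le> card V0_out * ?t ^ Suc l" for l
  proof -
    have "(\<Sum>q\<in>?W l. norm (cycwt u q)) = (\<Sum>(e, p)\<in>(V0_out \<inter> E) \<times> words E l. norm (cycwt u (e # p)))"
      by (subst sum.reindex) (auto simp: inj_on_def intro!: sum.cong)
    also have "\<dots> = (\<Sum>e\<in>V0_out \<inter> E. \<Sum>p\<in>words E l. norm (cycwt u (e # p)))"
      by (rule sum.cartesian_product[symmetric])
    also have "\<dots> \<le> (\<Sum>e\<in>V0_out \<inter> E. ?t ^ Suc l)"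
    proof (rule sum_mono)
      fix e assume e: "e \<in> V0_out \<inter> E"
      have "(\<Sum>p\<in>words E l. norm (cycwt u (e # p))) = (\<Sum>p\<in>words E l. norm (pathprod turn e p e)) * norm u ^ Suc l"
        unfolding sum_distrib_right
        by (intro sum.cong refl) (auto simp: cycwt_def norm_mult norm_power pathprod_closed words_def)
      also have "\<dots> \<le> real D ^ Suc l * norm u ^ Suc l"
        by (intro mult_right_mono sum_pathprod_le E) (use e E in auto)
      also have "\<dots> = ?t ^ Suc l" by (simp only: power_mult_distrib mult.commute)
      finally show "(\<Sum>p\<in>words E l. norm (cycwt u (e # p))) \<le> ?t ^ Suc l" .
    qed
    also have "\<dots> \<le> card V0_out * ?t ^ Suc l"
      using finite_V0_out by (auto intro!: mult_right_mono card_mono)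
    finally show ?thesis .
  qed
  have "(\<Sum>q\<in>Q. norm (cycwt u q)) \<le> (\<Sum>q\<in>(\<Union>l<Suc L. ?W l). norm (cycwt u q))"
    using fW by (intro sum_mono2 sub) auto
  also have "\<dots> \<le> (\<Sum>l<Suc L. \<Sum>q\<in>?W l. norm (cycwt u q))"
    using fW by (intro sum_UN_le) auto
  also have "\<dots> \<le> (\<Sum>l<Suc L. card V0_out * ?t ^ Suc l)" by (intro sum_mono W)
  also have "\<dots> = card V0_out * (\<Sum>l<Suc L. ?t ^ Suc l)" by (simp only: sum_distrib_left)
  also have "\<dots> \<le> card V0_out * (1 / (1 - ?t))"
  proof (intro mult_left_mono)
    have "(\<Sum>l<Suc L. ?t ^ Suc l) \<le> (\<Sum>l<Suc (Suc L). ?t ^ l)"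
      by (subst (2) sum.lessThan_Suc_shift) simp
    also have "\<dots> \<le> (\<Sum>l. ?t ^ l)" using u by (intro sum_le_suminf summable_geometric) auto
    also have "\<dots> = 1 / (1 - ?t)" using u by (intro suminf_geometric) auto
    finally show "(\<Sum>l<Suc L. ?t ^ Suc l) \<le> 1 / (1 - ?t)" .
  qed auto
  finally show ?thesis .
qed

text \<open>
  A closed path of nonzero weight and length \<open>l\<close> has a rotation that starts in \<open>V0\<close>, and at most \<open>l\<close>
  closed paths have the same rotation. The denominator \<open>l\<close> compensates for this, which leaves the sum
  over the closed paths based at \<open>V0\<close>.
\<close>

lemma closed_paths_summable:
  assumes u: "norm u * D < 1"
  shows "(\<lambda>p. cycwt u p / of_nat (length p)) summable_on closed_paths X"
proof (rule abs_summable_summable, rule nonneg_bdd_above_summable_on)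
  let ?g = "\<lambda>p. norm (cycwt u p / of_nat (length p))"
  let ?B = "card V0_out * (1 / (1 - norm u * D))"
  show "bdd_above (sum ?g ` {F. F \<subseteq> closed_paths X \<and> finite F})"
  proof (rule bdd_aboveI)
    fix y assume "y \<in> sum ?g ` {F. F \<subseteq> closed_paths X \<and> finite F}"
    then obtain C where C: "C \<subseteq> closed_paths X" "finite C" "y = sum ?g C" by auto
    define Z where "Z = {p \<in> C. cycprod turn p \<noteq> 0}"
    have "\<exists>j. j < length p \<and> tail X (p ! j) \<in> V0" if "p \<in> Z" for p
      using closed_path_meets_V0[of p] that C by (auto simp: Z_def)
    then obtain k where k: "\<And>p. p \<in> Z \<Longrightarrow> k p < length p \<and> tail X (p ! k p) \<in> V0" by metis
    define \<psi> where "\<psi> p = (rotate (k p) p, k p)" for p :: "'e list"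
    define Q where "Q = (\<lambda>p. rotate (k p) p) ` Z"
    have Zf: "finite Z" using C by (simp add: Z_def)
    have "inj_on \<psi> Z"
    proof (rule inj_onI)
      fix p q assume pq: "p \<in> Z" "q \<in> Z" "\<psi> p = \<psi> q"
      have "fst (\<psi> p) = fst (\<psi> q)" "snd (\<psi> p) = snd (\<psi> q)" using pq(3) by simp_all
      then have r: "rotate (k p) p = rotate (k p) q" unfolding \<psi>_def fst_conv snd_conv by metis
      have "length p = length q" using arg_cong[OF r, of length] by simp
      with r have "rotate (length p - k p) (rotate (k p) p) = rotate (length q - k p) (rotate (k p) q)" by simp
      then show "p = q" using k[OF pq(1)] \<open>length p = length q\<close> by (simp add: rotate_rotate)
    qed
    have "y = sum ?g Z"
      unfolding C(3) using C(2) by (intro sum.mono_neutral_right) (auto simp: Z_def cycwt_def)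
    also have "\<dots> = (\<Sum>p\<in>Z. ?g (fst (\<psi> p)))" by (intro sum.cong refl) (simp add: \<psi>_def)
    also have "\<dots> = (\<Sum>z\<in>\<psi> ` Z. ?g (fst z))"
      using \<open>inj_on \<psi> Z\<close> by (simp add: sum.reindex)
    also have "\<dots> \<le> (\<Sum>z\<in>(SIGMA q:Q. {..<length q}). ?g (fst z))"
      using Zf k by (intro sum_mono2) (auto simp: \<psi>_def Q_def)
    also have "\<dots> = (\<Sum>q\<in>Q. \<Sum>j<length q. ?g q)"
      using Zf by (subst sum.Sigma) (auto simp: Q_def intro!: sum.cong)
    also have "\<dots> = (\<Sum>q\<in>Q. norm (cycwt u q))"
    proof (intro sum.cong refl)
      fix q assume "q \<in> Q"
      then have "q \<noteq> []" using C by (auto simp: Q_def Z_def closed_paths_def)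
      then show "(\<Sum>j<length q. ?g q) = norm (cycwt u q)" by (simp add: norm_divide)
    qed
    also have "\<dots> \<le> ?B"
    proof (rule based_closed_sum_le[OF _ _ _ u])
      show "finite Q" using Zf by (simp add: Q_def)
      show Qc: "Q \<subseteq> closed_paths X" using C by (auto simp: Q_def Z_def closed_rotate_iff)
      fix q assume "q \<in> Q"
      then obtain p where p: "p \<in> Z" "q = rotate (k p) p" by (auto simp: Q_def)
      then have "p \<noteq> []" using C by (auto simp: Z_def closed_paths_def)
      then have hd: "hd q = p ! k p" using k[OF p(1)] p(2) by (simp add: hd_rotate_conv_nth)
      have "p \<in> closed_paths X" using p(1) C(1) by (auto simp: Z_def)
      then have "set p \<subseteq> arcs X" by (simp add: closed_paths_iff[OF wf_digraph])
      moreover have "p ! k p \<in> set p" using k[OF p(1)] by simp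
      ultimately have "p ! k p \<in> out_arcs X (tail X (p ! k p))" by (auto simp: out_arcs_def)
      then show "hd q \<in> V0_out" unfolding hd V0_out_def using k[OF p(1)] by blast
    qed
    finally show "y \<le> ?B" .
  qed
qed simp

lemma norm_cycwt_less:
  assumes u: "norm u * D < 1" and p: "p \<in> closed_paths X"
  shows "norm (cycwt u p) < 1"
proof -
  have p': "set p \<subseteq> arcs X" "p \<noteq> []" using p by (auto simp: closed_paths_iff[OF wf_digraph])
  have "norm (cycwt u p) \<le> real D ^ length p * norm u ^ length p"
    using norm_cycprod_le[OF p'(1)] by (simp add: cycwt_def norm_mult norm_power mult_right_mono)
  also have "\<dots> = (norm u * D) ^ length p" by (simp add: power_mult_distrib mult.commute)
  also have "\<dots> < 1" using u p'(2) by (simp add: power_less_one_iff)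
  finally show ?thesis .
qed

text \<open>
  Words over \<open>E\<close> that are not closed paths contribute nothing, as they contain a turn of weight \<open>0\<close>.
\<close>

lemma exp_finite_closed_paths:
  assumes u: "norm u * D < 1" and E: "finite E" "E \<subseteq> arcs X"
  shows "exp (- infsum (\<lambda>p. cycwt u p / of_nat (length p)) {p \<in> closed_paths X. set p \<subseteq> E}) =
    fdet (\<lambda>e f. (if e = f then 1 else 0) - u * turn e f) E"
proof -
  let ?f = "\<lambda>p. cycwt u p / of_nat (length p)"
  let ?C = "{p \<in> closed_paths X. set p \<subseteq> E}"
  let ?A = "SIGMA l:UNIV. words E (Suc l)"
  have row: "(\<Sum>f\<in>E. norm (turn e f)) \<le> real D" if "e \<in> E" for e
    using turn_row_sum[OF _ E] that E by auto
  obtain t where "(\<lambda>l. (\<Sum>p\<in>words E (Suc l). cycprod turn p) * u ^ Suc l / of_nat (Suc l)) sums t \<and>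
      exp (- t) = fdet (\<lambda>e f. (if e = f then 1 else 0) - u * turn e f) E"
    using exp_closed_words_series[OF E(1) row u] by (rule exE)
  then have t: "(\<lambda>l. (\<Sum>p\<in>words E (Suc l). cycprod turn p) * u ^ Suc l / of_nat (Suc l)) sums t"
    "exp (- t) = fdet (\<lambda>e f. (if e = f then 1 else 0) - u * turn e f) E" by (rule conjunct1, rule conjunct2)
  have bij: "bij_betw snd ?A {p. p \<noteq> [] \<and> set p \<subseteq> E}"
    by (rule bij_betw_byWitness[where f' = "\<lambda>p. (length p - 1, p)"]) (auto simp: words_def)
  have "?f summable_on ?C"
    by (rule summable_on_subset_banach[OF closed_paths_summable[OF u]]) auto
  moreover have zero: "?f p = 0" if "p \<in> {p. p \<noteq> [] \<and> set p \<subseteq> E} - ?C" for p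
    using that cycprod_nonzero_closed[of p] E by (auto simp: cycwt_def)
  moreover have CE: "?C \<subseteq> {p. p \<noteq> [] \<and> set p \<subseteq> E}" by (auto simp: closed_paths_def)
  moreover have "?f summable_on ?C \<longleftrightarrow> ?f summable_on {p. p \<noteq> [] \<and> set p \<subseteq> E}"
    by (rule summable_on_cong_neutral) (use zero CE in auto)
  ultimately have s1: "?f summable_on {p. p \<noteq> [] \<and> set p \<subseteq> E}" by blast
  then have s2: "(\<lambda>z. ?f (snd z)) summable_on ?A"
    using summable_on_reindex_bij_betw[OF bij, of ?f] by simp
  have "infsum ?f ?C = infsum ?f {p. p \<noteq> [] \<and> set p \<subseteq> E}"
    using zero CE by (intro infsum_cong_neutral) auto
  also have "\<dots> = infsum (\<lambda>z. ?f (snd z)) ?A" by (rule infsum_reindex_bij_betw[OF bij, symmetric])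
  also have "\<dots> = infsum (\<lambda>l. infsum ?f (words E (Suc l))) UNIV"
    using infsum_Sigma_banach[OF s2] by simp
  finally have i1: "infsum ?f ?C = infsum (\<lambda>l. infsum ?f (words E (Suc l))) UNIV" .
  have fin: "infsum ?f (words E (Suc l)) = (\<Sum>p\<in>words E (Suc l). cycprod turn p) * u ^ Suc l / of_nat (Suc l)" for l
    unfolding infsum_finite[OF finite_words[OF E(1)]] sum_distrib_right sum_divide_distrib
    by (intro sum.cong refl) (auto simp: cycwt_def words_def)
  have "(\<lambda>l. infsum ?f (words E (Suc l))) summable_on UNIV"
    using summable_on_Sigma_banach[of "\<lambda>l p. ?f p" UNIV "\<lambda>l. words E (Suc l)"] s2
    by (simp add: case_prod_unfold)
  then have "(\<lambda>l. infsum ?f (words E (Suc l))) sums infsum ?f ?C"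
    unfolding i1 by (intro has_sum_imp_sums has_sum_infsum)
  then have "infsum ?f ?C = t" unfolding fin using t(1) by (rule sums_unique2)
  then show ?thesis using t(2) by simp
qed

end

section \<open>The determinant formula for graphs with cusps\<close>

lemma card_edge_pairs:
  assumes "finite E" and inv: "\<And>e. e \<in> E \<Longrightarrow> \<rho> e \<in> E \<and> \<rho> e \<noteq> e \<and> \<rho> (\<rho> e) = e"
  shows "card E = 2 * card ((\<lambda>e. {e, \<rho> e}) ` E)"
proof -
  let ?C = "(\<lambda>e. {e, \<rho> e}) ` E"
  have U: "\<Union>?C = E" using inv by auto
  have "2 * card ?C = card (\<Union>?C)"
  proof (rule card_partition)
    show "finite ?C" "finite (\<Union>?C)" using assms(1) unfolding U by auto
    show "card c = 2" if "c \<in> ?C" for c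
    proof -
      obtain e where e: "e \<in> E" "c = {e, \<rho> e}" using \<open>c \<in> ?C\<close> by blast
      then show ?thesis using inv[OF e(1)] by (metis card_2_iff)
    qed
    show "c1 \<inter> c2 = {}" if c: "c1 \<in> ?C" "c2 \<in> ?C" "c1 \<noteq> c2" for c1 c2
    proof -
      obtain e f where ef: "e \<in> E" "c1 = {e, \<rho> e}" "f \<in> E" "c2 = {f, \<rho> f}" using c by blast
      have "{e, \<rho> e} = {f, \<rho> f}" if "e = f \<or> e = \<rho> f \<or> \<rho> e = f \<or> \<rho> e = \<rho> f"
        using that inv[OF ef(1)] inv[OF ef(3)] by (metis insert_commute)
      then show ?thesis using ef c(3) by blast
    qed
  qed
  then show ?thesis unfolding U by simp
qed

context cusp_graph
begin

definition trunc_arcs :: "nat \<Rightarrow> 'e set" where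
  "trunc_arcs n = {e \<in> arcs X. tail X e \<in> trunc (\<lambda>_. n) \<and> head X e \<in> trunc (\<lambda>_. n)}"

lemma trunc_arcs_subset: "trunc_arcs n \<subseteq> arcs X" by (auto simp: trunc_arcs_def)

lemma finite_trunc_arcs: "finite (trunc_arcs n)"
proof (rule finite_subset)
  show "trunc_arcs n \<subseteq> (\<Union>v\<in>trunc (\<lambda>_. n). out_arcs X v)" by (auto simp: trunc_arcs_def out_arcs_def)
  show "finite (\<Union>v\<in>trunc (\<lambda>_. n). out_arcs X v)"
    using finite_trunc finite_out trunc_subset by blast
qed

lemma trunc_arcs_rev: "e \<in> trunc_arcs n \<Longrightarrow> \<rho> e \<in> trunc_arcs n \<and> \<rho> e \<noteq> e \<and> \<rho> (\<rho> e) = e"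
  using rev[of e] by (simp add: trunc_arcs_def)

lemma trunc_Suc: "trunc (\<lambda>_. Suc n) = trunc (\<lambda>_. n) \<union> (\<lambda>s. x s (Suc n)) ` S"
  by (auto simp: trunc_def le_Suc_eq)

text \<open>
  Both \<open>card_trunc\<close> and \<open>card_trunc_arcs\<close> serve to show that all truncations have the same Euler
  number: a further level adds one vertex and one pair of edges for every ray.
\<close>

lemma card_trunc: "card (trunc (\<lambda>_. n)) = card V0 + n * card S"
proof (induction n)
  case 0
  have "trunc (\<lambda>_. 0) = V0" using x_0 by (auto simp: trunc_def)
  then show ?case by simp
next
  case (Suc n)
  have "trunc (\<lambda>_. n) \<inter> (\<lambda>s. x s (Suc n)) ` S = {}" by auto
  moreover have "inj_on (\<lambda>s. x s (Suc n)) S" by (auto intro: inj_onI)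
  ultimately show ?case
    unfolding trunc_Suc using Suc finite_trunc finite_S
    by (subst card_Un_disjoint) (auto simp: card_image)
qed

lemma trunc_arcs_Suc:
  "trunc_arcs (Suc n) = trunc_arcs n \<union> ((\<lambda>s. ed s n) ` S \<union> (\<lambda>s. \<rho> (ed s n)) ` S)"
proof (intro equalityI subsetI)
  fix e assume e: "e \<in> trunc_arcs (Suc n)"
  then have arc: "e \<in> arcs X" by (simp add: trunc_arcs_def)
  have te: "tail X e \<in> trunc (\<lambda>_. Suc n)" and he: "head X e \<in> trunc (\<lambda>_. Suc n)"
    using e by (auto simp: trunc_arcs_def)
  consider "e \<in> trunc_arcs n" | s where "s \<in> S" "tail X e = x s (Suc n)" | s where "s \<in> S" "head X e = x s (Suc n)"
    using te he arc unfolding trunc_arcs_def trunc_Suc by blast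
  then show "e \<in> trunc_arcs n \<union> ((\<lambda>s. ed s n) ` S \<union> (\<lambda>s. \<rho> (ed s n)) ` S)"
  proof cases
    case (2 s)
    have "head X e \<noteq> x s (Suc (Suc n))" using he 2(1) by auto
    then show ?thesis using arc_at_ray[OF 2(1) arc 2(2)] 2(1) by auto
  next
    case (3 s)
    have "tail X e \<noteq> x s (Suc (Suc n))" using te 3(1) by auto
    then show ?thesis using arc_into_ray[OF 3(1) arc 3(2)] 3(1) by auto
  qed auto
next
  fix e assume "e \<in> trunc_arcs n \<union> ((\<lambda>s. ed s n) ` S \<union> (\<lambda>s. \<rho> (ed s n)) ` S)"
  then consider "e \<in> trunc_arcs n" | s where "s \<in> S" "e = ed s n" | s where "s \<in> S" "e = \<rho> (ed s n)" by auto
  then show "e \<in> trunc_arcs (Suc n)"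
  proof cases
    case 1
    then show ?thesis unfolding trunc_arcs_def trunc_Suc by auto
  next
    case (2 s)
    then show ?thesis using ed[of s n] by (auto simp: trunc_arcs_def)
  next
    case (3 s)
    then show ?thesis using ed[of s n] rev[of "ed s n"] by (auto simp: trunc_arcs_def)
  qed
qed

lemma card_trunc_arcs: "card (trunc_arcs n) = card (trunc_arcs 0) + 2 * n * card S"
proof (induction n)
  case (Suc n)
  let ?U = "(\<lambda>s. ed s n) ` S" and ?D = "(\<lambda>s. \<rho> (ed s n)) ` S"
  have hu: "head X (ed s n) = x s (Suc n)" "tail X (ed s n) = x s n" if "s \<in> S" for s
    using ed[OF that, of n] by auto
  have hd: "head X (\<rho> (ed s n)) = x s n" "tail X (\<rho> (ed s n)) = x s (Suc n)" if "s \<in> S" for s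
    using ed[OF that, of n] rev[of "ed s n"] by auto
  have "inj_on (\<lambda>s. ed s n) S" by (rule inj_onI) (metis hu(1) x_eq_iff)
  then have cU: "card ?U = card S" by (rule card_image)
  have "inj_on (\<lambda>s. \<rho> (ed s n)) S" by (rule inj_onI) (metis hd(2) x_eq_iff)
  then have cD: "card ?D = card S" by (rule card_image)
  have "ed s n \<noteq> \<rho> (ed s' n)" if "s \<in> S" "s' \<in> S" for s s'
    using hu(1)[OF that(1)] hd(1)[OF that(2)] that by (metis n_not_Suc_n x_eq_iff)
  then have UD: "?U \<inter> ?D = {}" by auto
  have "ed s n \<notin> trunc_arcs n" if "s \<in> S" for s using hu[OF that] that by (auto simp: trunc_arcs_def)
  moreover have "\<rho> (ed s n) \<notin> trunc_arcs n" if "s \<in> S" for s using hd[OF that] that by (auto simp: trunc_arcs_def)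
  ultimately have "trunc_arcs n \<inter> (?U \<union> ?D) = {}" by auto
  then have "card (trunc_arcs (Suc n)) = card (trunc_arcs n) + (card ?U + card ?D)"
    unfolding trunc_arcs_Suc using finite_trunc_arcs finite_S UD by (simp add: card_Un_disjoint)
  then show ?case using Suc cU cD by simp
qed simp

lemma arc_leaving_trunc:
  assumes "e \<in> arcs X" "tail X e \<in> trunc (\<lambda>_. n)" "head X e \<notin> trunc (\<lambda>_. n)"
  shows "\<exists>s\<in>S. e = ed s n"
proof -
  have "head X e \<in> verts X" using assms(1) by simp
  then obtain s j where s: "s \<in> S" "head X e = x s j" "j > n"
    using assms(3) by (auto simp: verts_eq trunc_def)
  then obtain i where i: "j = Suc i" by (cases j) auto
  have "tail X e \<noteq> x s (Suc (Suc i))" using assms(2) s i by auto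
  then have e: "e = ed s i" "tail X e = x s i"
    using arc_into_ray[OF s(1) assms(1), of i] s i by auto
  then have "i \<le> n" using assms(2) s(1) by auto
  then have "i = n" using s i by simp
  then show ?thesis using e s by auto
qed

lemma sum_trunc_arcs:
  assumes v: "v \<in> trunc (\<lambda>_. n)"
  shows "(\<Sum>e | e \<in> trunc_arcs n \<and> tail X e = v. w e) = wval v - (if v \<in> (\<lambda>s. x s n) ` S then 1 else 0)"
    and "v \<in> (\<lambda>s. x s n) ` S \<Longrightarrow> 0 < wval v"
proof -
  have fin: "finite (out_arcs X v)" using finite_out trunc_subset v by blast
  let ?O = "{e \<in> out_arcs X v. head X e \<notin> trunc (\<lambda>_. n)}"
  have "out_arcs X v = {e. e \<in> trunc_arcs n \<and> tail X e = v} \<union> ?O"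
    using v by (auto simp: trunc_arcs_def out_arcs_def)
  moreover have "{e. e \<in> trunc_arcs n \<and> tail X e = v} \<inter> ?O = {}" by (auto simp: trunc_arcs_def)
  moreover have "finite {e. e \<in> trunc_arcs n \<and> tail X e = v}" using finite_trunc_arcs by auto
  ultimately have 1: "wval v = (\<Sum>e | e \<in> trunc_arcs n \<and> tail X e = v. w e) + sum w ?O"
    unfolding wval_def using fin by (metis (no_types, lifting) finite_Un sum.union_disjoint)
  have 2: "sum w ?O = (if v \<in> (\<lambda>s. x s n) ` S then 1 else 0)"
  proof (cases "v \<in> (\<lambda>s. x s n) ` S")
    case True
    then obtain s where s: "s \<in> S" "v = x s n" by auto
    have "e = ed s n" if e: "e \<in> ?O" for e
    proof -
      have e': "e \<in> arcs X" "tail X e = v" "head X e \<notin> trunc (\<lambda>_. n)" using e by auto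
      then obtain s' where "s' \<in> S" "e = ed s' n" using arc_leaving_trunc v by blast
      then show ?thesis using ed[of s' n] e' s by auto
    qed
    moreover have "ed s n \<in> ?O" using ed[OF s(1), of n] s by auto
    ultimately have "?O = {ed s n}" by blast
    then show ?thesis using True w_ed[OF s(1)] by simp
  next
    case False
    have "?O = {}"
    proof (rule equals0I)
      fix e assume e: "e \<in> ?O"
      have e': "e \<in> arcs X" "tail X e = v" "head X e \<notin> trunc (\<lambda>_. n)" using e by auto
      then obtain s' where "s' \<in> S" "e = ed s' n" using arc_leaving_trunc v by blast
      then show False using ed[of s' n] e' False by auto
    qed
    then show ?thesis using False by (simp only: sum.empty if_False)
  qed
  show "(\<Sum>e | e \<in> trunc_arcs n \<and> tail X e = v. w e) = wval v - (if v \<in> (\<lambda>s. x s n) ` S then 1 else 0)"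
    using 1 2 by simp
  show "v \<in> (\<lambda>s. x s n) ` S \<Longrightarrow> 0 < wval v" using 1 2 by simp
qed

lemma bass_trunc:
  "(1 - u\<^sup>2) ^ card (trunc (\<lambda>_. n)) * (1 - u\<^sup>2) ^ (card (trunc_arcs n) div 2) *
     fdet (\<lambda>e f. (if e = f then 1 else 0) - u * turn e f) (trunc_arcs n) =
   (1 - u\<^sup>2) ^ card (trunc_arcs n) * trunc_det_lowered u S (\<lambda>_. n)"
proof -
  let ?E = "trunc_arcs n" and ?V = "trunc (\<lambda>_. n)"
  have "(1 - u\<^sup>2) ^ card ?V * (1 - u\<^sup>2) ^ (card ?E div 2) *
     fdet (\<lambda>e f. (if e = f then 1 else 0) - u * ((if tail X f = head X e then of_nat (w f) else 0) - (if f = \<rho> e then 1 else 0))) ?E =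
     (1 - u\<^sup>2) ^ card ?E *
     fdet (\<lambda>v v'. (if v = v' then 1 - u\<^sup>2 + u\<^sup>2 * (\<Sum>e | e \<in> ?E \<and> tail X e = v. of_nat (w e)) else 0)
            - u * (\<Sum>e | e \<in> ?E \<and> tail X e = v \<and> head X e = v'. of_nat (w e))) ?V"
  proof (rule bass_identity[OF finite_trunc_arcs finite_trunc])
    fix e assume e: "e \<in> ?E"
    then have "e \<in> arcs X" by (simp add: trunc_arcs_def)
    then show "\<rho> e \<in> ?E \<and> \<rho> e \<noteq> e \<and> \<rho> (\<rho> e) = e \<and> head X (\<rho> e) = tail X e \<and> tail X (\<rho> e) = head X e"
      using trunc_arcs_rev[OF e] rev[of e] by blast
    show "head X e \<in> ?V" using e by (simp add: trunc_arcs_def)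
  qed
  moreover have "fdet (\<lambda>v v'. (if v = v' then 1 - u\<^sup>2 + u\<^sup>2 * (\<Sum>e | e \<in> ?E \<and> tail X e = v. of_nat (w e)) else 0)
            - u * (\<Sum>e | e \<in> ?E \<and> tail X e = v \<and> head X e = v'. of_nat (w e))) ?V = trunc_det_lowered u S (\<lambda>_. n)"
    unfolding trunc_det_lowered_def
  proof (rule fdet_cong)
    fix v v' assume v: "v \<in> ?V" "v' \<in> ?V"
    have e: "{e. e \<in> ?E \<and> tail X e = v \<and> head X e = v'} = {e. e \<in> arcs X \<and> tail X e = v \<and> head X e = v'}"
      using v by (auto simp: trunc_arcs_def)
    have "(\<Sum>e | e \<in> ?E \<and> tail X e = v. of_nat (w e) :: complex) =
        of_nat (wval v - (if v \<in> (\<lambda>s. x s n) ` S then 1 else 0))"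
      by (simp only: of_nat_sum[symmetric] sum_trunc_arcs(1)[OF v(1)])
    also have "\<dots> = of_nat (wval v) - (if v \<in> (\<lambda>s. x s n) ` S then 1 else 0)"
      using sum_trunc_arcs(2)[OF v(1)] by (auto simp: of_nat_diff Suc_leI)
    finally have s: "(\<Sum>e | e \<in> ?E \<and> tail X e = v. of_nat (w e) :: complex) =
        of_nat (wval v) - (if v \<in> (\<lambda>s. x s n) ` S then 1 else 0)" .
    show "(if v = v' then 1 - u\<^sup>2 + u\<^sup>2 * (\<Sum>e | e \<in> ?E \<and> tail X e = v. of_nat (w e)) else 0)
            - u * (\<Sum>e | e \<in> ?E \<and> tail X e = v \<and> head X e = v'. of_nat (w e)) =
        (if v = v' \<and> v \<in> (\<lambda>s. x s n) ` S then ihara_mat u v v' - u\<^sup>2 else ihara_mat u v v')"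
      unfolding s e ihara_mat_def
      by (cases "v = v'"; cases "v \<in> (\<lambda>s. x s n) ` S") (simp_all add: algebra_simps)
  qed
  ultimately show ?thesis by (simp add: turn_def)
qed

text \<open>
  The Euler number of what remains of the graph when all vertices and edges of the rays are removed.
\<close>

definition outer_chi :: int where
  "outer_chi = int (card V0) - int (card ((\<lambda>e. {e, \<rho> e}) ` trunc_arcs 0)) - int (card S)"

text \<open>
  On the truncations at level \<open>n\<close>, the identity of Bass expresses the sum over the closed paths by
  \<open>trunc_det_lowered\<close>, with an exponent that does not depend on \<open>n\<close>. As \<open>n\<close> tends to infinity,
  \<open>trunc_det_lowered\<close> contributes \<open>(1 - u\<^sup>2) ^ card S\<close>, which turns the exponent into
  \<open>- outer_chi\<close>.
\<close>

theorem zeta_determinant_formula: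
  assumes r: "realizes T u" and u1: "norm u * D < 1" "norm u < 1"
  shows "connected_determinant_class T (verts X)"
    and "\<exists>z. z \<noteq> 0 \<and>
      ((\<lambda>C. \<Prod>c\<in>C. inverse (1 - class_value (cycwt u) c)) \<longlongrightarrow> z) (finite_subsets_at_top (prime_cycles X)) \<and>
      inverse z = connected_det T (verts X) / (1 - u\<^sup>2) powi outer_chi"
    and "S \<noteq> {} \<Longrightarrow> \<not> determinant_class T (verts X)"
proof -
  have "norm u ^ 2 * D \<le> norm u * D"
    using u1(2) by (intro mult_right_mono) (auto simp: power2_eq_square mult_left_le_one_le)
  then have "norm u ^ 2 * D < 1" using u1(1) by simp
  then obtain L where L: "\<And>G. (\<forall>s\<in>S. filterlim (\<lambda>N. N s) at_top G) \<Longrightarrow> (trunc_det u \<longlongrightarrow> L) G"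
    using trunc_det_limit by blast
  have lim: "(finite_det T \<longlongrightarrow> L) (connected_subsets_at_top T (verts X))"
    and cdet: "connected_det T (verts X) = L"
    using connected_det_limit[OF r] L by blast+
  show "connected_determinant_class T (verts X)"
    unfolding connected_determinant_class_def using op_irreducible_verts[OF r] lim by blast
  show "S \<noteq> {} \<Longrightarrow> \<not> determinant_class T (verts X)" using not_determinant_class[OF r] by blast
  have ne: "1 - u\<^sup>2 \<noteq> 0"
  proof
    assume "1 - u\<^sup>2 = 0"
    then have "norm u ^ 2 = 1" by (metis eq_iff_diff_eq_0 norm_one norm_power)
    then show False using u1(2) power_less_one_iff[of "norm u" 2] by simp
  qed
  let ?f = "\<lambda>p. cycwt u p / of_nat (length p)"
  define s where "s = infsum ?f (closed_paths X)"
  have "((\<lambda>C. \<Prod>c\<in>C. inverse (1 - class_value (cycwt u) c)) \<longlongrightarrow> exp s) (finite_subsets_at_top (prime_cycles X))"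
    unfolding s_def cycwt_def[abs_def]
    by (rule euler_product) (use closed_paths_summable[OF u1(1)] norm_cycwt_less[OF u1(1)] in \<open>auto simp: cycwt_def[abs_def]\<close>)
  moreover have "exp (- s) = L / (1 - u\<^sup>2) powi outer_chi"
  proof -
    let ?B = "\<lambda>n. {p \<in> closed_paths X. set p \<subseteq> trunc_arcs n}"
    let ?ne = "\<lambda>n. card ((\<lambda>e. {e, \<rho> e}) ` trunc_arcs n)"
    have mono: "trunc_arcs m \<subseteq> trunc_arcs n" if "m \<le> n" for m n
      using trunc_mono[of "\<lambda>_. m" "\<lambda>_. n"] that by (auto simp: trunc_arcs_def)
    have "(\<lambda>n. infsum ?f (?B n)) \<longlonglongrightarrow> s"
      unfolding s_def
    proof (rule infsum_increasing_limit[OF closed_paths_summable[OF u1(1)]])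
      show "?B m \<subseteq> ?B n" if "m \<le> n" for m n using mono[OF that] by blast
      fix p assume p: "p \<in> closed_paths X"
      then have sp: "set p \<subseteq> arcs X" by (simp add: closed_paths_iff[OF wf_digraph])
      have fin: "finite (tail X ` set p \<union> head X ` set p)" by simp
      have sub: "tail X ` set p \<union> head X ` set p \<subseteq> verts X" using sp by auto
      from finite_subset_trunc[OF fin sub] obtain n where "tail X ` set p \<union> head X ` set p \<subseteq> trunc (\<lambda>_. n)" .
      then have "set p \<subseteq> trunc_arcs n" using sp by (auto simp: trunc_arcs_def)
      then show "\<exists>n. p \<in> ?B n" using p by blast
    qed auto
    then have "(\<lambda>n. exp (- infsum ?f (?B n))) \<longlonglongrightarrow> exp (- s)" by (intro tendsto_intros)
    moreover have "exp (- infsum ?f (?B n)) = (1 - u\<^sup>2) powi (- outer_chi - int (card S)) * trunc_det_lowered u S (\<lambda>_. n)" for n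
    proof -
      have c: "card (trunc_arcs n) = 2 * ?ne n" for n
        by (rule card_edge_pairs[OF finite_trunc_arcs]) (rule trunc_arcs_rev)
      have e: "?ne n = ?ne 0 + n * card S" using c[of n] c[of 0] card_trunc_arcs[of n] by simp
      let ?X = "exp (- infsum ?f (?B n))"
      have "?X = fdet (\<lambda>e f. (if e = f then 1 else 0) - u * turn e f) (trunc_arcs n)"
        by (rule exp_finite_closed_paths[OF u1(1) finite_trunc_arcs trunc_arcs_subset])
      then have "(1 - u\<^sup>2) ^ card (trunc (\<lambda>_. n)) * (1 - u\<^sup>2) ^ ?ne n * ?X =
          (1 - u\<^sup>2) ^ ?ne n * (1 - u\<^sup>2) ^ ?ne n * trunc_det_lowered u S (\<lambda>_. n)"
        using bass_trunc[where n = n and u = u] unfolding c by (simp add: mult_2 power_add)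
      then have *: "(1 - u\<^sup>2) ^ card (trunc (\<lambda>_. n)) * ?X = (1 - u\<^sup>2) ^ ?ne n * trunc_det_lowered u S (\<lambda>_. n)"
        using ne by simp
      have "(1 - u\<^sup>2) powi (- outer_chi - int (card S)) = (1 - u\<^sup>2) ^ ?ne n / (1 - u\<^sup>2) ^ card (trunc (\<lambda>_. n))"
      proof -
        have "- outer_chi - int (card S) = int (?ne n) - int (card (trunc (\<lambda>_. n)))"
          unfolding outer_chi_def card_trunc e by simp
        then show ?thesis using ne by (simp add: power_int_diff)
      qed
      moreover have "X = b / c * t" if "c * X = b * t" "c \<noteq> 0" for X b c t :: complex
        using that by (simp add: field_simps)
      ultimately show ?thesis using * ne by simp
    qed
    ultimately have 1: "(\<lambda>n. (1 - u\<^sup>2) powi (- outer_chi - int (card S)) * trunc_det_lowered u S (\<lambda>_. n)) \<longlonglongrightarrow> exp (- s)" by simp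
    have "(trunc_det_lowered u S \<longlongrightarrow> (1 - u\<^sup>2) ^ card S * L) (filtermap (\<lambda>n s. n) sequentially)"
      by (rule trunc_det_lowered_limit[OF L _ filterlim_const_coords]) auto
    then have "(\<lambda>n. trunc_det_lowered u S (\<lambda>_. n)) \<longlonglongrightarrow> (1 - u\<^sup>2) ^ card S * L" by (simp add: filterlim_filtermap)
    then have 2: "(\<lambda>n. (1 - u\<^sup>2) powi (- outer_chi - int (card S)) * trunc_det_lowered u S (\<lambda>_. n))
        \<longlonglongrightarrow> (1 - u\<^sup>2) powi (- outer_chi - int (card S)) * ((1 - u\<^sup>2) ^ card S * L)"
      by (intro tendsto_intros)
    have "exp (- s) = (1 - u\<^sup>2) powi (- outer_chi - int (card S)) * ((1 - u\<^sup>2) ^ card S * L)"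
      by (rule LIMSEQ_unique[OF 1 2])
    also have "\<dots> = L / (1 - u\<^sup>2) powi outer_chi"
      using ne by (simp add: power_int_diff power_int_minus field_simps)
    finally show ?thesis .
  qed
  ultimately show "\<exists>z. z \<noteq> 0 \<and>
      ((\<lambda>C. \<Prod>c\<in>C. inverse (1 - class_value (cycwt u) c)) \<longlongrightarrow> z) (finite_subsets_at_top (prime_cycles X)) \<and>
      inverse z = connected_det T (verts X) / (1 - u\<^sup>2) powi outer_chi"
    using cdet by (intro exI[of _ "exp s"]) (auto simp: exp_minus)
qed

end

section \<open>Rays in trees\<close>

lemma reduced_iff_successively: "reduced \<rho> p \<longleftrightarrow> successively (\<lambda>e f. f \<noteq> \<rho> e) p"
  by (simp add: reduced_def successively_conv_nth)

context bidirected_digraph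
begin

definition rev_walk :: "'b list \<Rightarrow> 'b list" where
  "rev_walk p = map arev (List.rev p)"

lemma awalk_rev_walk: "awalk u p v \<Longrightarrow> awalk v (rev_walk p) u"
proof (induction p arbitrary: u)
  case Nil
  then show ?case by (auto simp: rev_walk_def awalk_Nil_iff)
next
  case (Cons e p)
  then have e: "e \<in> arcs G" "u = tail G e" "awalk (head G e) p v" by (auto simp: awalk_Cons_iff)
  then have "awalk v (rev_walk p) (head G e)" by (intro Cons.IH)
  moreover have "awalk (head G e) [arev e] u" using e by (simp add: awalk_Cons_iff awalk_Nil_iff)
  ultimately show ?case by (auto simp: rev_walk_def)
qed

lemma reduced_rev_walk: "reduced arev p \<Longrightarrow> reduced arev (rev_walk p)"
  unfolding reduced_iff_successively rev_walk_def successively_map successively_rev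
  by (auto simp: arev_eq_iff elim!: successively_mono)

lemma last_rev_walk: "p \<noteq> [] \<Longrightarrow> last (rev_walk p) = arev (hd p)"
  by (simp add: rev_walk_def last_map last_rev)

lemma hd_rev_walk: "p \<noteq> [] \<Longrightarrow> hd (rev_walk p) = arev (last p)"
  by (simp add: rev_walk_def hd_map hd_rev)

lemma rev_walk_Nil_iff [simp]: "rev_walk p = [] \<longleftrightarrow> p = []"
  by (simp add: rev_walk_def)

lemma reduced_append_iff:
  "reduced arev (p @ q) \<longleftrightarrow> reduced arev p \<and> reduced arev q \<and> (p \<noteq> [] \<longrightarrow> q \<noteq> [] \<longrightarrow> hd q \<noteq> arev (last p))"
  by (auto simp: reduced_iff_successively successively_append_iff)

text \<open>
  If two reduced walks with common ends have different last arcs, the first followed by the reverse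
  of the second is a reduced closed walk.
\<close>

lemma reduced_walk_unique:
  assumes tree: "\<And>v p. awalk v p v \<Longrightarrow> reduced arev p \<Longrightarrow> p = []"
  assumes "awalk u p v" "awalk u q v" "reduced arev p" "reduced arev q"
  shows "p = q"
  using assms(2-)
proof (induction "length p" arbitrary: p q v)
  case 0
  then show ?case using tree by (auto simp: awalk_Nil_iff)
next
  case (Suc n)
  show ?case
  proof (cases "q = []")
    case True
    then show ?thesis using Suc.prems tree[of u p] by (auto simp: awalk_Nil_iff)
  next
    case False
    have "p \<noteq> []" using Suc.hyps(2) by auto
    then obtain p' e where p: "p = p' @ [e]" by (metis rev_exhaust)
    obtain q' f where q: "q = q' @ [f]" using False by (metis rev_exhaust)
    have wp: "awalk u p' (tail G e)" "head G e = v" and wq: "awalk u q' (tail G f)" "head G f = v"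
      using Suc.prems unfolding p q by (auto simp: awalk_Cons_iff awalk_Nil_iff)
    have red: "reduced arev p'" "reduced arev q'"
      using Suc.prems unfolding p q by (auto simp: reduced_append_iff)
    show ?thesis
    proof (cases "e = f")
      case True
      then have "p' = q'" using Suc.hyps wp wq red p by (intro Suc.hyps(1)[of p' "tail G e" q']) auto
      then show ?thesis using p q True by simp
    next
      case False
      have "awalk u (p @ rev_walk q) u" using Suc.prems awalk_rev_walk by (auto)
      moreover have "reduced arev (p @ rev_walk q)"
        unfolding reduced_append_iff
        using Suc.prems reduced_rev_walk[of q] False p q by (auto simp: hd_rev_walk arev_eq_iff)
      ultimately show ?thesis using tree p by blast
    qed
  qed
qed

lemma raysD:
  assumes "r \<in> rays G arev"
  shows "r j \<in> arcs G" "head G (r j) = tail G (r (Suc j))" "r (Suc j) \<noteq> arev (r j)"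
  using assms by (auto simp: rays_def)

definition seg :: "(nat \<Rightarrow> 'b) \<Rightarrow> nat \<Rightarrow> 'b list" where
  "seg r n = map r [0..<n]"

lemma awalk_seg: "r \<in> rays G arev \<Longrightarrow> awalk (tail G (r 0)) (seg r n) (tail G (r n))"
proof (induction n)
  case 0
  then show ?case using raysD(1) by (simp add: seg_def awalk_Nil_iff)
next
  case (Suc n)
  then have "awalk (tail G (r n)) [r n] (tail G (r (Suc n)))"
    using raysD[OF Suc.prems, of n] raysD(1)[OF Suc.prems, of "Suc n"]
    by (simp add: awalk_Cons_iff awalk_Nil_iff)
  then show ?case using Suc by (auto simp: seg_def)
qed

lemma reduced_seg: "r \<in> rays G arev \<Longrightarrow> reduced arev (seg r n)"
  by (auto simp: reduced_def seg_def raysD)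

lemma shift_ray: "r \<in> rays G arev \<Longrightarrow> (\<lambda>j. r (n + j)) \<in> rays G arev"
  by (simp add: rays_def)

definition ray_append :: "'b list \<Rightarrow> (nat \<Rightarrow> 'b) \<Rightarrow> nat \<Rightarrow> 'b" where
  "ray_append p r j = (if j < length p then p ! j else r (j - length p))"

lemma ray_append_ray:
  assumes r: "r \<in> rays G arev" and p: "awalk v p (tail G (r 0))" "reduced arev p"
    and j: "p \<noteq> [] \<Longrightarrow> r 0 \<noteq> arev (last p)"
  shows "ray_append p r \<in> rays G arev" "tail G (ray_append p r 0) = v"
    "ray_append p r (length p + i) = r i"
proof -
  show "ray_append p r (length p + i) = r i" by (simp add: ray_append_def)
  have c: "set p \<subseteq> arcs G" "p \<noteq> [] \<Longrightarrow> tail G (hd p) = v" "p = [] \<Longrightarrow> v = tail G (r 0)"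
    "p \<noteq> [] \<Longrightarrow> head G (last p) = tail G (r 0)"
    "\<And>j. Suc j < length p \<Longrightarrow> head G (p ! j) = tail G (p ! Suc j)"
    using p(1) by (auto simp: awalk_def cas_iff split: if_splits)
  show "tail G (ray_append p r 0) = v"
    using c by (cases "p = []") (auto simp: ray_append_def hd_conv_nth)
  show "ray_append p r \<in> rays G arev"
    unfolding rays_def
  proof (intro CollectI allI)
    fix i
    consider "Suc i < length p" | "Suc i = length p" | "length p \<le> i" by linarith
    then show "ray_append p r i \<in> arcs G \<and> head G (ray_append p r i) = tail G (ray_append p r (Suc i)) \<and>
        ray_append p r (Suc i) \<noteq> arev (ray_append p r i)"
    proof cases
      case 1
      then show ?thesis using c p(2) by (auto simp: ray_append_def reduced_def subset_iff)
    next
      case 2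
      then have ne: "p \<noteq> []" by auto
      then have "p ! i = last p" using 2 by (metis diff_Suc_1 last_conv_nth)
      moreover have "last p \<in> arcs G" using c(1) ne by auto
      ultimately show ?thesis using 2 c(4)[OF ne] j[OF ne] by (auto simp: ray_append_def)
    next
      case 3
      then have "Suc i - length p = Suc (i - length p)" by simp
      then show ?thesis using 3 raysD[OF r, of "i - length p"] by (auto simp: ray_append_def)
    qed
  qed
qed

text \<open>
  Two natural shifts replace the integer shift in \<open>ray_equiv\<close>; see \<open>ray_equiv_iff\<close>.
\<close>

definition tail_equal :: "(nat \<Rightarrow> 'b) \<Rightarrow> (nat \<Rightarrow> 'b) \<Rightarrow> bool" where
  "tail_equal r s \<longleftrightarrow> (\<exists>a b. \<forall>i. r (a + i) = s (b + i))"

lemma tail_equal_refl: "tail_equal r r" by (auto simp: tail_equal_def)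

lemma tail_equal_sym: "tail_equal r s \<Longrightarrow> tail_equal s r"
  unfolding tail_equal_def by metis

lemma tail_equal_trans:
  assumes "tail_equal r s" "tail_equal s t"
  shows "tail_equal r t"
proof -
  obtain a b where ab: "\<And>i. r (a + i) = s (b + i)" using assms(1) by (auto simp: tail_equal_def)
  obtain c d where cd: "\<And>i. s (c + i) = t (d + i)" using assms(2) by (auto simp: tail_equal_def)
  have "r ((a + c) + i) = t ((d + b) + i)" for i
    using ab[of "c + i"] cd[of "b + i"] by (simp add: add.left_commute add.assoc)
  then show ?thesis unfolding tail_equal_def by blast
qed

lemma ray_equiv_iff: "(r, s) \<in> ray_equiv G arev \<longleftrightarrow> r \<in> rays G arev \<and> s \<in> rays G arev \<and> tail_equal r s"
proof -
  have "(\<exists>(N::nat) (k::int). \<forall>j\<ge>N. 0 \<le> int j + k \<and> r (nat (int j + k)) = s j) \<longleftrightarrow> tail_equal r s"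
  proof
    assume "\<exists>(N::nat) (k::int). \<forall>j\<ge>N. 0 \<le> int j + k \<and> r (nat (int j + k)) = s j"
    then obtain N k where N: "\<And>j. j \<ge> N \<Longrightarrow> 0 \<le> int j + k \<and> r (nat (int j + k)) = s j" by blast
    have "r (nat (int N + k) + i) = s (N + i)" for i
    proof -
      have "nat (int N + k) + i = nat (int (N + i) + k)" using N[of N] by auto
      then show ?thesis using N[of "N + i"] by simp
    qed
    then show "tail_equal r s" unfolding tail_equal_def by blast
  next
    assume "tail_equal r s"
    then obtain a b where ab: "\<And>i. r (a + i) = s (b + i)" by (auto simp: tail_equal_def)
    have "0 \<le> int j + (int a - int b) \<and> r (nat (int j + (int a - int b))) = s j" if j: "j \<ge> b" for j
    proof -
      have "nat (int j + (int a - int b)) = a + (j - b)" using j by auto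
      then show ?thesis using ab[of "j - b"] j by simp
    qed
    then show "\<exists>(N::nat) (k::int). \<forall>j\<ge>N. 0 \<le> int j + k \<and> r (nat (int j + k)) = s j" by blast
  qed
  then show ?thesis by (simp add: ray_equiv_def)
qed

lemma boundary_classD:
  assumes "c \<in> tree_boundary G arev"
  shows "\<exists>r. r \<in> c" and "\<And>r. r \<in> c \<Longrightarrow> r \<in> rays G arev"
    and "\<And>r s. r \<in> c \<Longrightarrow> s \<in> c \<longleftrightarrow> s \<in> rays G arev \<and> tail_equal r s"
proof -
  obtain q where q: "q \<in> rays G arev" "c = ray_equiv G arev `` {q}"
    using assms by (auto simp: tree_boundary_def quotient_def)
  then have c: "c = {s \<in> rays G arev. tail_equal q s}" by (auto simp: ray_equiv_iff)
  show "\<exists>r. r \<in> c" using q(1) c tail_equal_refl by auto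
  show "\<And>r. r \<in> c \<Longrightarrow> r \<in> rays G arev" using c by simp
  show "\<And>r s. r \<in> c \<Longrightarrow> s \<in> c \<longleftrightarrow> s \<in> rays G arev \<and> tail_equal r s"
    using c tail_equal_trans tail_equal_sym by blast
qed

text \<open>
  Long initial segments of both rays are reduced walks with common ends.
\<close>

lemma ray_unique:
  assumes tree: "\<And>v p. awalk v p v \<Longrightarrow> reduced arev p \<Longrightarrow> p = []"
  assumes "r \<in> rays G arev" "s \<in> rays G arev" "tail_equal r s" "tail G (r 0) = tail G (s 0)"
  shows "r = s"
proof
  fix j
  obtain a b where ab: "\<And>i. r (a + i) = s (b + i)" using assms(4) by (auto simp: tail_equal_def)
  have eq: "seg r (a + i) = seg s (b + i)" for i
    using awalk_seg[OF assms(2), of "a + i"] awalk_seg[OF assms(3), of "b + i"] ab[of i] assms(5)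
    by (intro reduced_walk_unique[OF tree _ _ reduced_seg[OF assms(2)] reduced_seg[OF assms(3)]]) auto
  have "a = b" using arg_cong[OF eq[of 0], of length] by (simp add: seg_def)
  then have "seg r (a + Suc j) ! j = seg s (a + Suc j) ! j" using eq[of "Suc j"] by simp
  then show "r j = s j" by (simp add: seg_def del: upt_Suc)
qed

text \<open>
  A shortest walk from \<open>v\<close> to a vertex of the ray continues along the ray without backtracking.
\<close>

lemma ray_exists:
  assumes conn: "strongly_connected G" and r: "r \<in> rays G arev" and v: "v \<in> verts G"
  shows "\<exists>s\<in>rays G arev. tail G (s 0) = v \<and> tail_equal r s"
proof -
  let ?P = "\<lambda>l. \<exists>n p. awalk v p (tail G (r n)) \<and> length p = l"
  have "v \<rightarrow>\<^sup>*\<^bsub>G\<^esub> tail G (r 0)" using conn v raysD(1)[OF r] by (auto simp: strongly_connected_def)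
  then have "\<exists>l. ?P l" using reachable_awalk by blast
  then have "?P (LEAST l. ?P l)" by (rule LeastI_ex)
  then obtain n p where p: "awalk v p (tail G (r n))" "length p = (LEAST l. ?P l)" by blast
  have least: "length p \<le> length q" if "awalk v q (tail G (r m))" for q m
    unfolding p(2) by (rule Least_le) (use that in blast)
  have red: "reduced arev p"
  proof (rule ccontr)
    assume "\<not> reduced arev p"
    then obtain j where j: "Suc j < length p" "p ! Suc j = arev (p ! j)" by (auto simp: reduced_def)
    define a b where "a = take j p" and "b = drop (Suc (Suc j)) p"
    have ps: "p = a @ [p ! j, p ! Suc j] @ b"
      using j(1) by (simp add: a_def b_def Cons_nth_drop_Suc)
    have "awalk v (a @ [p ! j, p ! Suc j] @ b) (tail G (r n))" using p(1) ps by simp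
    then have "awalk v a (tail G (p ! j))" "p ! j \<in> arcs G" "awalk (head G (p ! Suc j)) b (tail G (r n))"
      by (auto simp: awalk_Cons_iff)
    then have "awalk v (a @ b) (tail G (r n))" using j(2) by auto
    from least[OF this] show False using arg_cong[OF ps, of length] by simp
  qed
  have j: "r (n + 0) \<noteq> arev (last p)" if ne: "p \<noteq> []"
  proof
    assume *: "r (n + 0) = arev (last p)"
    obtain q e where q: "p = q @ [e]" using ne by (metis rev_exhaust)
    then have w: "awalk v q (tail G e)" "e \<in> arcs G" using p(1) by (auto simp: awalk_Cons_iff)
    have "r n = arev e" using * q by simp
    then have "tail G e = tail G (r (Suc n))" using raysD(2)[OF r, of n] w(2) by simp
    then show False using least[of q "Suc n"] w(1) q by simp
  qed
  let ?s = "ray_append p (\<lambda>j. r (n + j))"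
  have w: "awalk v p (tail G (r (n + 0)))" using p(1) by simp
  have s: "?s \<in> rays G arev" "tail G (?s 0) = v" "\<And>i. ?s (length p + i) = r (n + i)"
    using ray_append_ray[OF shift_ray[OF r, of n] w red j] by auto
  then have "tail_equal r ?s" unfolding tail_equal_def by metis
  then show ?thesis using s by blast
qed

text \<open>
  If \<open>r'\<close> leaves the ray \<open>r\<close> at its vertex number \<open>i\<close>, the way back from any vertex of \<open>r'\<close> to the
  ray and then along it is again a ray.
\<close>

lemma detour_ray:
  assumes r: "r \<in> rays G arev" and r': "r' \<in> rays G arev"
    and leave: "tail G (r' 0) = tail G (r i)" "r' 0 \<noteq> r i"
  shows "\<exists>R\<in>rays G arev. tail G (R 0) = tail G (r' d) \<and> (\<forall>j. R (d + j) = r (i + j)) \<and>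
    (0 < d \<longrightarrow> R (d - 1) = arev (r' 0))"
proof -
  let ?p = "rev_walk (seg r' d)"
  have p: "awalk (tail G (r' d)) ?p (tail G (r (i + 0)))" "reduced arev ?p"
    using awalk_rev_walk[OF awalk_seg[OF r', of d]] reduced_rev_walk[OF reduced_seg[OF r']] leave by auto
  have l: "length ?p = d" by (simp add: rev_walk_def seg_def)
  have last: "last ?p = arev (r' 0)" if "0 < d"
    using that by (subst last_rev_walk) (auto simp: seg_def hd_map)
  have "r (i + 0) \<noteq> arev (last ?p)" if ne: "?p \<noteq> []"
  proof -
    have "0 < d" using ne l by (metis length_greater_0_conv)
    then show ?thesis using last leave by simp
  qed
  from ray_append_ray[OF shift_ray[OF r, of i] p this]
  have R: "ray_append ?p (\<lambda>j. r (i + j)) \<in> rays G arev"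
    "tail G (ray_append ?p (\<lambda>j. r (i + j)) 0) = tail G (r' d)"
    "\<And>j. ray_append ?p (\<lambda>j. r (i + j)) (d + j) = r (i + j)"
    unfolding l by auto
  have "ray_append ?p (\<lambda>j. r (i + j)) (d - 1) = arev (r' 0)" if "0 < d"
  proof -
    have "?p \<noteq> []" using that l by auto
    then have "last ?p = ?p ! (d - 1)" using last_conv_nth[of ?p] l by simp
    then show ?thesis using last that l by (simp add: ray_append_def)
  qed
  then show ?thesis using R by blast
qed

end

section \<open>Cusps of tree lattices\<close>

context group_action
begin

lemma orbit_image:
  assumes g: "g \<in> carrier G" and x: "x \<in> E"
  shows "orbit G \<phi> (\<phi> g x) = orbit G \<phi> x"
proof -
  interpret group G using group_hom by (simp add: group_hom_def)
  have "\<phi> h (\<phi> g x) \<in> orbit G \<phi> x" if "h \<in> carrier G" for h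
    unfolding orbit_def using composition_rule[OF x that g] that g by (auto intro!: exI[of _ "h \<otimes> g"])
  moreover have "\<phi> h x \<in> orbit G \<phi> (\<phi> g x)" if h: "h \<in> carrier G" for h
  proof -
    have "\<phi> h x = \<phi> h (\<phi> (inv g) (\<phi> g x))" using orbit_sym_aux[OF g x refl] by simp
    also have "\<dots> = \<phi> (h \<otimes> inv g) (\<phi> g x)"
      using composition_rule[OF element_image[OF g x refl] h, of "inv g"] g by simp
    finally show ?thesis unfolding orbit_def using h g by (auto intro!: exI[of _ "h \<otimes> inv g"])
  qed
  ultimately show ?thesis unfolding orbit_def by blast
qed

lemma orbit_eq_iff:
  assumes "x \<in> E" "y \<in> E"
  shows "orbit G \<phi> x = orbit G \<phi> y \<longleftrightarrow> (\<exists>g\<in>carrier G. \<phi> g x = y)"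
proof
  assume "orbit G \<phi> x = orbit G \<phi> y"
  then have "y \<in> orbit G \<phi> x" using orbit_refl[OF assms(2)] by simp
  then show "\<exists>g\<in>carrier G. \<phi> g x = y" by (auto simp: orbit_def)
next
  assume "\<exists>g\<in>carrier G. \<phi> g x = y"
  then show "orbit G \<phi> x = orbit G \<phi> y" using orbit_image[OF _ assms(1)] by auto
qed

end

locale tree_action =
  fixes Y :: "('v, 'e) pre_digraph" and arev :: "'e \<Rightarrow> 'e" and \<Gamma> :: "('g, 'm) monoid_scheme" (structure)
    and av :: "'g \<Rightarrow> 'v \<Rightarrow> 'v" and ae :: "'g \<Rightarrow> 'e \<Rightarrow> 'e"
  assumes is_tree: "is_tree Y arev" and graph_action: "graph_action Y arev \<Gamma> av ae"

sublocale tree_action \<subseteq> Y: bidirected_digraph Y arev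
  using is_tree by (simp add: is_tree_def)

sublocale tree_action \<subseteq> V: group_action \<Gamma> "verts Y" av
  using graph_action by (simp add: graph_action_def)

sublocale tree_action \<subseteq> E: group_action \<Gamma> "arcs Y" ae
  using graph_action by (simp add: graph_action_def)

context tree_action
begin

lemma group: "group \<Gamma>"
  using E.group_hom by (simp add: group_hom_def)

lemma no_reduced_closed: "Y.awalk v p v \<Longrightarrow> reduced arev p \<Longrightarrow> p = []"
  using is_tree by (auto simp: is_tree_def)

lemma act_arc:
  assumes "g \<in> carrier \<Gamma>" "e \<in> arcs Y"
  shows "ae g e \<in> arcs Y" "tail Y (ae g e) = av g (tail Y e)" "head Y (ae g e) = av g (head Y e)"
    "ae g (arev e) = arev (ae g e)"
  using E.element_image[OF assms refl] graph_action assms by (auto simp: graph_action_def)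

lemma act_vert: "g \<in> carrier \<Gamma> \<Longrightarrow> v \<in> verts Y \<Longrightarrow> av g v \<in> verts Y"
  using V.element_image by blast

lemma act_arc_inj: "g \<in> carrier \<Gamma> \<Longrightarrow> e \<in> arcs Y \<Longrightarrow> f \<in> arcs Y \<Longrightarrow> ae g e = ae g f \<longleftrightarrow> e = f"
  using E.inj_prop by (auto simp: inj_on_def)

lemma act_ray: "g \<in> carrier \<Gamma> \<Longrightarrow> r \<in> rays Y arev \<Longrightarrow> (\<lambda>n. ae g (r n)) \<in> rays Y arev"
  unfolding rays_def
proof (intro CollectI allI, elim CollectE)
  fix j assume g: "g \<in> carrier \<Gamma>"
    and "\<forall>j. r j \<in> arcs Y \<and> head Y (r j) = tail Y (r (Suc j)) \<and> r (Suc j) \<noteq> arev (r j)"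
  then have r: "\<And>j. r j \<in> arcs Y" "\<And>j. head Y (r j) = tail Y (r (Suc j))" "\<And>j. r (Suc j) \<noteq> arev (r j)" by auto
  have "ae g (r (Suc j)) \<noteq> ae g (arev (r j))"
    using act_arc_inj[OF g r(1), of "arev (r j)" "Suc j"] r by simp
  then show "ae g (r j) \<in> arcs Y \<and> head Y (ae g (r j)) = tail Y (ae g (r (Suc j))) \<and>
      ae g (r (Suc j)) \<noteq> arev (ae g (r j))"
    using act_arc[OF g r(1)] r by simp
qed

lemma tail_equal_act: "Y.tail_equal r s \<Longrightarrow> Y.tail_equal (\<lambda>n. ae g (r n)) (\<lambda>n. ae g (s n))"
  unfolding Y.tail_equal_def by metis

lemma ray_in_end_exists:
  assumes c: "c \<in> tree_boundary Y arev" and v: "v \<in> verts Y"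
  shows "\<exists>r\<in>c. tail Y (r 0) = v"
proof -
  obtain r where r: "r \<in> c" using Y.boundary_classD(1)[OF c] by blast
  obtain s where "s \<in> rays Y arev" "tail Y (s 0) = v" "Y.tail_equal r s"
    using Y.ray_exists[OF _ Y.boundary_classD(2)[OF c r] v] is_tree by (auto simp: is_tree_def)
  then show ?thesis using Y.boundary_classD(3)[OF c r] by blast
qed

lemma ray_in_end_unique:
  assumes c: "c \<in> tree_boundary Y arev" and "r \<in> c" "s \<in> c" "tail Y (r 0) = tail Y (s 0)"
  shows "r = s"
proof (rule Y.ray_unique[OF no_reduced_closed])
  show "r \<in> rays Y arev" "s \<in> rays Y arev" using Y.boundary_classD(2)[OF c] assms by auto
  show "Y.tail_equal r s" using Y.boundary_classD(3)[OF c assms(2)] assms by blast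
qed (use assms in auto)

lemma shift_in_end:
  assumes c: "c \<in> tree_boundary Y arev" and r: "r \<in> c"
  shows "(\<lambda>j. r (n + j)) \<in> c"
proof -
  have "Y.tail_equal r (\<lambda>j. r (n + j))"
    unfolding Y.tail_equal_def by (intro exI[of _ n] exI[of _ 0]) simp
  then show ?thesis
    using Y.boundary_classD(3)[OF c r] Y.shift_ray[OF Y.boundary_classD(2)[OF c r]] by blast
qed

lemma meet_imp_eq:
  assumes c: "c \<in> tree_boundary Y arev" and "r \<in> c" "s \<in> c" "tail Y (r n) = tail Y (s m)"
  shows "r (n + i) = s (m + i)"
proof -
  have "(\<lambda>j. r (n + j)) = (\<lambda>j. s (m + j))"
    by (rule ray_in_end_unique[OF c shift_in_end[OF c assms(2)] shift_in_end[OF c assms(3)]]) (use assms in simp)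
  then show ?thesis by (rule fun_cong)
qed

text \<open>
  Every vertex starts a ray in \<open>c\<close>, so the horocycle \<open>horocycle_rel Y c `` {v}\<close> contains \<open>v\<close>. With
  \<open>v = tail Y (\<rho> 0)\<close> as base point, membership in it is a single instance of \<open>horocycle_rel\<close>.
\<close>

lemma cusp_horocycle:
  assumes "is_cusp Y arev \<Gamma> av ae c"
  obtains \<rho> where "\<rho> \<in> c"
    "\<And>z n. z \<in> c \<Longrightarrow> tail Y (z n) = tail Y (\<rho> n) \<Longrightarrow>
       \<exists>g\<in>horocycle_stabilizer Y \<Gamma> av ae c. av g (tail Y (\<rho> 0)) = tail Y (z 0)"
proof -
  have c: "c \<in> tree_boundary Y arev" using assms by (simp add: is_cusp_def)
  obtain H where H: "H \<in> horocycles Y c"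
    "\<And>x y. x \<in> H \<Longrightarrow> y \<in> H \<Longrightarrow> \<exists>g\<in>horocycle_stabilizer Y \<Gamma> av ae c. av g x = y"
    using assms unfolding is_cusp_def by blast
  obtain v where v: "v \<in> verts Y" "H = horocycle_rel Y c `` {v}"
    using H(1) by (auto simp: horocycles_def quotient_def)
  obtain \<rho> where \<rho>: "\<rho> \<in> c" "tail Y (\<rho> 0) = v" using ray_in_end_exists[OF c v(1)] by blast
  have mem: "tail Y (z 0) \<in> H" if "z \<in> c" "tail Y (z n) = tail Y (\<rho> n)" for z n
  proof -
    have "\<exists>r\<in>c. \<exists>s\<in>c. tail Y (r 0) = v \<and> tail Y (s 0) = tail Y (z 0) \<and> (\<exists>n. tail Y (r n) = tail Y (s n))"
      using that \<rho> by metis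
    then show ?thesis unfolding v(2) horocycle_rel_def by simp
  qed
  show ?thesis
    by (rule that[OF \<rho>(1)]) (use H(2)[OF mem[OF \<rho>(1) refl] mem] in blast)
qed

lemma horocycle_stabilizer_carrier:
  "g \<in> horocycle_stabilizer Y \<Gamma> av ae c \<Longrightarrow> g \<in> carrier \<Gamma>"
  by (simp add: horocycle_stabilizer_def end_stabilizer_def)

text \<open>
  If \<open>g\<close> fixed the \<open>n\<close>-th vertex of \<open>r\<close> but moved the \<open>n\<close>-th edge, the image under \<open>g\<close> of some later
  vertex of \<open>r\<close> would lie on the horocycle on which the stabilizer is transitive. The orbit of that
  vertex would then be the orbit of the horocycle, and its number on \<open>r\<close> grows with \<open>n\<close>; since the
  vertices of \<open>r\<close> have distinct orbits, this happens for one \<open>n\<close> at most.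
\<close>

lemma cusp_ray_eventually_fixed:
  assumes cusp: "is_cusp Y arev \<Gamma> av ae c" and r: "r \<in> c"
    and inj: "inj (\<lambda>n. orbit \<Gamma> av (tail Y (r n)))"
  shows "\<exists>n0. \<forall>n\<ge>n0. \<forall>g\<in>carrier \<Gamma>. av g (tail Y (r n)) = tail Y (r n) \<longrightarrow> ae g (r n) = r n"
proof -
  have c: "c \<in> tree_boundary Y arev" using cusp by (simp add: is_cusp_def)
  have ray: "r \<in> rays Y arev" by (rule Y.boundary_classD(2)[OF c r])
  obtain z where z: "z \<in> c"
    "\<And>y n. y \<in> c \<Longrightarrow> tail Y (y n) = tail Y (z n) \<Longrightarrow>
       \<exists>g\<in>horocycle_stabilizer Y \<Gamma> av ae c. av g (tail Y (z 0)) = tail Y (y 0)"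
    using cusp_horocycle[OF cusp] by metis
  have "Y.tail_equal z r" using Y.boundary_classD(3)[OF c z(1)] r by blast
  then obtain a b where ab: "\<And>i. z (a + i) = r (b + i)" by (auto simp: Y.tail_equal_def)
  \<comment> \<open>The vertex \<open>b + i\<close> of \<open>r\<close> has distance \<open>a + i\<close> from \<open>tail Y (z 0)\<close>, so going \<open>a + i\<close> steps
    away from it along the image of \<open>r\<close> ends on the horocycle of \<open>tail Y (z 0)\<close>.\<close>
  have bad: "orbit \<Gamma> av (tail Y (z 0)) = orbit \<Gamma> av (tail Y (r (b + i + (a + i))))"
    if g: "g \<in> carrier \<Gamma>" "av g (tail Y (r (b + i))) = tail Y (r (b + i))" "ae g (r (b + i)) \<noteq> r (b + i)" for g i
  proof -
    let ?r' = "\<lambda>j. ae g (r (b + i + j))"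
    have r': "?r' \<in> rays Y arev" by (rule act_ray[OF g(1) Y.shift_ray[OF ray]])
    have arcs: "r n \<in> arcs Y" for n using Y.raysD(1)[OF ray] .
    have "tail Y (?r' 0) = tail Y (r (b + i))" "?r' 0 \<noteq> r (b + i)"
      using g act_arc[OF g(1) arcs] by auto
    from Y.detour_ray[OF ray r' this, of "a + i"] obtain R where R: "R \<in> rays Y arev"
      "tail Y (R 0) = tail Y (?r' (a + i))" "\<And>j. R (a + i + j) = r (b + i + j)" by blast
    have "Y.tail_equal r R" unfolding Y.tail_equal_def using R(3) by metis
    then have "R \<in> c" using Y.boundary_classD(3)[OF c r] R(1) by blast
    moreover have "tail Y (R (a + i)) = tail Y (z (a + i))" using R(3)[of 0] ab[of i] by simp
    ultimately obtain h where h: "h \<in> horocycle_stabilizer Y \<Gamma> av ae c" "av h (tail Y (z 0)) = tail Y (R 0)"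
      using z(2) by blast
    have hc: "h \<in> carrier \<Gamma>" by (rule horocycle_stabilizer_carrier[OF h(1)])
    have zv: "tail Y (z 0) \<in> verts Y" using Y.raysD(1)[OF Y.boundary_classD(2)[OF c z(1)]] by simp
    have eq: "av h (tail Y (z 0)) = av g (tail Y (r (b + i + (a + i))))"
      using h(2) R(2) act_arc[OF g(1) arcs] by simp
    have rv: "tail Y (r (b + i + (a + i))) \<in> verts Y" using arcs by simp
    show ?thesis
      using V.orbit_image[OF hc zv] V.orbit_image[OF g(1) rv] eq by simp
  qed
  show ?thesis
  proof (cases "\<exists>i g. g \<in> carrier \<Gamma> \<and> av g (tail Y (r (b + i))) = tail Y (r (b + i)) \<and> ae g (r (b + i)) \<noteq> r (b + i)")
    case False
    then show ?thesis by (intro exI[of _ b]) (metis le_iff_add)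
  next
    case True
    then obtain i0 where i0: "orbit \<Gamma> av (tail Y (z 0)) = orbit \<Gamma> av (tail Y (r (b + i0 + (a + i0))))"
      using bad by blast
    show ?thesis
    proof (intro exI[of _ "b + i0 + 1"] allI impI ballI)
      fix n g assume n: "n \<ge> b + i0 + 1" and g: "g \<in> carrier \<Gamma>" "av g (tail Y (r n)) = tail Y (r n)"
      then obtain i where i: "n = b + i" "i > i0" 
        using that[of "n - b"] n by auto
      show "ae g (r n) = r n"
      proof (rule ccontr)
        assume "ae g (r n) \<noteq> r n"
        then have "orbit \<Gamma> av (tail Y (z 0)) = orbit \<Gamma> av (tail Y (r (b + i + (a + i))))"
          using bad[of g i] g i by simp
        then have "b + i + (a + i) = b + i0 + (a + i0)" using i0 inj by (auto simp: inj_def)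
        then show False using i by simp
      qed
    qed
  qed
qed

text \<open>
  A group element that preserves a horocycle does not shift the rays of the end, so it fixes them from
  some point on.
\<close>

lemma horocycle_stabilizer_fixes:
  assumes c: "c \<in> tree_boundary Y arev" and r: "r \<in> c" and g: "g \<in> horocycle_stabilizer Y \<Gamma> av ae c"
  shows "\<exists>k. \<forall>j\<ge>k. ae g (r j) = r j"
proof -
  have gc: "g \<in> carrier \<Gamma>" by (rule horocycle_stabilizer_carrier[OF g])
  have inv: "(\<lambda>n. ae g (s n)) \<in> c" if "s \<in> c" for s
    using g that by (auto simp: horocycle_stabilizer_def end_stabilizer_def)
  obtain H where H: "H \<in> horocycles Y c" "av g ` H = H"
    using g by (auto simp: horocycle_stabilizer_def)
  obtain v where v: "v \<in> verts Y" "H = horocycle_rel Y c `` {v}"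
    using H(1) by (auto simp: horocycles_def quotient_def)
  obtain s where s: "s \<in> c" "tail Y (s 0) = v" using ray_in_end_exists[OF c v(1)] by blast
  have "v \<in> H" unfolding v(2) horocycle_rel_def using s by blast
  then have "av g v \<in> H" using H(2) by blast
  then obtain r1 r2 n where r12: "r1 \<in> c" "r2 \<in> c" "tail Y (r1 0) = v" "tail Y (r2 0) = av g v"
    "tail Y (r1 n) = tail Y (r2 n)" unfolding v(2) horocycle_rel_def by blast
  have arc: "r1 j \<in> arcs Y" for j using Y.raysD(1)[OF Y.boundary_classD(2)[OF c r12(1)]] .
  have eq: "(\<lambda>n. ae g (r1 n)) = r2"
    by (rule ray_in_end_unique[OF c inv[OF r12(1)] r12(2)]) (use r12 act_arc[OF gc arc] in simp)
  have fix1: "ae g (r1 (n + i)) = r1 (n + i)" for i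
    using meet_imp_eq[OF c r12(1,2,5), of i] fun_cong[OF eq, of "n + i"] by simp
  have "Y.tail_equal r1 r" using Y.boundary_classD(3)[OF c r12(1)] r by blast
  then obtain a b where ab: "\<And>i. r1 (a + i) = r (b + i)" by (auto simp: Y.tail_equal_def)
  have "ae g (r j) = r j" if j: "j \<ge> b + n" for j
  proof -
    obtain m where m: "j = b + (n + m)" using j by (metis add.assoc le_Suc_ex)
    have "r j = r1 (n + (a + m))" using ab[of "n + m"] m by (simp add: ac_simps)
    then show ?thesis using fix1[of "a + m"] by simp
  qed
  then show ?thesis by blast
qed

text \<open>
  If the quotient is finite, infinitely many edges of a ray to the cusp lie in one orbit, and their
  stabilizers have the same finite order. As each element of the stabilizer of the cusp fixes the ray
  from some point on, this bounds the size of the transitive horocycle. Hence, from some point on,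
  no infinite path leaves the ray sideways, since it would lead back down to the horocycle. An element
  moving one edge of the ray to a later one in the same orbit must then preserve the whole ray, that
  is, it is a translation fixing the cusp, which is impossible.
\<close>

lemma finite_quotient_no_cusp:
  assumes fin: "finite (orbits \<Gamma> (arcs Y) ae)" and stab: "\<And>e. e \<in> arcs Y \<Longrightarrow> finite (stabilizer \<Gamma> ae e)"
  shows "\<not> is_cusp Y arev \<Gamma> av ae c"
proof
  assume cusp: "is_cusp Y arev \<Gamma> av ae c"
  let ?HS = "horocycle_stabilizer Y \<Gamma> av ae c"
  interpret group \<Gamma> by (rule group)
  have c: "c \<in> tree_boundary Y arev" using cusp by (simp add: is_cusp_def)
  obtain r where r: "r \<in> c"
    "\<And>z n. z \<in> c \<Longrightarrow> tail Y (z n) = tail Y (r n) \<Longrightarrow> \<exists>g\<in>?HS. av g (tail Y (r 0)) = tail Y (z 0)"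
    using cusp_horocycle[OF cusp] by metis
  have ray: "r \<in> rays Y arev" by (rule Y.boundary_classD(2)[OF c r(1)])
  have arc: "r n \<in> arcs Y" for n by (rule Y.raysD(1)[OF ray])
  have "finite ((\<lambda>n. orbit \<Gamma> ae (r n)) ` UNIV)"
    by (rule finite_subset[OF _ fin]) (use arc in \<open>auto simp: orbits_def\<close>)
  from pigeonhole_infinite[OF infinite_UNIV_nat this] obtain n0 where
    inf: "infinite {n \<in> UNIV. orbit \<Gamma> ae (r n) = orbit \<Gamma> ae (r n0)}" by blast
  have often: "\<exists>n\<ge>k. orbit \<Gamma> ae (r n) = orbit \<Gamma> ae (r n0)" for k
    using inf unfolding infinite_nat_iff_unbounded_le by auto
  \<comment> \<open>The horocycle of \<open>tail Y (r 0)\<close>.\<close>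
  define B where "B = {tail Y (z 0) | z n. z \<in> c \<and> tail Y (z n) = tail Y (r n)}"
  have finB: "finite B"
  proof (rule ccontr)
    assume "infinite B"
    then obtain K where K: "finite K" "card K = Suc (card (stabilizer \<Gamma> ae (r n0)))" "K \<subseteq> B"
      using infinite_arbitrarily_large by blast
    have "\<exists>g\<in>?HS. av g (tail Y (r 0)) = y" if "y \<in> K" for y
      using r(2) that K(3) unfolding B_def by blast
    then obtain \<gamma> where \<gamma>: "\<And>y. y \<in> K \<Longrightarrow> \<gamma> y \<in> ?HS \<and> av (\<gamma> y) (tail Y (r 0)) = y" by metis
    then have "\<exists>k. \<forall>j\<ge>k. ae (\<gamma> y) (r j) = r j" if "y \<in> K" for y
      using horocycle_stabilizer_fixes[OF c r(1)] that by blast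
    then obtain k where k: "\<And>y j. y \<in> K \<Longrightarrow> k y \<le> j \<Longrightarrow> ae (\<gamma> y) (r j) = r j" by metis
    obtain n where n: "n \<ge> Max (insert 0 (k ` K))" "orbit \<Gamma> ae (r n) = orbit \<Gamma> ae (r n0)"
      using often by blast
    have kn: "k y \<le> n" if "y \<in> K" for y
      using n(1) K(1) that by (auto intro: order_trans[OF Max_ge])
    obtain h where h: "h \<in> carrier \<Gamma>" "ae h (r n0) = r n"
      using E.orbit_eq_iff[OF arc arc, of n0 n] n(2) by auto
    have hinv: "ae (inv h) (r n) = r n0" by (rule E.orbit_sym_aux[OF h(1) arc h(2)])
    have \<gamma>c: "\<gamma> y \<in> carrier \<Gamma>" if "y \<in> K" for y
      using \<gamma>[OF that] horocycle_stabilizer_carrier by blast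
    \<comment> \<open>Conjugation by \<open>h\<close> moves the stabilizer of \<open>r n\<close> to that of the fixed edge \<open>r n0\<close>.\<close>
    define \<phi> where "\<phi> y = inv h \<otimes> (\<gamma> y \<otimes> h)" for y
    have "\<phi> y \<in> stabilizer \<Gamma> ae (r n0)" if "y \<in> K" for y
    proof -
      have "ae (\<gamma> y \<otimes> h) (r n0) = r n"
        using E.composition_rule[OF arc \<gamma>c[OF that] h(1), of n0] h(2) k[OF that kn[OF that]] by simp
      then have "ae (\<phi> y) (r n0) = r n0"
        unfolding \<phi>_def using E.composition_rule[OF arc, of "inv h" "\<gamma> y \<otimes> h" n0] h(1) \<gamma>c[OF that] hinv by simp
      then show ?thesis unfolding stabilizer_def using h(1) \<gamma>c[OF that] by (simp add: \<phi>_def)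
    qed
    moreover have "inj_on \<phi> K"
    proof (rule inj_onI)
      fix y y' assume y: "y \<in> K" "y' \<in> K" "\<phi> y = \<phi> y'"
      then have "\<gamma> y \<otimes> h = \<gamma> y' \<otimes> h" unfolding \<phi>_def using h(1) \<gamma>c by simp
      then have "\<gamma> y = \<gamma> y'" using h(1) \<gamma>c y by simp
      then show "y = y'" using \<gamma> y by metis
    qed
    ultimately have "card K \<le> card (stabilizer \<Gamma> ae (r n0))"
      by (intro card_inj_on_le[of \<phi>] stab[OF arc]) auto
    then show False using K(2) by simp
  qed
  have "\<exists>n. \<exists>z\<in>c. y = tail Y (z 0) \<and> tail Y (z n) = tail Y (r n)" if "y \<in> B" for y
    using that unfolding B_def by blast
  then obtain \<nu> where \<nu>: "\<And>y. y \<in> B \<Longrightarrow> \<exists>z\<in>c. y = tail Y (z 0) \<and> tail Y (z (\<nu> y)) = tail Y (r (\<nu> y))" by metis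
  define M where "M = Max (insert 0 (\<nu> ` B))"
  \<comment> \<open>All rays from the horocycle to the cusp have merged with \<open>r\<close> at its vertex \<open>M\<close>.\<close>
  have merge: "z (M + i) = r (M + i)" if z: "z \<in> c" "tail Y (z n) = tail Y (r n)" for z n i
  proof -
    have y: "tail Y (z 0) \<in> B" unfolding B_def using z by blast
    then obtain z' where z': "z' \<in> c" "tail Y (z 0) = tail Y (z' 0)"
      "tail Y (z' (\<nu> (tail Y (z 0)))) = tail Y (r (\<nu> (tail Y (z 0))))" using \<nu> by blast
    have "z = z'" by (rule ray_in_end_unique[OF c z(1) z'(1,2)])
    moreover obtain k where "M = \<nu> (tail Y (z 0)) + k"
      using finB y unfolding M_def by (metis Max_ge finite.insertI finite_imageI image_eqI insertI2 le_iff_add)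
    ultimately show ?thesis using meet_imp_eq[OF c z(1) r(1), of "\<nu> (tail Y (z 0))" "\<nu> (tail Y (z 0))" "k + i"] z'(3)
      by (simp add: add.assoc)
  qed
  obtain n where n: "n \<ge> M" "orbit \<Gamma> ae (r n) = orbit \<Gamma> ae (r n0)" using often by blast
  obtain m where m: "m \<ge> Suc n" "orbit \<Gamma> ae (r m) = orbit \<Gamma> ae (r n0)" using often by blast
  obtain g where g: "g \<in> carrier \<Gamma>" "ae g (r n) = r m"
    using E.orbit_eq_iff[OF arc arc, of n m] n m by auto
  have trans: "ae g (r (n + j)) = r (m + j)" for j
  proof (induction j)
    case (Suc j)
    show ?case
    proof (rule ccontr)
      assume ne: "ae g (r (n + Suc j)) \<noteq> r (m + Suc j)"
      let ?r' = "\<lambda>k. ae g (r (n + Suc j + k))"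
      have r': "?r' \<in> rays Y arev" by (rule act_ray[OF g(1) Y.shift_ray[OF ray]])
      have "tail Y (ae g (r (n + Suc j))) = head Y (ae g (r (n + j)))"
        using act_arc[OF g(1) arc] Y.raysD(2)[OF ray, of "n + j"] by simp
      then have "tail Y (?r' 0) = tail Y (r (m + Suc j))" using Suc Y.raysD(2)[OF ray, of "m + j"] by simp
      moreover have "?r' 0 \<noteq> r (m + Suc j)" using ne by simp
      \<comment> \<open>Going \<open>m + Suc j\<close> steps along the branch ends on the horocycle, so the way back along the
        branch would have to agree with \<open>r\<close> beyond \<open>M\<close>.\<close>
      ultimately obtain R where R: "R \<in> rays Y arev" "\<And>k. R (m + Suc j + k) = r (m + Suc j + k)"
        "R (m + Suc j - 1) = arev (?r' 0)"
        using Y.detour_ray[OF ray r', of "m + Suc j" "m + Suc j"] by auto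
      have "Y.tail_equal r R" unfolding Y.tail_equal_def using R(2) by metis
      then have Rc: "R \<in> c" using Y.boundary_classD(3)[OF c r(1)] R(1) by blast
      obtain i where i: "m + j = M + i" using n m by (metis le_iff_add le_trans Suc_leD trans_le_add1)
      have "tail Y (R (m + Suc j)) = tail Y (r (m + Suc j))" using R(2)[of 0] by simp
      then have "R (m + j) = r (m + j)" using merge[OF Rc, of "m + Suc j" i] i by simp
      then have "arev (?r' 0) = ae g (r (n + j))" using R(3) Suc by simp
      then have "?r' 0 = ae g (arev (r (n + j)))" using act_arc(4)[OF g(1) arc] by (metis Y.arev_arev)
      then have "r (n + Suc j) = arev (r (n + j))"
        using act_arc_inj[OF g(1) arc, of "arev (r (n + j))" "n + Suc j"] arc by simp
      then show False using Y.raysD(3)[OF ray, of "n + j"] by simp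
    qed
  qed (use g in simp)
  have gi: "inv g \<in> carrier \<Gamma>" using g(1) by simp
  have trans': "ae (inv g) (r (m + j)) = r (n + j)" for j
    by (rule E.orbit_sym_aux[OF g(1) arc trans])
  have te: "Y.tail_equal r (\<lambda>k. ae g (r k))" "Y.tail_equal r (\<lambda>k. ae (inv g) (r k))"
    unfolding Y.tail_equal_def using trans trans' by metis+
  have closed: "(\<lambda>k. ae h (s k)) \<in> c"
    if h: "h \<in> carrier \<Gamma>" "Y.tail_equal r (\<lambda>k. ae h (r k))" and s: "s \<in> c" for h s
  proof -
    have "Y.tail_equal r s" using Y.boundary_classD(3)[OF c r(1)] s by blast
    then have "Y.tail_equal r (\<lambda>k. ae h (s k))" using Y.tail_equal_trans[OF h(2) tail_equal_act] by blast
    then show ?thesis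
      using Y.boundary_classD(3)[OF c r(1)] act_ray[OF h(1) Y.boundary_classD(2)[OF c s]] by blast
  qed
  have "(\<lambda>s k. ae g (s k)) ` c = c"
  proof (intro equalityI subsetI)
    fix s assume s: "s \<in> c"
    have sa: "s k \<in> arcs Y" for k by (rule Y.raysD(1)[OF Y.boundary_classD(2)[OF c s]])
    have "ae g (ae (inv g) (s k)) = s k" for k
      using E.orbit_sym_aux[OF gi sa refl, of k] g(1) by simp
    then have "s = (\<lambda>s k. ae g (s k)) (\<lambda>k. ae (inv g) (s k))" by simp
    then show "s \<in> (\<lambda>s k. ae g (s k)) ` c" using closed[OF gi te(2) s] by (rule image_eqI)
  qed (use closed[OF g(1) te(1)] in blast)
  then have "g \<in> ?HS" using cusp g(1) by (auto simp: is_cusp_def end_stabilizer_def)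
  then obtain k where k: "\<And>j. j \<ge> k \<Longrightarrow> ae g (r j) = r j"
    using horocycle_stabilizer_fixes[OF c r(1)] by blast
  let ?s = "\<lambda>j. r (n + k + j)"
  have s: "?s \<in> rays Y arev" by (rule Y.shift_ray[OF ray])
  have "?s (m - n) = ?s 0" using trans[of k] k[of "n + k"] m(1) by (simp add: add.commute)
  then have "Y.awalk (tail Y (?s 0)) (Y.seg ?s (m - n)) (tail Y (?s 0))"
    using Y.awalk_seg[OF s, of "m - n"] by simp
  from no_reduced_closed[OF this Y.reduced_seg[OF s]] show False using m(1) by (simp add: Y.seg_def)
qed

end

section \<open>The quotient graph\<close>

locale lattice_quotient = tree_action Y arev \<Gamma> av ae
  for Y :: "('v, 'e) pre_digraph" and arev :: "'e \<Rightarrow> 'e" and \<Gamma> :: "('g, 'm) monoid_scheme" (structure)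
    and av :: "'g \<Rightarrow> 'v \<Rightarrow> 'v" and ae :: "'g \<Rightarrow> 'e \<Rightarrow> 'e" +
  assumes finite_out_Y: "\<And>v. v \<in> verts Y \<Longrightarrow> finite (out_arcs Y v)"
    and no_inversion: "\<And>g e. g \<in> carrier \<Gamma> \<Longrightarrow> e \<in> arcs Y \<Longrightarrow> ae g e \<noteq> arev e"
begin

abbreviation X :: "('v set, 'e set) pre_digraph" where
  "X \<equiv> quotient_graph Y \<Gamma> av ae"

abbreviation qv :: "'v \<Rightarrow> 'v set" where "qv \<equiv> orbit \<Gamma> av"
abbreviation qe :: "'e \<Rightarrow> 'e set" where "qe \<equiv> orbit \<Gamma> ae"
abbreviation W :: "'e set \<Rightarrow> nat" where "W \<equiv> quotient_weight Y \<Gamma> av ae"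

lemma verts_X: "verts X = qv ` verts Y" and arcs_X: "arcs X = qe ` arcs Y"
  by (auto simp: quotient_graph_def orbits_def)

lemma X_ends:
  assumes "e \<in> arcs Y"
  shows "tail X (qe e) = qv (tail Y e)" "head X (qe e) = qv (head Y e)"
  using act_arc[OF _ assms] by (auto simp: quotient_graph_def orbit_def image_iff) metis+

lemma X_rev: "e \<in> arcs Y \<Longrightarrow> arev ` qe e = qe (arev e)"
  using act_arc(4)[of _ e] by (auto simp: orbit_def image_iff) metis+

lemma wf_X: "wf_digraph X"
  by unfold_locales (auto simp: arcs_X verts_X X_ends)

lemma X_rev_props:
  assumes "a \<in> arcs X"
  shows "arev ` a \<in> arcs X \<and> arev ` a \<noteq> a \<and> arev ` (arev ` a) = a \<and>
    tail X (arev ` a) = head X a \<and> head X (arev ` a) = tail X a"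
proof -
  obtain e where e: "e \<in> arcs Y" "a = qe e" using assms by (auto simp: arcs_X)
  have "qe (arev e) \<noteq> qe e"
  proof
    assume "qe (arev e) = qe e"
    then obtain g where "g \<in> carrier \<Gamma>" "ae g e = arev e"
      using E.orbit_eq_iff[of e "arev e"] e(1) by auto
    then show False using no_inversion e(1) by blast
  qed
  then show ?thesis using e by (auto simp: X_rev X_ends arcs_X)
qed

lemma edge_weight_eq:
  assumes e: "e \<in> arcs Y"
  shows "edge_weight Y \<Gamma> av ae e = card (qe e \<inter> out_arcs Y (tail Y e))"
proof -
  have "(\<lambda>g. ae g e) ` stabilizer \<Gamma> av (tail Y e) = qe e \<inter> out_arcs Y (tail Y e)"
    using act_arc[OF _ e] by (auto simp: stabilizer_def orbit_def out_arcs_def)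
  then show ?thesis by (simp add: edge_weight_def)
qed

lemma edge_weight_act:
  assumes e: "e \<in> arcs Y" and g: "g \<in> carrier \<Gamma>"
  shows "edge_weight Y \<Gamma> av ae (ae g e) = edge_weight Y \<Gamma> av ae e"
proof -
  interpret group \<Gamma> by (rule group)
  let ?A = "qe e \<inter> out_arcs Y (tail Y e)"
  have gi: "inv g \<in> carrier \<Gamma>" using g by simp
  have "ae g ` ?A = qe e \<inter> out_arcs Y (av g (tail Y e))"
  proof (intro equalityI subsetI)
    fix f assume "f \<in> ae g ` ?A"
    then obtain f' where f': "f' \<in> qe e" "f' \<in> arcs Y" "tail Y f' = tail Y e" "f = ae g f'" by auto
    have "f \<in> qe f'" unfolding f'(4) orbit_def using g by blast
    moreover have "qe f' = qe e" using f'(1) E.orbit_image[OF _ e] unfolding orbit_def by force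
    ultimately show "f \<in> qe e \<inter> out_arcs Y (av g (tail Y e))"
      using f' act_arc[OF g f'(2)] by (simp add: out_arcs_def)
  next
    fix f assume f: "f \<in> qe e \<inter> out_arcs Y (av g (tail Y e))"
    then have fa: "f \<in> arcs Y" "tail Y f = av g (tail Y e)" by auto
    have "qe f = qe e" using f E.orbit_image[OF _ e] unfolding orbit_def by force
    then have "ae (inv g) f \<in> qe e" using gi unfolding orbit_def by blast
    moreover have "tail Y (ae (inv g) f) = tail Y e"
      using act_arc(2)[OF gi fa(1)] fa(2) V.orbit_sym_aux[OF g _ refl, of "tail Y e"] e by simp
    moreover have "ae g (ae (inv g) f) = f" using E.orbit_sym_aux[OF gi fa(1) refl] g by simp
    ultimately show "f \<in> ae g ` ?A"
      using act_arc(1)[OF gi fa(1)] by (intro image_eqI[of _ _ "ae (inv g) f"]) auto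
  qed
  moreover have "inj_on (ae g) ?A"
    using act_arc_inj[OF g] by (auto intro!: inj_onI)
  ultimately have "card (qe e \<inter> out_arcs Y (av g (tail Y e))) = card ?A" by (metis card_image)
  then show ?thesis
    using edge_weight_eq[OF e] edge_weight_eq[OF act_arc(1)[OF g e]] act_arc(2)[OF g e] E.orbit_image[OF g e] by simp
qed

lemma W_eq: "e \<in> arcs Y \<Longrightarrow> W (qe e) = edge_weight Y \<Gamma> av ae e"
  unfolding quotient_weight_def
proof (rule class_value_eqI)
  assume e: "e \<in> arcs Y"
  show "edge_weight Y \<Gamma> av ae f = edge_weight Y \<Gamma> av ae e" if "f \<in> qe e" for f
    using that edge_weight_act[OF e] unfolding orbit_def by blast
  show "e \<in> qe e" by (rule E.orbit_refl[OF e])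
qed

lemma W_pos: "a \<in> arcs X \<Longrightarrow> 0 < W a"
proof -
  assume "a \<in> arcs X"
  then obtain e where e: "e \<in> arcs Y" "a = qe e" by (auto simp: arcs_X)
  have "e \<in> qe e \<inter> out_arcs Y (tail Y e)" using E.orbit_refl[OF e(1)] e(1) by auto
  moreover have "finite (qe e \<inter> out_arcs Y (tail Y e))" using finite_out_Y e(1) by auto
  ultimately have "0 < card (qe e \<inter> out_arcs Y (tail Y e))" unfolding card_gt_0_iff by blast
  then show ?thesis using W_eq[OF e(1)] edge_weight_eq[OF e(1)] e(2) by simp
qed

lemma out_arcs_X:
  assumes y: "y \<in> verts Y"
  shows "out_arcs X (qv y) = qe ` out_arcs Y y"
proof (intro equalityI subsetI)
  fix a assume "a \<in> out_arcs X (qv y)"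
  then obtain e where e: "e \<in> arcs Y" "a = qe e" "qv (tail Y e) = qv y"
    by (auto simp: arcs_X X_ends)
  then obtain g where g: "g \<in> carrier \<Gamma>" "av g (tail Y e) = y"
    using V.orbit_eq_iff[of "tail Y e" y] y by auto
  then show "a \<in> qe ` out_arcs Y y"
    using e act_arc[OF g(1) e(1)] E.orbit_image[OF g(1) e(1)] by (intro image_eqI[of _ _ "ae g e"]) auto
next
  fix a assume "a \<in> qe ` out_arcs Y y"
  then show "a \<in> out_arcs X (qv y)" by (auto simp: arcs_X X_ends)
qed

text \<open>
  An edge of the quotient stands for as many edges at a given vertex of the tree as its weight says.
\<close>

lemma sum_out_arcs_X:
  fixes h :: "'e set \<Rightarrow> 'a::comm_semiring_1"
  assumes y: "y \<in> verts Y"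
  shows "(\<Sum>a\<in>out_arcs X (qv y). of_nat (W a) * h a) = (\<Sum>e\<in>out_arcs Y y. h (qe e))"
proof -
  have "(\<Sum>e\<in>out_arcs Y y. h (qe e)) = (\<Sum>a\<in>qe ` out_arcs Y y. \<Sum>e | e \<in> out_arcs Y y \<and> qe e = a. h (qe e))"
    using finite_out_Y[OF y] by (intro sum.group[symmetric]) auto
  also have "\<dots> = (\<Sum>a\<in>qe ` out_arcs Y y. of_nat (W a) * h a)"
  proof (intro sum.cong refl)
    fix a assume "a \<in> qe ` out_arcs Y y"
    then obtain e0 where e0: "e0 \<in> arcs Y" "tail Y e0 = y" "a = qe e0" by auto
    have "{e. e \<in> out_arcs Y y \<and> qe e = a} = qe e0 \<inter> out_arcs Y (tail Y e0)"
    proof (intro equalityI subsetI)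
      fix e assume "e \<in> {e. e \<in> out_arcs Y y \<and> qe e = a}"
      then show "e \<in> qe e0 \<inter> out_arcs Y (tail Y e0)" using e0 E.orbit_refl[of e] by auto
    next
      fix e assume e: "e \<in> qe e0 \<inter> out_arcs Y (tail Y e0)"
      then have "qe e = qe e0" using E.orbit_image[OF _ e0(1)] unfolding orbit_def by force
      then show "e \<in> {e. e \<in> out_arcs Y y \<and> qe e = a}" using e e0 by simp
    qed
    then have "card {e. e \<in> out_arcs Y y \<and> qe e = a} = W a"
      using W_eq[OF e0(1)] edge_weight_eq[OF e0(1)] e0(3) by simp
    then show "(\<Sum>e | e \<in> out_arcs Y y \<and> qe e = a. h (qe e)) = of_nat (W a) * h a" by simp
  qed
  finally show ?thesis unfolding out_arcs_X[OF y] ..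
qed

lemma sum_W: "y \<in> verts Y \<Longrightarrow> (\<Sum>a\<in>out_arcs X (qv y). W a) = val Y y"
  using sum_out_arcs_X[of y "\<lambda>_. 1 :: nat"] by (simp add: out_degree_def)

lemma adjacency_op_eq:
  assumes y: "y \<in> verts Y"
  shows "adjacency_op Y f y = (\<Sum>e\<in>out_arcs Y y. f (head Y e))"
proof -
  have "inj_on (head Y) (out_arcs Y y)"
  proof (rule inj_onI)
    fix e e' assume e: "e \<in> out_arcs Y y" "e' \<in> out_arcs Y y" "head Y e = head Y e'"
    have "[e] = [e']"
      by (rule Y.reduced_walk_unique[where u = y and v = "head Y e", OF no_reduced_closed])
         (use e in \<open>auto simp: Y.awalk_Cons_iff Y.awalk_Nil_iff reduced_def\<close>)
    then show "e = e'" by simp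
  qed
  moreover have "head Y ` out_arcs Y y = {y'. y' \<rightarrow>\<^bsub>Y\<^esub> y}"
  proof (intro equalityI subsetI)
    fix y' assume "y' \<in> head Y ` out_arcs Y y"
    then obtain e where "e \<in> arcs Y" "tail Y e = y" "head Y e = y'" by auto
    then have "arev e \<in> arcs Y" "(tail Y (arev e), head Y (arev e)) = (y', y)" by auto
    then show "y' \<in> {y'. y' \<rightarrow>\<^bsub>Y\<^esub> y}" unfolding arcs_ends_conv by force
  next
    fix y' assume "y' \<in> {y'. y' \<rightarrow>\<^bsub>Y\<^esub> y}"
    then obtain e where "e \<in> arcs Y" "tail Y e = y'" "head Y e = y" by auto
    then show "y' \<in> head Y ` out_arcs Y y" by (intro image_eqI[of _ _ "arev e"]) auto
  qed
  ultimately show ?thesis by (simp add: adjacency_op_def sum.reindex flip: \<open>head Y ` out_arcs Y y = {y'. y' \<rightarrow>\<^bsub>Y\<^esub> y}\<close>)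
qed

lemma qv_eq_iff: "x \<in> verts Y \<Longrightarrow> y \<in> verts Y \<Longrightarrow> x \<in> qv y \<Longrightarrow> qv x = qv y"
  using V.orbit_image[of _ y] unfolding orbit_def by force

lemma qv_subset: "y \<in> verts Y \<Longrightarrow> qv y \<subseteq> verts Y"
  using act_vert by (auto simp: orbit_def)

lemma induced_adjacency:
  assumes y: "y \<in> verts Y"
  shows "induced_op \<Gamma> av (adjacency_op Y) f (qv y) = (\<Sum>a\<in>out_arcs X (qv y). of_nat (W a) * f (head X a))"
proof -
  have *: "adjacency_op Y (\<lambda>y. f (qv y)) z = (\<Sum>a\<in>out_arcs X (qv z). of_nat (W a) * f (head X a))"
    if z: "z \<in> verts Y" for z
    unfolding sum_out_arcs_X[OF z] adjacency_op_eq[OF z] by (intro sum.cong refl) (simp add: X_ends)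
  show ?thesis
    unfolding induced_op_def *[OF y, symmetric]
  proof (rule class_value_eqI)
    fix x assume x: "x \<in> qv y"
    then have "x \<in> verts Y" using qv_subset[OF y] by auto
    then show "adjacency_op Y (\<lambda>y. f (qv y)) x = adjacency_op Y (\<lambda>y. f (qv y)) y"
      using * y qv_eq_iff[OF _ y x] by simp
  qed (rule V.orbit_refl[OF y])
qed

lemma induced_valency:
  assumes y: "y \<in> verts Y"
  shows "induced_op \<Gamma> av (valency_op Y) f (qv y) = (of_nat (val Y y) - 1) * f (qv y)"
proof -
  have "induced_op \<Gamma> av (valency_op Y) f (qv y) = valency_op Y (\<lambda>y. f (qv y)) y"
    unfolding induced_op_def
  proof (rule class_value_eqI)
    fix x assume x: "x \<in> qv y"
    then have xv: "x \<in> verts Y" using qv_subset[OF y] by auto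
    then show "valency_op Y (\<lambda>y. f (qv y)) x = valency_op Y (\<lambda>y. f (qv y)) y"
      using qv_eq_iff[OF xv y x] sum_W[OF xv] sum_W[OF y] by (simp add: valency_op_def)
  qed (rule V.orbit_refl[OF y])
  then show ?thesis by (simp add: valency_op_def)
qed

lemma ihara_op_entry:
  assumes y: "y \<in> verts Y"
  shows "entry (ihara_op Y \<Gamma> av u) (qv y) j =
    (if qv y = j then 1 + u\<^sup>2 * (of_nat (val Y y) - 1) else 0)
     - u * (\<Sum>a | a \<in> arcs X \<and> tail X a = qv y \<and> head X a = j. of_nat (W a))"
proof -
  have fin: "finite (out_arcs X (qv y))" using finite_out_Y[OF y] out_arcs_X[OF y] by simp
  have "(\<Sum>a\<in>out_arcs X (qv y). of_nat (W a) * indicator {j} (head X a)) =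
      (\<Sum>a\<in>out_arcs X (qv y). if head X a = j then of_nat (W a) else (0 :: complex))"
    by (intro sum.cong refl) (auto simp: indicator_def)
  also have "\<dots> = (\<Sum>a | a \<in> out_arcs X (qv y) \<and> head X a = j. of_nat (W a))"
    by (rule sum.inter_filter[OF fin, symmetric])
  also have "{a. a \<in> out_arcs X (qv y) \<and> head X a = j} = {a. a \<in> arcs X \<and> tail X a = qv y \<and> head X a = j}"
    by auto
  finally have A: "(\<Sum>a\<in>out_arcs X (qv y). of_nat (W a) * indicator {j} (head X a)) =
      (\<Sum>a | a \<in> arcs X \<and> tail X a = qv y \<and> head X a = j. of_nat (W a) :: complex)" .
  show ?thesis
    unfolding entry_def ihara_op_def induced_adjacency[OF y] induced_valency[OF y] A
    by (simp add: indicator_def)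
qed

lemma X_connected:
  assumes M: "M \<subseteq> verts X" "M \<noteq> {}" "\<And>a. a \<in> arcs X \<Longrightarrow> tail X a \<in> M \<Longrightarrow> head X a \<in> M"
  shows "M = verts X"
proof -
  obtain v where v: "v \<in> verts Y" "qv v \<in> M" using M(1,2) by (auto simp: verts_X)
  have step: "qv v' \<in> M" if "Y.awalk v p v'" "qv v \<in> M" for v p v'
    using that
  proof (induction p arbitrary: v)
    case (Cons e p)
    then have e: "e \<in> arcs Y" "tail Y e = v" "Y.awalk (head Y e) p v'" by (auto simp: Y.awalk_Cons_iff)
    have "head X (qe e) \<in> M" by (rule M(3)) (use e Cons.prems in \<open>auto simp: arcs_X X_ends\<close>)
    then show ?case using Cons.IH[OF e(3)] e(1) by (simp add: X_ends)
  qed (simp add: Y.awalk_Nil_iff)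
  have "qv v' \<in> M" if "v' \<in> verts Y" for v'
  proof -
    have "v \<rightarrow>\<^sup>*\<^bsub>Y\<^esub> v'" using is_tree v that by (auto simp: is_tree_def strongly_connected_def)
    then obtain p where "Y.awalk v p v'" using Y.reachable_awalk by blast
    then show ?thesis using step v by blast
  qed
  then show ?thesis using M(1) by (auto simp: verts_X)
qed

end

text \<open>
  The valency is constant on the finitely many orbits of the automorphism group.
\<close>

lemma uniform_bounded_valency:
  assumes "uniform Y arev" and wf: "wf_digraph Y"
  shows "\<exists>D. \<forall>v\<in>verts Y. val Y v \<le> D"
proof -
  let ?O = "\<lambda>v. {f v | f h. graph_aut Y arev f h}"
  have val: "val Y (f v) = val Y v" if a: "graph_aut Y arev f h" and v: "v \<in> verts Y" for f h v
  proof -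
    have f: "bij_betw f (verts Y) (verts Y)" and h: "bij_betw h (arcs Y) (arcs Y)"
      and th: "\<And>e. e \<in> arcs Y \<Longrightarrow> tail Y (h e) = f (tail Y e)" using a by (auto simp: graph_aut_def)
    have "h ` out_arcs Y v = out_arcs Y (f v)"
    proof (intro equalityI subsetI)
      fix e assume "e \<in> h ` out_arcs Y v"
      then show "e \<in> out_arcs Y (f v)" using th bij_betwE[OF h] by auto
    next
      fix e assume e: "e \<in> out_arcs Y (f v)"
      then have "e \<in> h ` arcs Y" using bij_betw_imp_surj_on[OF h] by simp
      then obtain e' where e': "e' \<in> arcs Y" "h e' = e" by auto
      then have "f (tail Y e') = f v" using th e by auto
      then have "tail Y e' = v"
        using inj_onD[OF bij_betw_imp_inj_on[OF f] _ wf_digraph.tail_in_verts[OF wf e'(1)] v] by simp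
      then show "e \<in> h ` out_arcs Y v" using e' by auto
    qed
    moreover have "inj_on h (out_arcs Y v)"
      using h by (auto simp: bij_betw_def intro: inj_on_subset)
    ultimately show ?thesis unfolding out_degree_def by (metis card_image)
  qed
  have single: "val Y ` ?O v = {val Y v}" if "v \<in> verts Y" for v
  proof -
    have "graph_aut Y arev id id" by (simp add: graph_aut_def)
    then have "id v \<in> ?O v" by blast
    then show ?thesis using val[OF _ that] by auto
  qed
  have "val Y ` verts Y \<subseteq> (\<lambda>O'. the_elem (val Y ` O')) ` {?O v | v. v \<in> verts Y}"
  proof (intro subsetI, elim imageE)
    fix n v assume v: "n = val Y v" "v \<in> verts Y"
    then have "n = the_elem (val Y ` ?O v)"
      using single[OF v(2)] by simp
    then show "n \<in> (\<lambda>O'. the_elem (val Y ` O')) ` {?O v | v. v \<in> verts Y}" using v(2) by blast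
  qed
  moreover have "finite {?O v | v. v \<in> verts Y}" using assms(1) by (simp add: uniform_def)
  ultimately have "finite (val Y ` verts Y)" by (meson finite_imageI finite_subset)
  then show ?thesis using finite_nat_set_iff_bounded_le by auto
qed

section \<open>Cuspidal tree lattices\<close>

context lattice_quotient
begin

lemma cusp_section_weight:
  assumes cusp: "is_cusp Y arev \<Gamma> av ae c" and r: "r \<in> c"
    and inj: "inj (\<lambda>n. tail X (qe (r n)))"
  shows "\<exists>n0. \<forall>n\<ge>n0. W (qe (r n)) = 1"
proof -
  have c: "c \<in> tree_boundary Y arev" using cusp by (simp add: is_cusp_def)
  have arc: "r n \<in> arcs Y" for n by (rule Y.raysD(1)[OF Y.boundary_classD(2)[OF c r]])
  have "inj (\<lambda>n. qv (tail Y (r n)))" using inj by (simp add: X_ends[OF arc])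
  from cusp_ray_eventually_fixed[OF cusp r this] obtain n0 where
    n0: "\<And>n g. n \<ge> n0 \<Longrightarrow> g \<in> carrier \<Gamma> \<Longrightarrow> av g (tail Y (r n)) = tail Y (r n) \<Longrightarrow> ae g (r n) = r n" by blast
  have "W (qe (r n)) = 1" if n: "n \<ge> n0" for n
  proof -
    have one: "\<one> \<in> stabilizer \<Gamma> av (tail Y (r n))" using arc by (intro V.stabilizer_one_closed) simp
    have "(\<lambda>g. ae g (r n)) ` stabilizer \<Gamma> av (tail Y (r n)) = (\<lambda>g. r n) ` stabilizer \<Gamma> av (tail Y (r n))"
      using n0[OF n] by (intro image_cong refl) (simp add: stabilizer_def)
    also have "\<dots> = {r n}" using one by blast
    finally have "(\<lambda>g. ae g (r n)) ` stabilizer \<Gamma> av (tail Y (r n)) = {r n}" .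
    then show ?thesis by (simp add: W_eq[OF arc] edge_weight_def)
  qed
  then show ?thesis by blast
qed

end

text \<open>
  From level \<open>n0\<close> on, the edges along the sections have weight \<open>1\<close>; this is where the rays of the
  cusp graph start. The vertices and edges before that level are moved to its finite part.
\<close>

locale cuspidal_quotient = lattice_quotient Y arev \<Gamma> av ae
  for Y :: "('v, 'e) pre_digraph" and arev :: "'e \<Rightarrow> 'e" and \<Gamma> :: "('g, 'm) monoid_scheme" (structure)
    and av :: "'g \<Rightarrow> 'v \<Rightarrow> 'v" and ae :: "'g \<Rightarrow> 'e \<Rightarrow> 'e" +
  fixes F :: "('v set, 'e set) pre_digraph" and S :: "(nat \<Rightarrow> 'e set) set" and D :: nat and n0 :: nat
  assumes decomposition: "cuspidal_decomposition Y arev \<Gamma> av ae F S"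
    and val_le: "\<And>v. v \<in> verts Y \<Longrightarrow> val Y v \<le> D"
    and weight_one: "\<And>s n. s \<in> S \<Longrightarrow> n \<ge> n0 \<Longrightarrow> quotient_weight Y \<Gamma> av ae (s n) = 1"
begin

lemma F_props:
  shows "subgraph F X" "finite (verts F)" "finite (arcs F)" "finite S"
    "verts X = verts F \<union> (\<Union>s\<in>S. section_verts X s)"
    "arcs X = arcs F \<union> (\<Union>s\<in>S. section_arcs ((`) arev) s)"
    "\<And>s. s \<in> S \<Longrightarrow> inj (\<lambda>n. tail X (s n))"
    "\<And>s. s \<in> S \<Longrightarrow> section_verts X s \<inter> verts F = {tail X (s 0)}"
    "\<And>s s'. s \<in> S \<Longrightarrow> s' \<in> S \<Longrightarrow> s \<noteq> s' \<Longrightarrow> section_verts X s \<inter> section_verts X s' = {}"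
    "S \<subseteq> periodic_cusp_sections Y arev \<Gamma> av ae"
  using decomposition unfolding cuspidal_decomposition_def Let_def by simp_all

lemma section_ray:
  assumes "s \<in> S"
  shows "s n \<in> arcs X" "head X (s n) = tail X (s (Suc n))"
proof -
  obtain r c where rc: "s = (\<lambda>n. qe (r n))" "is_cusp Y arev \<Gamma> av ae c" "r \<in> c"
    using F_props(10) assms by (auto simp: periodic_cusp_sections_def)
  then have ray: "r \<in> rays Y arev" using Y.boundary_classD(2) by (auto simp: is_cusp_def)
  show "s n \<in> arcs X" using Y.raysD(1)[OF ray] by (simp add: rc(1) arcs_X)
  show "head X (s n) = tail X (s (Suc n))"
    using Y.raysD(1,2)[OF ray] by (simp add: rc(1) X_ends)
qed

definition section_vert :: "(nat \<Rightarrow> 'e set) \<Rightarrow> nat \<Rightarrow> 'v set" where "section_vert s n = tail X (s n)"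

lemma section_tail: "tail X (s n) = section_vert s n" by (simp add: section_vert_def)

lemma section_head: "s \<in> S \<Longrightarrow> head X (s n) = section_vert s (Suc n)" using section_ray by (simp add: section_vert_def)

lemma section_vert_inj:
  assumes "s \<in> S" "s' \<in> S" "section_vert s n = section_vert s' m"
  shows "s = s' \<and> n = m"
proof -
  have "section_vert s n \<in> section_verts X s" "section_vert s' m \<in> section_verts X s'"
    by (auto simp: section_vert_def section_verts_def)
  then have "s = s'" using F_props(9)[OF assms(1,2)] assms(3) by auto
  then show ?thesis using injD[OF F_props(7)[OF assms(1)], of n m] assms(3) by (simp add: section_vert_def)
qed

lemma section_vert_in_F_iff: "s \<in> S \<Longrightarrow> section_vert s n \<in> verts F \<longleftrightarrow> n = 0"
proof -
  assume s: "s \<in> S"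
  have 1: "section_vert s n \<in> section_verts X s" "section_vert s 0 \<in> section_verts X s" by (auto simp: section_vert_def section_verts_def)
  have "section_vert s 0 \<in> verts F" using F_props(8)[OF s] by (auto simp: section_vert_def)
  moreover have "n = 0" if "section_vert s n \<in> verts F"
  proof -
    have "section_vert s n = section_vert s 0" using F_props(8)[OF s] 1 that by (auto simp: section_vert_def)
    then show ?thesis using section_vert_inj[OF s s] by simp
  qed
  ultimately show ?thesis by auto
qed

lemma F_arc_ends: "a \<in> arcs F \<Longrightarrow> tail X a \<in> verts F \<and> head X a \<in> verts F"
  using F_props(1) by (auto simp: subgraph_def compatible_def wf_digraph_def)

definition V0 :: "'v set set" where
  "V0 = verts F \<union> {section_vert s j | s j. s \<in> S \<and> j \<le> n0}"

lemma section_vert_in_V0_iff: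
  assumes s: "s \<in> S"
  shows "section_vert s n \<in> V0 \<longleftrightarrow> n \<le> n0"
proof
  assume "section_vert s n \<in> V0"
  then consider "n = 0" | s' j where "s' \<in> S" "j \<le> n0" "section_vert s n = section_vert s' j"
    using section_vert_in_F_iff[OF s] by (auto simp: V0_def)
  then show "n \<le> n0" using section_vert_inj[OF s] by cases auto
qed (use s in \<open>auto simp: V0_def\<close>)

lemma finite_V0: "finite V0"
proof -
  have "{section_vert s j | s j. s \<in> S \<and> j \<le> n0} = (\<lambda>(s, j). section_vert s j) ` (S \<times> {..n0})" by auto
  then show ?thesis using F_props(2,4) by (simp add: V0_def)
qed

lemma section_arcs_out:
  assumes s: "s \<in> S" and a: "a \<in> arcs X" "tail X a = section_vert s (Suc n)"
  shows "a = s (Suc n) \<or> a = arev ` s n"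
proof -
  have "a \<notin> arcs F" using F_arc_ends[of a] a(2) section_vert_in_F_iff[OF s, of "Suc n"] by auto
  then obtain s' where s': "s' \<in> S" "a \<in> section_arcs ((`) arev) s'" using a(1) F_props(6) by blast
  then obtain k where "a = s' k \<or> a = arev ` s' k" by (auto simp: section_arcs_def)
  then show ?thesis
  proof
    assume "a = s' k"
    then show ?thesis using section_vert_inj[OF s'(1) s, of k "Suc n"] a(2) by (simp add: section_tail)
  next
    assume *: "a = arev ` s' k"
    then have "tail X a = section_vert s' (Suc k)"
      using X_rev_props[OF section_ray(1)[OF s'(1)], of k] section_head[OF s'(1), of k] by simp
    then show ?thesis using section_vert_inj[OF s'(1) s, of "Suc k" "Suc n"] a(2) * by simp
  qed
qed

sublocale cusp_graph X "(`) arev" W V0 S "\<lambda>s n. section_vert s (n0 + n)" "\<lambda>s n. s (n0 + n)" D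
proof (rule cusp_graph.intro[OF wf_X], unfold_locales)
  show "arev ` a \<in> arcs X \<and> arev ` a \<noteq> a \<and> arev ` (arev ` a) = a \<and>
      tail X (arev ` a) = head X a \<and> head X (arev ` a) = tail X a" if "a \<in> arcs X" for a
    by (rule X_rev_props[OF that])
  show "0 < W a" if "a \<in> arcs X" for a by (rule W_pos[OF that])
  show "finite V0" "finite S" by (rule finite_V0, rule F_props(4))
  show "finite (out_arcs X v)" if "v \<in> verts X" for v
    using that finite_out_Y by (auto simp: verts_X out_arcs_X)
  show "(\<Sum>a\<in>out_arcs X v. W a) \<le> D" if "v \<in> verts X" for v
    using that sum_W val_le by (auto simp: verts_X)
  show "verts X = V0 \<union> (\<Union>s\<in>S. range (\<lambda>n. section_vert s (n0 + n)))"
  proof -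
    have "section_verts X s = {section_vert s j | j. j \<le> n0} \<union> range (\<lambda>n. section_vert s (n0 + n))" for s
    proof (intro equalityI subsetI)
      fix v assume "v \<in> section_verts X s"
      then obtain j where j: "v = section_vert s j" by (auto simp: section_verts_def section_vert_def)
      show "v \<in> {section_vert s j | j. j \<le> n0} \<union> range (\<lambda>n. section_vert s (n0 + n))"
      proof (cases "j \<le> n0")
        case False
        then have "v = section_vert s (n0 + (j - n0))" using j by simp
        then show ?thesis by blast
      qed (use j in blast)
    qed (auto simp: section_verts_def section_vert_def)
    then show ?thesis unfolding F_props(5) V0_def by auto
  qed
  show "s = s' \<and> n = m" if "s \<in> S" "s' \<in> S" "section_vert s (n0 + n) = section_vert s' (n0 + m)" for s s' n m
    using section_vert_inj[OF that] by simp
  show "section_vert s (n0 + 0) \<in> V0" if "s \<in> S" for s using section_vert_in_V0_iff[OF that, of n0] by simp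
  show "section_vert s (n0 + Suc n) \<notin> V0" if "s \<in> S" for s n using section_vert_in_V0_iff[OF that, of "n0 + Suc n"] by simp
  show "s (n0 + n) \<in> arcs X \<and> tail X (s (n0 + n)) = section_vert s (n0 + n) \<and> head X (s (n0 + n)) = section_vert s (n0 + Suc n)"
    if "s \<in> S" for s n using section_ray(1)[OF that] section_head[OF that, of "n0 + n"] by (simp add: section_tail)
  show "W (s (n0 + n)) = 1" if "s \<in> S" for s n by (rule weight_one[OF that]) simp
  show "a = s (n0 + Suc n) \<or> a = arev ` s (n0 + n)"
    if "s \<in> S" "a \<in> arcs X" "tail X a = section_vert s (n0 + Suc n)" for s a n
    using section_arcs_out[OF that(1,2), of "n0 + n"] that(3) by simp
  show "M = verts X" if "M \<subseteq> verts X" "M \<noteq> {}" "\<And>a. a \<in> arcs X \<Longrightarrow> tail X a \<in> M \<Longrightarrow> head X a \<in> M" for M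
    by (rule X_connected[OF that])
qed

lemma ihara_op_realizes: "u \<noteq> 0 \<Longrightarrow> realizes (ihara_op Y \<Gamma> av u) u"
  unfolding realizes_def ihara_mat_def wval_def
  by (auto simp: verts_X ihara_op_entry sum_W[symmetric])

lemma path_weight_turn:
  assumes "p \<in> closed_paths X"
  shows "of_int (path_weight ((`) arev) W p) = cycprod turn p"
proof -
  have p: "set p \<subseteq> arcs X" "\<And>j. j < length p \<Longrightarrow> head X (p ! j) = tail X (p ! (Suc j mod length p))"
    using assms by (auto simp: closed_paths_iff[OF wf_X])
  have "of_int (turn_weight ((`) arev) W (p ! j) (p ! (Suc j mod length p))) =
      turn (p ! j) (p ! (Suc j mod length p))" if "j < length p" for j
    using p(2)[OF that] by (simp add: turn_weight_def turn_def)
  then show ?thesis by (simp add: path_weight_def cycprod_def)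
qed

lemma class_value_cycwt:
  assumes c: "c \<in> prime_cycles X"
  shows "of_int (class_value (path_weight ((`) arev) W) c) * u ^ class_value length c = class_value (cycwt u) c"
proof -
  obtain q where q: "q \<in> c" using prime_cycle_members(4)[OF c] by auto
  have mem: "length p = length q" "cycprod turn p = cycprod turn q" "p \<in> closed_paths X" if "p \<in> c" for p
    using prime_cycle_members(2)[OF c that q, of turn] prime_cycle_members(3)[OF c that] by auto
  have "class_value length c = length q"
    by (rule class_value_eqI[OF q]) (rule mem(1))
  moreover have "class_value (path_weight ((`) arev) W) c = path_weight ((`) arev) W q"
  proof (rule class_value_eqI[OF q])
    fix p assume p: "p \<in> c"
    have "(of_int (path_weight ((`) arev) W p) :: complex) = of_int (path_weight ((`) arev) W q)"
      using path_weight_turn[OF mem(3)[OF p]] path_weight_turn[OF mem(3)[OF q]] mem(2)[OF p] by simp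
    then show "path_weight ((`) arev) W p = path_weight ((`) arev) W q" by simp
  qed
  moreover have "class_value (cycwt u) c = cycwt u q"
    by (rule class_value_eqI[OF q]) (use mem in \<open>simp add: cycwt_def\<close>)
  ultimately show ?thesis by (simp add: cycwt_def path_weight_turn[OF mem(3)[OF q]])
qed

text \<open>
  Moving the beginning of a section to \<open>V0\<close> adds \<open>n0\<close> vertices, besides the initial one, and \<open>n0\<close>
  pairs of edges.
\<close>

lemma euler_number_finite_part:
  "euler_number (finite_part X ((`) arev) S) ((`) arev) = outer_chi"
proof -
  let ?VA = "verts X - (\<Union>s\<in>S. section_verts X s)"
  let ?EA = "arcs X - (\<Union>s\<in>S. section_arcs ((`) arev) s)"
  let ?pairs = "\<lambda>E. card ((\<lambda>a. {a, arev ` a}) ` E)"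
  have section_vert_mem: "section_vert s j \<in> section_verts X s" for s j by (auto simp: section_verts_def section_vert_def)
  have VA: "?VA = verts F - (\<Union>s\<in>S. section_verts X s)" unfolding F_props(5) by blast
  have V0: "V0 = ?VA \<union> (\<lambda>(s, j). section_vert s j) ` (S \<times> {..n0})"
  proof (intro equalityI subsetI)
    fix v assume v: "v \<in> V0"
    show "v \<in> ?VA \<union> (\<lambda>(s, j). section_vert s j) ` (S \<times> {..n0})"
    proof (cases "\<exists>s\<in>S. v \<in> section_verts X s")
      case True
      then obtain s j where s: "s \<in> S" "v = section_vert s j" by (auto simp: section_verts_def section_vert_def)
      then show ?thesis using section_vert_in_V0_iff v by auto
    next
      case False
      then have "v \<in> verts F" using v section_vert_mem by (auto simp: V0_def)
      then show ?thesis unfolding VA using False by blast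
    qed
  next
    fix v assume "v \<in> ?VA \<union> (\<lambda>(s, j). section_vert s j) ` (S \<times> {..n0})"
    then show "v \<in> V0" unfolding VA V0_def by auto
  qed
  have injV: "inj_on (\<lambda>(s, j). section_vert s j) (S \<times> {..n0})"
    by (rule inj_onI) (use section_vert_inj in auto)
  have "card V0 = card ?VA + card ((\<lambda>(s, j). section_vert s j) ` (S \<times> {..n0}))"
    unfolding V0 using F_props(2,4) section_vert_mem VA by (intro card_Un_disjoint) auto
  then have cV: "card V0 = card ?VA + card S * Suc n0"
    using card_image[OF injV] by (simp add: card_cartesian_product)
  let ?U = "(\<lambda>(s, j). s j) ` (S \<times> {..<n0})" and ?L = "(\<lambda>(s, j). arev ` s j) ` (S \<times> {..<n0})"
  have EA: "?EA = arcs F - (\<Union>s\<in>S. section_arcs ((`) arev) s)" unfolding F_props(6) by blast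
  have rs: "arev ` s j \<in> arcs X" "tail X (arev ` s j) = section_vert s (Suc j)" "head X (arev ` s j) = section_vert s j" if "s \<in> S" for s j
    using X_rev_props[OF section_ray(1)[OF that]] section_head[OF that] by (auto simp: section_tail)
  have trunc0: "trunc (\<lambda>_. 0) = V0" using section_vert_in_V0_iff by (auto simp: trunc_def)
  have sa: "s j \<in> section_arcs ((`) arev) s" "arev ` s j \<in> section_arcs ((`) arev) s" for s j
    by (auto simp: section_arcs_def)
  have T0: "trunc_arcs 0 = ?EA \<union> (?U \<union> ?L)"
  proof (intro equalityI subsetI)
    fix a assume "a \<in> trunc_arcs 0"
    then have a: "a \<in> arcs X" "tail X a \<in> V0" "head X a \<in> V0" by (auto simp: trunc_arcs_def trunc0)
    show "a \<in> ?EA \<union> (?U \<union> ?L)"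
    proof (cases "a \<in> ?EA")
      case False
      then obtain s j where s: "s \<in> S" "a = s j \<or> a = arev ` s j" using a(1) by (auto simp: section_arcs_def)
      then have "section_vert s (Suc j) \<in> V0" using a section_head[OF s(1)] rs[OF s(1)] by auto
      then have "j < n0" using section_vert_in_V0_iff[OF s(1)] by simp
      then show ?thesis using s by force
    qed simp
  next
    fix a assume "a \<in> ?EA \<union> (?U \<union> ?L)"
    then consider "a \<in> ?EA" | s j where "s \<in> S" "j < n0" "a = s j" | s j where "s \<in> S" "j < n0" "a = arev ` s j"
      by blast
    then show "a \<in> trunc_arcs 0"
    proof cases
      case 1
      then have "a \<in> arcs X" "a \<in> arcs F" using EA by auto
      moreover have "tail X a \<in> V0" "head X a \<in> V0" using F_arc_ends[of a] \<open>a \<in> arcs F\<close> by (auto simp: V0_def)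
      ultimately show ?thesis by (simp add: trunc_arcs_def trunc0)
    next
      case (2 s j)
      then show ?thesis using section_ray(1)[OF 2(1)] section_head[OF 2(1)] section_vert_in_V0_iff[OF 2(1)]
        by (auto simp: trunc_arcs_def trunc0 section_tail)
    next
      case (3 s j)
      then show ?thesis using rs[OF 3(1)] section_vert_in_V0_iff[OF 3(1)] by (auto simp: trunc_arcs_def trunc0)
    qed
  qed
  have injU: "inj_on (\<lambda>(s, j). s j) (S \<times> {..<n0})"
  proof (rule inj_onI, clarsimp)
    fix s j s' j' assume "s \<in> S" "s' \<in> S" "s j = s' j'"
    then show "s = s' \<and> j = j'" using section_vert_inj[of s s' j j'] by (simp add: section_vert_def)
  qed
  have injL: "inj_on (\<lambda>(s, j). arev ` s j) (S \<times> {..<n0})"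
  proof (rule inj_onI, clarsimp)
    fix s j s' j' assume s: "s \<in> S" "s' \<in> S" "arev ` s j = arev ` s' j'"
    then show "s = s' \<and> j = j'" using section_vert_inj[OF s(1,2), of j j'] rs(3)[OF s(1), of j] rs(3)[OF s(2), of j'] by simp
  qed
  have UL: "?U \<inter> ?L = {}"
  proof -
    have False if s: "s \<in> S" "s' \<in> S" "s j = arev ` s' j'" for s s' j j'
    proof -
      have "section_vert s j = section_vert s' (Suc j')" "section_vert s (Suc j) = section_vert s' j'"
        using s rs[OF s(2), of j'] section_head[OF s(1), of j] section_tail[of s j] by auto
      then have "j = Suc j'" "Suc j = j'" using section_vert_inj[OF s(1,2)] by blast+
      then show False by simp
    qed
    then show ?thesis by auto
  qed
  have "?U \<union> ?L \<subseteq> (\<Union>s\<in>S. section_arcs ((`) arev) s)" using sa by auto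
  moreover have "(A - Z) \<inter> B = {}" if "B \<subseteq> Z" for A B Z :: "'e set set" using that by blast
  ultimately have EU: "?EA \<inter> (?U \<union> ?L) = {}" by simp
  have finEA: "finite ?EA" using EA F_props(3) by simp
  have "card (trunc_arcs 0) = card ?EA + (card ?U + card ?L)"
    unfolding T0 using EU UL finEA F_props(4) by (simp add: card_Un_disjoint)
  then have cE: "card (trunc_arcs 0) = card ?EA + 2 * (card S * n0)"
    using card_image[OF injU] card_image[OF injL] by (simp add: card_cartesian_product)
  have p0: "card (trunc_arcs 0) = 2 * ?pairs (trunc_arcs 0)"
    by (rule card_edge_pairs[OF finite_trunc_arcs]) (rule trunc_arcs_rev)
  have pA: "card ?EA = 2 * ?pairs ?EA"
  proof (rule card_edge_pairs[OF finEA])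
    fix a assume a: "a \<in> ?EA"
    then have ra: "arev ` a \<in> arcs X \<and> arev ` a \<noteq> a \<and> arev ` (arev ` a) = a" using X_rev_props[of a] by simp
    have "arev ` a \<notin> section_arcs ((`) arev) s" if s: "s \<in> S" for s
    proof
      assume "arev ` a \<in> section_arcs ((`) arev) s"
      then obtain j where "arev ` a = s j \<or> arev ` a = arev ` s j" by (auto simp: section_arcs_def)
      then have "a = arev ` s j \<or> a = s j"
        using ra X_rev_props[OF section_ray(1)[OF s], of j] by metis
      then show False using a s sa by blast
    qed
    then show "arev ` a \<in> ?EA \<and> arev ` a \<noteq> a \<and> arev ` (arev ` a) = a" using ra by blast
  qed
  have "?pairs (trunc_arcs 0) = ?pairs ?EA + card S * n0" using cE p0 pA by simp
  then have "outer_chi = int (card ?VA) - int (?pairs ?EA)"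
    unfolding outer_chi_def cV by (simp add: algebra_simps)
  then show ?thesis by (simp add: euler_number_def finite_part_def)
qed

lemma cusp_imp_section:
  assumes "\<And>e. e \<in> arcs Y \<Longrightarrow> finite (stabilizer \<Gamma> ae e)" "is_cusp Y arev \<Gamma> av ae c"
  shows "S \<noteq> {}"
proof
  assume "S = {}"
  then have "finite (arcs X)" using F_props(3,6) by simp
  then have "finite (orbits \<Gamma> (arcs Y) ae)" by (simp add: quotient_graph_def)
  then show False using finite_quotient_no_cusp assms by blast
qed

end

theorem theorem5p1:
  fixes Y :: "('v, 'e) pre_digraph" and arev :: "'e \<Rightarrow> 'e"
    and \<Gamma> :: "('g, 'm) monoid_scheme"
    and av :: "'g \<Rightarrow> 'v \<Rightarrow> 'v" and ae :: "'g \<Rightarrow> 'e \<Rightarrow> 'e"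
    and F :: "('v set, 'e set) pre_digraph" and S :: "(nat \<Rightarrow> 'e set) set"
  assumes "tree_lattice Y arev \<Gamma> av ae"
    and "uniform Y arev"
    and "orientation_preserving Y arev \<Gamma> ae"
    and "cuspidal_decomposition Y arev \<Gamma> av ae F S"
  shows "\<exists>\<epsilon>>0. \<forall>u::complex. 0 < norm u \<and> norm u < \<epsilon> \<longrightarrow>
    connected_determinant_class (ihara_op Y \<Gamma> av u) (verts (quotient_graph Y \<Gamma> av ae)) \<and>
    zeta_convergent Y arev \<Gamma> av ae u \<and>
    inverse (bass_ihara_zeta Y arev \<Gamma> av ae u) =
      connected_det (ihara_op Y \<Gamma> av u) (verts (quotient_graph Y \<Gamma> av ae)) /
      (1 - u\<^sup>2) powi euler_number (finite_part (quotient_graph Y \<Gamma> av ae) ((`) arev) S) ((`) arev) \<and>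
    ((\<exists>c. is_cusp Y arev \<Gamma> av ae c) \<longrightarrow>
      \<not> determinant_class (ihara_op Y \<Gamma> av u) (verts (quotient_graph Y \<Gamma> av ae)))"
proof -
  have tl: "is_tree Y arev" "locally_finite Y" "graph_action Y arev \<Gamma> av ae"
    "\<And>e. e \<in> arcs Y \<Longrightarrow> finite (stabilizer \<Gamma> ae e)"
    using assms(1) by (auto simp: tree_lattice_def)
  interpret lattice_quotient Y arev \<Gamma> av ae
    using tl assms(3) by unfold_locales (auto simp: locally_finite_def orientation_preserving_def)
  obtain D where D: "\<And>v. v \<in> verts Y \<Longrightarrow> val Y v \<le> D"
    using uniform_bounded_valency[OF assms(2) Y.wf_digraph] by blast
  have S: "finite S" "S \<subseteq> periodic_cusp_sections Y arev \<Gamma> av ae" "\<And>s. s \<in> S \<Longrightarrow> inj (\<lambda>n. tail X (s n))"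
    using assms(4) unfolding cuspidal_decomposition_def Let_def by simp_all
  have "\<exists>m. \<forall>n\<ge>m. W (s n) = 1" if s: "s \<in> S" for s
  proof -
    obtain r c where rc: "s = (\<lambda>n. qe (r n))" "is_cusp Y arev \<Gamma> av ae c" "r \<in> c"
      using S(2) s by (auto simp: periodic_cusp_sections_def)
    then show ?thesis using cusp_section_weight[OF rc(2,3)] S(3)[OF s] by simp
  qed
  then obtain m where m: "\<And>s n. s \<in> S \<Longrightarrow> n \<ge> m s \<Longrightarrow> W (s n) = 1" by metis
  define n0 where "n0 = Max (insert 0 (m ` S))"
  have "m s \<le> n0" if "s \<in> S" for s unfolding n0_def using S(1) that by (intro Max_ge) auto
  then have n0: "W (s n) = 1" if "s \<in> S" "n \<ge> n0" for s n using m that order_trans by blast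
  interpret cuspidal_quotient Y arev \<Gamma> av ae F S D n0
    using assms(4) D n0 by unfold_locales auto
  \<comment> \<open>The bound gives \<open>norm u * D < 1\<close>, for the convergence of the series and the determinants, and
    \<open>norm u < 1\<close>, for \<open>1 - u\<^sup>2 \<noteq> 0\<close>.\<close>
  show ?thesis
  proof (intro exI[of _ "1 / (real D + 2)"] conjI allI impI)
    show "0 < 1 / (real D + 2)" by simp
    fix u :: complex assume u: "0 < norm u \<and> norm u < 1 / (real D + 2)"
    let ?T = "ihara_op Y \<Gamma> av u" and ?A = "finite_subsets_at_top (prime_cycles X)"
    have "norm u * (real D + 2) < 1" using u by (simp add: field_simps)
    then have uD: "norm u * D + 2 * norm u < 1" by (simp add: algebra_simps)
    then have small: "norm u * D < 1" "norm u < 1"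
      using u mult_nonneg_nonneg[of "norm u" "real D"] by (simp_all, linarith+)
    have r: "realizes ?T u" using u by (intro ihara_op_realizes) auto
    note main = zeta_determinant_formula[OF r small]
    obtain z where z: "z \<noteq> 0"
      "((\<lambda>C. \<Prod>c\<in>C. inverse (1 - class_value (cycwt u) c)) \<longlongrightarrow> z) ?A"
      "inverse z = connected_det ?T (verts X) / (1 - u\<^sup>2) powi outer_chi"
      using main(2) by blast
    have lim: "(zeta_partial Y arev \<Gamma> av ae u \<longlongrightarrow> z) ?A"
      using z(2)
    proof (rule Lim_transform_eventually)
      show "\<forall>\<^sub>F C in ?A. (\<Prod>c\<in>C. inverse (1 - class_value (cycwt u) c)) = zeta_partial Y arev \<Gamma> av ae u C"
        by (rule eventually_finite_subsets_at_top_weakI)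
           (auto simp: zeta_partial_def class_value_cycwt subset_iff intro!: prod.cong)
    qed
    show "connected_determinant_class ?T (verts X)" by (rule main(1))
    show "zeta_convergent Y arev \<Gamma> av ae u" unfolding zeta_convergent_def using z(1) lim by blast
    have "bass_ihara_zeta Y arev \<Gamma> av ae u = z"
      unfolding bass_ihara_zeta_def by (rule tendsto_Lim[OF _ lim]) simp
    then show "inverse (bass_ihara_zeta Y arev \<Gamma> av ae u) = connected_det ?T (verts X) /
        (1 - u\<^sup>2) powi euler_number (finite_part X ((`) arev) S) ((`) arev)"
      using z(3) by (simp add: euler_number_finite_part)
    assume "\<exists>c. is_cusp Y arev \<Gamma> av ae c"
    then have "S \<noteq> {}" using cusp_imp_section tl(4) by blast
    then show "\<not> determinant_class ?T (verts X)" by (rule main(3))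
  qed
qed

end
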